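(* Let $\Omega\subset M$ be an open set. If the Gaussian curvature function $\kappa$ is not constant on $\Omega$, then $$\dim H^1_{\mathrm{kf}}(\Omega,T)\le 1.$$ Moreover, if there is a point $o\in\Omega$ such that $$[\langle Q\nabla\kappa,\nabla\Delta\kappa\rangle]^2+[D^2\kappa(\nabla\kappa,Q\nabla\kappa)]^2>0\quad\text{at } o,$$ then $H^1_{\mathrm{kf}}(\Omega,T)=\{0\}$.
   Context: $M\subset\mathbb{R}^3$ is a smooth orientable surface with the metric $g=\langle\cdot,\cdot\rangle$ induced from $\mathbb{R}^3$, Levi-Civita connection $D$; $\kappa$ is its Gaussian curvature; $\nabla$, $D^2$, $\Delta$ are the gradient, Hessian and Laplacian of $g$; $M_x$ is the tangent space at $x$. For a vector field $X$, $QX=\langle X,e_2\rangle e_1-\langle X,e_1\rangle e_2$, where $e_1,e_2$ is any positively oriented orthonormal basis of $M_x$. For a vector field $W$ on $\Omega$ put $DW(X,Y)=\langle D_YW,X\rangle$. $H^1(\Omega,T)$ is the Sobolev space of vector fields $W$ on $\Omega$ with $W$ and $DW$ square integrable. $H^1_{\mathrm{kf}}(\Omega,T)$ is the space of all $W\in H^1(\Omega,T)$ such that $DW(X,Y)+DW(Y,X)=0$ for all $X,Y\in M_x$, for almost every $x\in\Omega$.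
   Formalization: The open set Ω is additionally assumed connected; for disconnected Ω (e.g. a flat disc together with a disjoint curved piece) both claims fail as stated. *)

theory Defs
  imports "HOL-Analysis.Analysis"
begin

section \<open>Smooth maps on open sets\<close>

primrec Ck_on :: "nat \<Rightarrow> 'a::euclidean_space set \<Rightarrow> ('a \<Rightarrow> 'b::real_normed_vector) \<Rightarrow> bool" where
  "Ck_on 0 S f \<longleftrightarrow> continuous_on S f"
| "Ck_on (Suc k) S f \<longleftrightarrow>
     f differentiable_on S \<and> (\<forall>v. Ck_on k S (\<lambda>x. frechet_derivative f (at x) v))"

definition smooth_on :: "'a::euclidean_space set \<Rightarrow> ('a \<Rightarrow> 'b::real_normed_vector) \<Rightarrow> bool" where
  "smooth_on S f \<longleftrightarrow> open S \<and> (\<forall>k. Ck_on k S f)"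

definition pd :: "'n::finite \<Rightarrow> (real^'n \<Rightarrow> 'b::real_normed_vector) \<Rightarrow> real^'n \<Rightarrow> 'b" where
  "pd j f u = frechet_derivative f (at u) (axis j 1)"


section \<open>Oriented surfaces in Euclidean 3-space\<close>

definition local_param :: "(real^3) set \<Rightarrow> (real^2) set \<Rightarrow> (real^2 \<Rightarrow> real^3) \<Rightarrow> bool" where
  "local_param M U \<phi> \<longleftrightarrow>
     smooth_on U \<phi> \<and> (\<forall>u\<in>U. inj (frechet_derivative \<phi> (at u))) \<and>
     openin (top_of_set M) (\<phi> ` U) \<and> (\<exists>\<psi>. homeomorphism U (\<phi> ` U) \<phi> \<psi>)"

definition smooth_surface :: "(real^3) set \<Rightarrow> bool" where
  "smooth_surface M \<longleftrightarrow> (\<forall>x\<in>M. \<exists>U \<phi>. local_param M U \<phi> \<and> x \<in> \<phi> ` U)"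

definition tangent_space :: "(real^3) set \<Rightarrow> real^3 \<Rightarrow> (real^3) set" where
  "tangent_space M x =
     {v. \<exists>\<gamma> e. 0 < e \<and> smooth_on {-e<..<e} \<gamma> \<and> \<gamma> ` {-e<..<e} \<subseteq> M \<and>
           \<gamma> (0::real) = x \<and> (\<gamma> has_vector_derivative v) (at 0)}"

text \<open>An orientation is given by a continuous field of unit normals.\<close>

definition orientation :: "(real^3) set \<Rightarrow> (real^3 \<Rightarrow> real^3) \<Rightarrow> bool" where
  "orientation M n \<longleftrightarrow>
     continuous_on M n \<and> (\<forall>x\<in>M. norm (n x) = 1 \<and> (\<forall>v\<in>tangent_space M x. n x \<bullet> v = 0))"

definition onb :: "(real^3) set \<Rightarrow> real^3 \<Rightarrow> real^3 \<Rightarrow> real^3 \<Rightarrow> bool" where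
  "onb M x e1 e2 \<longleftrightarrow>
     e1 \<in> tangent_space M x \<and> e2 \<in> tangent_space M x \<and>
     norm e1 = 1 \<and> norm e2 = 1 \<and> e1 \<bullet> e2 = 0"

definition pos_onb ::
  "(real^3) set \<Rightarrow> (real^3 \<Rightarrow> real^3) \<Rightarrow> real^3 \<Rightarrow> real^3 \<Rightarrow> real^3 \<Rightarrow> bool" where
  "pos_onb M n x e1 e2 \<longleftrightarrow> onb M x e1 e2 \<and> cross3 e1 e2 = n x"

definition Q_rot ::
  "(real^3) set \<Rightarrow> (real^3 \<Rightarrow> real^3) \<Rightarrow> real^3 \<Rightarrow> real^3 \<Rightarrow> real^3" where
  "Q_rot M n x X =
     (THE Y. \<forall>e1 e2. pos_onb M n x e1 e2 \<longrightarrow> Y = (X \<bullet> e2) *\<^sub>R e1 - (X \<bullet> e1) *\<^sub>R e2)"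


section \<open>Calculus on a surface\<close>

text \<open>
  The differential at a point x of M of a map defined on M. The derivative
  within M is determined only on the tangent space of M at x; it is only ever
  applied to tangent vectors below.
\<close>

definition diff_on :: "(real^3) set \<Rightarrow> (real^3 \<Rightarrow> 'b::real_normed_vector) \<Rightarrow> real^3 \<Rightarrow> real^3 \<Rightarrow> 'b" where
  "diff_on M f x v = frechet_derivative f (at x within M) v"

definition tan_proj :: "(real^3) set \<Rightarrow> real^3 \<Rightarrow> real^3 \<Rightarrow> real^3" where
  "tan_proj M x v =
     (THE w. w \<in> tangent_space M x \<and> (\<forall>t\<in>tangent_space M x. (v - w) \<bullet> t = 0))"

text \<open>
  The Levi-Civita connection of the induced metric: the tangential part of the
  derivative in the ambient space. Here v is the direction of differentiation.
\<close>

definition cov_deriv :: "(real^3) set \<Rightarrow> (real^3 \<Rightarrow> real^3) \<Rightarrow> real^3 \<Rightarrow> real^3 \<Rightarrow> real^3" where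
  "cov_deriv M W x v = tan_proj M x (diff_on M W x v)"

definition surf_grad :: "(real^3) set \<Rightarrow> (real^3 \<Rightarrow> real) \<Rightarrow> real^3 \<Rightarrow> real^3" where
  "surf_grad M f x =
     (THE w. w \<in> tangent_space M x \<and> (\<forall>v\<in>tangent_space M x. w \<bullet> v = diff_on M f x v))"

definition surf_hess :: "(real^3) set \<Rightarrow> (real^3 \<Rightarrow> real) \<Rightarrow> real^3 \<Rightarrow> real^3 \<Rightarrow> real^3 \<Rightarrow> real" where
  "surf_hess M f x X Y = cov_deriv M (surf_grad M f) x Y \<bullet> X"

definition surf_lap :: "(real^3) set \<Rightarrow> (real^3 \<Rightarrow> real) \<Rightarrow> real^3 \<Rightarrow> real" where
  "surf_lap M f x =
     (THE l. \<forall>e1 e2. onb M x e1 e2 \<longrightarrow> l = surf_hess M f x e1 e1 + surf_hess M f x e2 e2)"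

text \<open>The determinant of the differential of the Gauss map.\<close>

definition gauss_curv :: "(real^3) set \<Rightarrow> (real^3 \<Rightarrow> real^3) \<Rightarrow> real^3 \<Rightarrow> real" where
  "gauss_curv M n x =
     (THE k. \<forall>e1 e2. onb M x e1 e2 \<longrightarrow>
        k = (diff_on M n x e1 \<bullet> e1) * (diff_on M n x e2 \<bullet> e2)
          - (diff_on M n x e1 \<bullet> e2) * (diff_on M n x e2 \<bullet> e1))"


section \<open>The area measure\<close>

text \<open>
  The area of the image of a parametrized piece is the integral of the norm of
  the cross product of the two partial derivatives. The measures obtained from
  two parametrizations agree on the overlap of their images, so their supremum
  in the lattice of measures is the Riemannian measure of M, viewed as a Borel
  measure on the ambient space that is concentrated on M.
\<close>

definition param_measure :: "(real^2) set \<Rightarrow> (real^2 \<Rightarrow> real^3) \<Rightarrow> (real^3) measure" where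
  "param_measure U \<phi> =
     distr (density (restrict_space lborel U)
              (\<lambda>u. ennreal (norm (cross3 (pd 1 \<phi> u) (pd 2 \<phi> u)))))
           borel \<phi>"

definition area_measure :: "(real^3) set \<Rightarrow> (real^3) measure" where
  "area_measure M = (SUP (U, \<phi>)\<in>{(U, \<phi>). local_param M U \<phi>}. param_measure U \<phi>)"


section \<open>Sobolev vector fields\<close>

definition test_function :: "(real^2) set \<Rightarrow> (real^2 \<Rightarrow> real) \<Rightarrow> bool" where
  "test_function U \<psi> \<longleftrightarrow>
     smooth_on UNIV \<psi> \<and> (\<exists>K. compact K \<and> K \<subseteq> U \<and> (\<forall>u. u \<notin> K \<longrightarrow> \<psi> u = 0))"

definition loc_integrable :: "(real^2) set \<Rightarrow> (real^2 \<Rightarrow> real^3) \<Rightarrow> bool" where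
  "loc_integrable U f \<longleftrightarrow> (\<forall>K. compact K \<and> K \<subseteq> U \<longrightarrow> set_integrable lborel K f)"

definition weak_pd :: "(real^2) set \<Rightarrow> 2 \<Rightarrow> (real^2 \<Rightarrow> real^3) \<Rightarrow> (real^2 \<Rightarrow> real^3) \<Rightarrow> bool" where
  "weak_pd U j f g \<longleftrightarrow>
     loc_integrable U f \<and> loc_integrable U g \<and>
     (\<forall>\<psi>. test_function U \<psi> \<longrightarrow>
        (LINT u:U|lborel. pd j \<psi> u *\<^sub>R f u) = - (LINT u:U|lborel. \<psi> u *\<^sub>R g u))"

text \<open>
  A is a weak covariant derivative of W on \<Omega>, where A x v stands for the derivative
  of W at x in the direction v: in every local parametrization, A applied to the
  j-th coordinate vector is the tangential part of the j-th weak partial derivative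
  of W, in accordance with the definition of the connection. Only the restriction of
  A x to the tangent space matters; A x is taken to be defined on the whole ambient
  space for convenience.
\<close>

definition weak_cov_deriv ::
  "(real^3) set \<Rightarrow> (real^3) set \<Rightarrow> (real^3 \<Rightarrow> real^3) \<Rightarrow> (real^3 \<Rightarrow> real^3 \<Rightarrow> real^3) \<Rightarrow> bool" where
  "weak_cov_deriv M \<Omega> W A \<longleftrightarrow>
     (\<forall>x\<in>\<Omega>. linear (A x) \<and> (\<forall>v\<in>tangent_space M x. A x v \<in> tangent_space M x)) \<and>
     (\<forall>U \<phi>. local_param M U \<phi> \<and> \<phi> ` U \<subseteq> \<Omega> \<longrightarrow>
        (\<forall>j. \<exists>V. weak_pd U j (W \<circ> \<phi>) V \<and>
           (AE u in lborel. u \<in> U \<longrightarrow> A (\<phi> u) (pd j \<phi> u) = tan_proj M (\<phi> u) (V u))))"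

text \<open>
  Square of the Hilbert-Schmidt norm of the restriction of A to the tangent space at x
  (the map is extended by zero on the normal line, which does not change the norm).
\<close>

definition hs_norm2 :: "(real^3) set \<Rightarrow> real^3 \<Rightarrow> (real^3 \<Rightarrow> real^3) \<Rightarrow> real" where
  "hs_norm2 M x A = (\<Sum>b\<in>Basis. (norm (A (tan_proj M x b)))\<^sup>2)"

text \<open>
  Sobolev spaces are represented by the sets of all representing Borel fields;
  \<open>ae_eq M \<Omega>\<close> is the identification of fields that agree almost everywhere on \<Omega>.
  Values outside \<Omega> are irrelevant.
\<close>

definition L2_fields :: "(real^3) set \<Rightarrow> (real^3) set \<Rightarrow> (real^3 \<Rightarrow> real^3) set" where
  "L2_fields M \<Omega> =
     {W. (\<forall>x\<in>\<Omega>. W x \<in> tangent_space M x) \<and> W \<in> borel_measurable (restrict_space borel \<Omega>) \<and>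
         set_integrable (area_measure M) \<Omega> (\<lambda>x. (norm (W x))\<^sup>2)}"

definition H1_deriv ::
  "(real^3) set \<Rightarrow> (real^3) set \<Rightarrow> (real^3 \<Rightarrow> real^3) \<Rightarrow> (real^3 \<Rightarrow> real^3 \<Rightarrow> real^3) \<Rightarrow> bool" where
  "H1_deriv M \<Omega> W A \<longleftrightarrow>
     weak_cov_deriv M \<Omega> W A \<and> set_integrable (area_measure M) \<Omega> (\<lambda>x. hs_norm2 M x (A x))"

definition H1 :: "(real^3) set \<Rightarrow> (real^3) set \<Rightarrow> (real^3 \<Rightarrow> real^3) set" where
  "H1 M \<Omega> = {W \<in> L2_fields M \<Omega>. \<exists>A. H1_deriv M \<Omega> W A}"

definition H1_kf :: "(real^3) set \<Rightarrow> (real^3) set \<Rightarrow> (real^3 \<Rightarrow> real^3) set" where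
  "H1_kf M \<Omega> =
     {W \<in> H1 M \<Omega>. \<exists>DW. H1_deriv M \<Omega> W DW \<and>
        (AE x in area_measure M. x \<in> \<Omega> \<longrightarrow>
           (\<forall>X\<in>tangent_space M x. \<forall>Y\<in>tangent_space M x. DW x Y \<bullet> X + DW x X \<bullet> Y = 0))}"

definition ae_eq :: "(real^3) set \<Rightarrow> (real^3) set \<Rightarrow> ((real^3 \<Rightarrow> real^3) \<times> (real^3 \<Rightarrow> real^3)) set" where
  "ae_eq M \<Omega> = {(V, W). AE x in area_measure M. x \<in> \<Omega> \<longrightarrow> V x = W x}"

text \<open>
  Dimension of the space of \<open>ae_eq M \<Omega>\<close>-classes of a linear space F of fields: the
  supremum of the cardinalities of the finite subsets of F that are linearly
  independent modulo equality almost everywhere on \<Omega>.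
\<close>

definition ae_independent :: "(real^3) set \<Rightarrow> (real^3) set \<Rightarrow> (real^3 \<Rightarrow> real^3) set \<Rightarrow> bool" where
  "ae_independent M \<Omega> B \<longleftrightarrow>
     finite B \<and>
     (\<forall>c. ((\<lambda>x. \<Sum>b\<in>B. c b *\<^sub>R b x), (\<lambda>x. 0)) \<in> ae_eq M \<Omega> \<longrightarrow> (\<forall>b\<in>B. c b = (0::real)))"

definition ae_dim :: "(real^3) set \<Rightarrow> (real^3) set \<Rightarrow> (real^3 \<Rightarrow> real^3) set \<Rightarrow> enat" where
  "ae_dim M \<Omega> F = (SUP B\<in>{B. B \<subseteq> F \<and> ae_independent M \<Omega> B}. enat (card B))"

end

theory Submission
  imports Defs
begin

text \<open>
  In a chart \<open>\<phi>\<close> with unit normal N, a Killing field W satisfies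
  \<open>\<partial>\<^sub>j W = \<tau> N \<times> \<partial>\<^sub>j\<phi> - (W \<bullet> \<partial>\<^sub>j N) N\<close>, and commuting the derivatives gives
  \<open>\<partial>\<^sub>j \<tau> = - \<kappa> W \<bullet> (N \<times> \<partial>\<^sub>j\<phi>)\<close>. This linear system also holds weakly for \<open>H\<^sup>1\<close> fields; since all
  first and mixed second weak derivatives of \<open>(W, \<tau>)\<close> are locally integrable, \<open>(W, \<tau>)\<close> is continuous and by
  bootstrapping smooth, and it vanishes everywhere on a connected set if it vanishes at one point.
  Commuting derivatives of \<open>\<tau>\<close> gives \<open>W \<bullet> \<nabla>\<kappa> = 0\<close>. Hence, at a point where
  \<open>\<nabla>\<kappa> \<noteq> 0\<close>, two Killing fields are proportional, and differentiating \<open>W \<bullet> \<nabla>\<kappa> = 0\<close> shows that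
  \<open>\<tau> = 0\<close> there as soon as \<open>W = 0\<close>; so some nontrivial combination of the two fields vanishes.
  Moreover \<open>[W, \<nabla>\<kappa>] = 0\<close> and \<open>div W = 0\<close> give \<open>W \<bullet> \<nabla>\<Delta>\<kappa> = 0\<close> and
  \<open>D\<^sup>2\<kappa>(\<nabla>\<kappa>, W) = 0\<close>, so that W, a multiple of \<open>Q\<nabla>\<kappa>\<close>, vanishes at the point o.
\<close>

section \<open>Calculus of smooth maps\<close>

lemma Ck_on_cong:
  assumes "open S" "\<And>x. x \<in> S \<Longrightarrow> f x = g x" "Ck_on k S f"
  shows "Ck_on k S g"
  using assms(2,3)
proof (induction k arbitrary: f g)
  case 0
  then show ?case using continuous_on_cong[of S S f g] by auto
next
  case (Suc k)
  have df: "(f has_derivative frechet_derivative f (at x)) (at x)" if "x \<in> S" for x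
    using Suc.prems(2) that \<open>open S\<close>
    by (auto simp: frechet_derivative_works[symmetric] differentiable_on_eq_differentiable_at)
  have dg: "(g has_derivative frechet_derivative f (at x)) (at x)" if "x \<in> S" for x
    using has_derivative_transform_within_open[OF df[OF that] \<open>open S\<close> that] Suc.prems(1) by blast
  have eq: "frechet_derivative f (at x) = frechet_derivative g (at x)" if "x \<in> S" for x
    using frechet_derivative_at[OF dg[OF that]] .
  have "g differentiable_on S"
    using dg differentiable_def by (metis differentiable_at_imp_differentiable_on)
  moreover have "Ck_on k S (\<lambda>x. frechet_derivative g (at x) v)" for v
    using Suc.IH[of "\<lambda>x. frechet_derivative f (at x) v" "\<lambda>x. frechet_derivative g (at x) v"] Suc.prems(2) eq
    by auto
  ultimately show ?case by simp
qed

lemma Ck_on_SucI: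
  assumes "open S" "\<And>x. x \<in> S \<Longrightarrow> (f has_derivative f' x) (at x)" "\<And>v. Ck_on k S (\<lambda>x. f' x v)"
  shows "Ck_on (Suc k) S f"
proof -
  have "f differentiable_on S"
    using assms(2) differentiable_def by (metis differentiable_at_imp_differentiable_on)
  moreover have "Ck_on k S (\<lambda>x. frechet_derivative f (at x) v)" for v
    using Ck_on_cong[OF assms(1) _ assms(3)[of v], of "\<lambda>x. frechet_derivative f (at x) v"]
      frechet_derivative_at[OF assms(2)] by auto
  ultimately show ?thesis by simp
qed

lemma Ck_on_has_derivative:
  assumes "open S" "Ck_on (Suc k) S f" "x \<in> S"
  shows "(f has_derivative frechet_derivative f (at x)) (at x)"
  using assms by (auto simp: frechet_derivative_works[symmetric] differentiable_on_eq_differentiable_at)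

lemma Ck_on_imp_continuous_on: "Ck_on k S f \<Longrightarrow> continuous_on S f"
  by (cases k) (auto intro: differentiable_imp_continuous_on)

lemma Ck_on_Suc_imp: "Ck_on (Suc k) S f \<Longrightarrow> Ck_on k S f"
proof (induction k arbitrary: f)
  case 0
  then show ?case using Ck_on_imp_continuous_on[OF 0] by simp
next
  case (Suc k)
  have "f differentiable_on S" "Ck_on k S (\<lambda>x. frechet_derivative f (at x) v)" for v
    using Suc.prems Suc.IH[of "\<lambda>x. frechet_derivative f (at x) v"] unfolding Ck_on.simps(2) by blast+
  then show ?case by simp
qed

lemma Ck_on_subset:
  assumes "open T" "T \<subseteq> S" "Ck_on k S f"
  shows "Ck_on k T f"
  using assms(3)
proof (induction k arbitrary: f)
  case 0
  then show ?case using continuous_on_subset[of S f T] assms(2) by simp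
next
  case (Suc k)
  have "f differentiable_on T" "Ck_on k T (\<lambda>x. frechet_derivative f (at x) v)" for v
    using Suc.prems Suc.IH[of "\<lambda>x. frechet_derivative f (at x) v"] differentiable_on_subset[of f S T] assms(2)
    unfolding Ck_on.simps(2) by blast+
  then show ?case by simp
qed

lemma Ck_on_Un:
  assumes "open S" "open T" "Ck_on k S f" "Ck_on k T f"
  shows "Ck_on k (S \<union> T) f"
  using assms(3,4)
proof (induction k arbitrary: f)
  case 0
  then show ?case using continuous_on_open_Un[OF assms(1,2)] by auto
next
  case (Suc k)
  have "f differentiable_on (S \<union> T)"
    using Suc.prems assms(1,2) by (auto simp: differentiable_on_eq_differentiable_at open_Un)
  then show ?case using Suc by auto
qed

lemma Ck_on_const: "Ck_on k S (\<lambda>x. c)"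
  by (induction k arbitrary: c) auto

lemma Ck_on_bounded_linear:
  assumes "open S" "bounded_linear L" "Ck_on k S f"
  shows "Ck_on k S (\<lambda>x. L (f x))"
  using assms(3)
proof (induction k arbitrary: f)
  case 0
  then show ?case
    using bounded_linear.continuous_on[OF assms(2)] by auto
next
  case (Suc k)
  show ?case
  proof (rule Ck_on_SucI[OF assms(1)])
    show "((\<lambda>x. L (f x)) has_derivative (\<lambda>v. L (frechet_derivative f (at x) v))) (at x)" if "x \<in> S" for x
      by (rule bounded_linear.has_derivative[OF assms(2) Ck_on_has_derivative[OF assms(1) Suc.prems that]])
    show "Ck_on k S (\<lambda>x. L (frechet_derivative f (at x) v))" for v
      using Suc by auto
  qed
qed

lemma Ck_on_add:
  assumes "open S" "Ck_on k S f" "Ck_on k S g"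
  shows "Ck_on k S (\<lambda>x. f x + g x)"
  using assms(2,3)
proof (induction k arbitrary: f g)
  case 0
  then show ?case by (auto intro: continuous_intros)
next
  case (Suc k)
  show ?case
  proof (rule Ck_on_SucI[OF assms(1)])
    show "((\<lambda>x. f x + g x) has_derivative
        (\<lambda>v. frechet_derivative f (at x) v + frechet_derivative g (at x) v)) (at x)" if "x \<in> S" for x
      using Suc.prems that by (intro has_derivative_add Ck_on_has_derivative[OF assms(1)])
    show "Ck_on k S (\<lambda>x. frechet_derivative f (at x) v + frechet_derivative g (at x) v)" for v
      using Suc by auto
  qed
qed

lemma Ck_on_bilinear:
  assumes "open S" "bounded_bilinear B" "Ck_on k S f" "Ck_on k S g"
  shows "Ck_on k S (\<lambda>x. B (f x) (g x))"
  using assms(3,4)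
proof (induction k arbitrary: f g)
  case 0
  then show ?case using bounded_bilinear.continuous_on[OF assms(2)] by auto
next
  case (Suc k)
  show ?case
  proof (rule Ck_on_SucI[OF assms(1)])
    show "((\<lambda>x. B (f x) (g x)) has_derivative
        (\<lambda>v. B (f x) (frechet_derivative g (at x) v) + B (frechet_derivative f (at x) v) (g x))) (at x)"
      if "x \<in> S" for x
      using Suc.prems that
      by (intro bounded_bilinear.FDERIV[OF assms(2)] Ck_on_has_derivative[OF assms(1)])
    show "Ck_on k S (\<lambda>x. B (f x) (frechet_derivative g (at x) v) + B (frechet_derivative f (at x) v) (g x))" for v
      using Suc.prems Ck_on_Suc_imp[OF Suc.prems(1)] Ck_on_Suc_imp[OF Suc.prems(2)]
      by (intro Ck_on_add[OF assms(1)] Suc.IH) simp_all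
  qed
qed

lemma Ck_on_inverse:
  fixes f :: "'a::euclidean_space \<Rightarrow> real"
  assumes "open S" "\<And>x. x \<in> S \<Longrightarrow> f x \<noteq> 0" "Ck_on k S f"
  shows "Ck_on k S (\<lambda>x. inverse (f x))"
  using assms(3)
proof (induction k)
  case 0
  then show ?case using assms(2) by (auto intro: continuous_intros)
next
  case (Suc k)
  show ?case
  proof (rule Ck_on_SucI[OF assms(1)])
    show "((\<lambda>x. inverse (f x)) has_derivative
        (\<lambda>v. - (inverse (f x) * frechet_derivative f (at x) v * inverse (f x)))) (at x)" if "x \<in> S" for x
      using Deriv.has_derivative_inverse[OF assms(2)[OF that] Ck_on_has_derivative[OF assms(1) Suc.prems that]] .
    have "Ck_on k S (\<lambda>x. inverse (f x))"
      using Suc Ck_on_Suc_imp by blast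
    then show "Ck_on k S (\<lambda>x. - (inverse (f x) * frechet_derivative f (at x) v * inverse (f x)))" for v
      using Suc.prems
      by (intro Ck_on_bounded_linear[OF assms(1) bounded_linear_minus[OF bounded_linear_ident]]
          Ck_on_bilinear[OF assms(1) bounded_bilinear_mult]) auto
  qed
qed

lemma Ck_on_sqrt:
  fixes f :: "'a::euclidean_space \<Rightarrow> real"
  assumes "open S" "\<And>x. x \<in> S \<Longrightarrow> f x > 0" "Ck_on k S f"
  shows "Ck_on k S (\<lambda>x. sqrt (f x))"
  using assms(3)
proof (induction k)
  case 0
  then show ?case by (auto intro: continuous_intros)
next
  case (Suc k)
  show ?case
  proof (rule Ck_on_SucI[OF assms(1)])
    show "((\<lambda>x. sqrt (f x)) has_derivative
        (\<lambda>v. frechet_derivative f (at x) v * (inverse (sqrt (f x)) / 2))) (at x)" if "x \<in> S" for x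
    proof -
      have "(sqrt has_derivative (\<lambda>t. t * (inverse (sqrt (f x)) / 2))) (at (f x))"
        using DERIV_real_sqrt[OF assms(2)[OF that]] unfolding has_field_derivative_def
        by (rule has_derivative_eq_rhs) (auto simp: mult.commute)
      from has_derivative_compose[OF Ck_on_has_derivative[OF assms(1) Suc.prems that] this]
      show ?thesis .
    qed
    have "Ck_on k S (\<lambda>x. sqrt (f x))"
      using Suc Ck_on_Suc_imp by blast
    then have "Ck_on k S (\<lambda>x. inverse (sqrt (f x)) / 2)"
      using Ck_on_bounded_linear[OF assms(1) bounded_linear_divide Ck_on_inverse[OF assms(1)], of "\<lambda>x. sqrt (f x)" k 2]
       assms(2) by force
    then show "Ck_on k S (\<lambda>x. frechet_derivative f (at x) v * (inverse (sqrt (f x)) / 2))" for v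
      using Suc.prems by (intro Ck_on_bilinear[OF assms(1) bounded_bilinear_mult]) auto
  qed
qed

lemma Ck_on_affine_compose:
  fixes f :: "'b::euclidean_space \<Rightarrow> 'c::real_normed_vector" and L :: "'a::euclidean_space \<Rightarrow> 'b"
  assumes "open S" "open T" "bounded_linear L" "(\<lambda>x. c + L x) ` T \<subseteq> S" "Ck_on k S f"
  shows "Ck_on k T (\<lambda>x. f (c + L x))"
  using assms(5)
proof (induction k arbitrary: f)
  case 0
  have "continuous_on T (\<lambda>x. c + L x)"
    by (intro continuous_on_add continuous_on_const linear_continuous_on assms(3))
  then show ?case using 0 assms(4) by (auto intro: continuous_on_compose2)
next
  case (Suc k)
  show ?case
  proof (rule Ck_on_SucI[OF assms(2)])
    show "((\<lambda>x. f (c + L x)) has_derivative (\<lambda>v. frechet_derivative f (at (c + L x)) (L v))) (at x)"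
      if "x \<in> T" for x
    proof -
      have "((\<lambda>x. c + L x) has_derivative L) (at x)"
        using bounded_linear_imp_has_derivative[OF assms(3)] by (auto intro!: derivative_eq_intros)
      moreover have "c + L x \<in> S" using that assms(4) by auto
      ultimately show ?thesis
        using has_derivative_compose[OF _ Ck_on_has_derivative[OF assms(1) Suc.prems]] by blast
    qed
    show "Ck_on k T (\<lambda>x. frechet_derivative f (at (c + L x)) (L v))" for v
      using Suc by auto
  qed
qed

lemma smooth_on_open: "smooth_on S f \<Longrightarrow> open S"
  by (simp add: smooth_on_def)

lemma smooth_on_has_derivative:
  "smooth_on S f \<Longrightarrow> x \<in> S \<Longrightarrow> (f has_derivative frechet_derivative f (at x)) (at x)"
  using Ck_on_has_derivative unfolding smooth_on_def by blast

lemma smooth_on_differentiable: "smooth_on S f \<Longrightarrow> x \<in> S \<Longrightarrow> f differentiable (at x)"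
  using smooth_on_has_derivative differentiable_def by blast

lemma smooth_on_continuous_on: "smooth_on S f \<Longrightarrow> continuous_on S f"
  using Ck_on_imp_continuous_on unfolding smooth_on_def by blast

lemma smooth_on_derivative: "smooth_on S f \<Longrightarrow> smooth_on S (\<lambda>x. frechet_derivative f (at x) v)"
  unfolding smooth_on_def by (metis Ck_on.simps(2))

lemma smooth_on_cong:
  "smooth_on S f \<Longrightarrow> (\<And>x. x \<in> S \<Longrightarrow> f x = g x) \<Longrightarrow> smooth_on S g"
  unfolding smooth_on_def using Ck_on_cong by blast

lemma smooth_on_subset: "smooth_on S f \<Longrightarrow> open T \<Longrightarrow> T \<subseteq> S \<Longrightarrow> smooth_on T f"
  unfolding smooth_on_def using Ck_on_subset by blast

lemma smooth_on_Un: "smooth_on S f \<Longrightarrow> smooth_on T f \<Longrightarrow> smooth_on (S \<union> T) f"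
  unfolding smooth_on_def using Ck_on_Un by (metis open_Un)

lemma smooth_on_const: "open S \<Longrightarrow> smooth_on S (\<lambda>x. c)"
  unfolding smooth_on_def using Ck_on_const by blast

lemma smooth_on_bounded_linear: "bounded_linear L \<Longrightarrow> smooth_on S f \<Longrightarrow> smooth_on S (\<lambda>x. L (f x))"
  unfolding smooth_on_def using Ck_on_bounded_linear by blast

lemma smooth_on_add: "smooth_on S f \<Longrightarrow> smooth_on S g \<Longrightarrow> smooth_on S (\<lambda>x. f x + g x)"
  unfolding smooth_on_def using Ck_on_add by blast

lemma smooth_on_minus: "smooth_on S f \<Longrightarrow> smooth_on S (\<lambda>x. - f x)"
  by (rule smooth_on_bounded_linear[OF bounded_linear_minus[OF bounded_linear_ident]])

lemma smooth_on_diff: "smooth_on S f \<Longrightarrow> smooth_on S g \<Longrightarrow> smooth_on S (\<lambda>x. f x - g x)"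
  using smooth_on_add[OF _ smooth_on_minus] by fastforce

lemma smooth_on_bilinear:
  "bounded_bilinear B \<Longrightarrow> smooth_on S f \<Longrightarrow> smooth_on S g \<Longrightarrow> smooth_on S (\<lambda>x. B (f x) (g x))"
  unfolding smooth_on_def using Ck_on_bilinear by blast

lemma smooth_on_inverse:
  fixes f :: "'a::euclidean_space \<Rightarrow> real"
  shows "smooth_on S f \<Longrightarrow> (\<And>x. x \<in> S \<Longrightarrow> f x \<noteq> 0) \<Longrightarrow> smooth_on S (\<lambda>x. inverse (f x))"
  unfolding smooth_on_def using Ck_on_inverse by blast

lemma smooth_on_sqrt:
  fixes f :: "'a::euclidean_space \<Rightarrow> real"
  shows "smooth_on S f \<Longrightarrow> (\<And>x. x \<in> S \<Longrightarrow> f x > 0) \<Longrightarrow> smooth_on S (\<lambda>x. sqrt (f x))"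
  unfolding smooth_on_def using Ck_on_sqrt by blast

lemma bounded_bilinear_cross3: "bounded_bilinear cross3"
  using bilinear_cross bilinear_conv_bounded_bilinear by blast

lemma smooth_on_mult:
  fixes f g :: "'a::euclidean_space \<Rightarrow> real"
  shows "smooth_on S f \<Longrightarrow> smooth_on S g \<Longrightarrow> smooth_on S (\<lambda>x. f x * g x)"
  by (rule smooth_on_bilinear[OF bounded_bilinear_mult])

lemmas smooth_on_scaleR = smooth_on_bilinear[OF bounded_bilinear_scaleR]
lemmas smooth_on_inner = smooth_on_bilinear[OF bounded_bilinear_inner]
lemmas smooth_on_cross3 = smooth_on_bilinear[OF bounded_bilinear_cross3]

lemma smooth_on_divide:
  fixes f g :: "'a::euclidean_space \<Rightarrow> real"
  shows "smooth_on S f \<Longrightarrow> smooth_on S g \<Longrightarrow> (\<And>x. x \<in> S \<Longrightarrow> g x \<noteq> 0) \<Longrightarrow> smooth_on S (\<lambda>x. f x / g x)"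
  unfolding divide_inverse by (intro smooth_on_mult smooth_on_inverse)

lemma smooth_on_sum:
  "open S \<Longrightarrow> (\<And>i. i \<in> I \<Longrightarrow> smooth_on S (f i)) \<Longrightarrow> smooth_on S (\<lambda>x. \<Sum>i\<in>I. f i x)"
  by (induction I rule: infinite_finite_induct) (auto simp: smooth_on_const smooth_on_add)

lemma smooth_on_vec_nth:
  fixes f :: "'a::euclidean_space \<Rightarrow> real^'n"
  shows "smooth_on S f \<Longrightarrow> smooth_on S (\<lambda>x. f x $ i)"
  by (rule smooth_on_bounded_linear[OF bounded_linear_vec_nth])

lemma smooth_on_pd: "smooth_on S f \<Longrightarrow> smooth_on S (\<lambda>u. pd j f u)"
  unfolding pd_def by (rule smooth_on_derivative)

lemmas smooth_intros = smooth_on_const smooth_on_add smooth_on_minus smooth_on_diff smooth_on_mult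
  smooth_on_scaleR smooth_on_inner smooth_on_cross3 smooth_on_divide smooth_on_vec_nth smooth_on_pd

subsection \<open>Partial derivatives in the plane\<close>

lemma pd_unique: "(f has_derivative f') (at u) \<Longrightarrow> pd j f u = f' (axis j 1)"
  unfolding pd_def using frechet_derivative_at by metis

lemma frechet_eq_sum_pd:
  fixes f :: "real^'n \<Rightarrow> 'b::real_normed_vector"
  assumes "f differentiable (at u)"
  shows "frechet_derivative f (at u) h = (\<Sum>j\<in>UNIV. h $ j *\<^sub>R pd j f u)"
proof -
  have "linear (frechet_derivative f (at u))"
    using assms linear_frechet_derivative by blast
  then show ?thesis
    unfolding pd_def
    by (subst basis_expansion[of h, symmetric, unfolded scalar_mult_eq_scaleR])
      (simp add: linear_sum linear_cmul)
qed

lemma has_derivative_sum_pd: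
  fixes f :: "real^'n \<Rightarrow> 'b::real_normed_vector"
  assumes "f differentiable (at u)"
  shows "(f has_derivative (\<lambda>h. \<Sum>j\<in>UNIV. h $ j *\<^sub>R pd j f u)) (at u)"
proof -
  have "frechet_derivative f (at u) = (\<lambda>h. \<Sum>j\<in>UNIV. h $ j *\<^sub>R pd j f u)"
    using frechet_eq_sum_pd[OF assms] by blast
  then show ?thesis using assms frechet_derivative_works by metis
qed

lemma pd_cong:
  "open S \<Longrightarrow> u \<in> S \<Longrightarrow> (\<And>x. x \<in> S \<Longrightarrow> f x = g x) \<Longrightarrow> f differentiable (at u) \<Longrightarrow> pd j f u = pd j g u"
  unfolding pd_def using frechet_derivative_transform_within_open[of f u S g] by metis

lemma pd_const [simp]: "pd j (\<lambda>u. c) u = 0"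
  unfolding pd_def by simp

lemma pd_add:
  "f differentiable (at u) \<Longrightarrow> g differentiable (at u) \<Longrightarrow>
    pd j (\<lambda>u. f u + g u) u = pd j f u + pd j g u"
  using pd_unique[OF has_derivative_add] unfolding pd_def frechet_derivative_works by blast

lemma pd_bounded_linear:
  "bounded_linear L \<Longrightarrow> f differentiable (at u) \<Longrightarrow> pd j (\<lambda>u. L (f u)) u = L (pd j f u)"
  using pd_unique[OF bounded_linear.has_derivative] unfolding pd_def frechet_derivative_works by blast

lemma pd_minus: "f differentiable (at u) \<Longrightarrow> pd j (\<lambda>u. - f u) u = - pd j f u"
  using pd_bounded_linear[OF bounded_linear_minus[OF bounded_linear_ident]] .

lemma pd_diff:
  "f differentiable (at u) \<Longrightarrow> g differentiable (at u) \<Longrightarrow>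
    pd j (\<lambda>u. f u - g u) u = pd j f u - pd j g u"
  using pd_add[of f u "\<lambda>u. - g u"] pd_minus[of g u] by simp

lemma pd_bilinear:
  assumes "bounded_bilinear B" "f differentiable (at u)" "g differentiable (at u)"
  shows "pd j (\<lambda>u. B (f u) (g u)) u = B (pd j f u) (g u) + B (f u) (pd j g u)"
  using pd_unique[OF bounded_bilinear.FDERIV[OF assms(1) assms(2,3)[unfolded frechet_derivative_works]], of j]
  by (simp add: pd_def add.commute)

lemmas pd_inner = pd_bilinear[OF bounded_bilinear_inner]
lemmas pd_cross3 = pd_bilinear[OF bounded_bilinear_cross3]
lemmas pd_scaleR = pd_bilinear[OF bounded_bilinear_scaleR]

lemma pd_mult:
  fixes f g :: "real^'n \<Rightarrow> real"
  shows "f differentiable (at u) \<Longrightarrow> g differentiable (at u) \<Longrightarrow>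
    pd j (\<lambda>u. f u * g u) u = pd j f u * g u + f u * pd j g u"
  by (rule pd_bilinear[OF bounded_bilinear_mult])

lemma pd_vec_nth:
  fixes f :: "real^'n \<Rightarrow> real^'m"
  shows "f differentiable (at u) \<Longrightarrow> pd j (\<lambda>u. f u $ i) u = pd j f u $ i"
  by (rule pd_bounded_linear[OF bounded_linear_vec_nth])

lemma Ck_on_Suc_pd:
  fixes f :: "real^'n \<Rightarrow> 'b::real_normed_vector"
  assumes "open S" "\<And>x. x \<in> S \<Longrightarrow> f differentiable (at x)" "\<And>j. Ck_on k S (pd j f)"
  shows "Ck_on (Suc k) S f"
proof (rule Ck_on_SucI[OF assms(1)])
  show "(f has_derivative (\<lambda>h. \<Sum>j\<in>UNIV. h $ j *\<^sub>R pd j f u)) (at u)" if "u \<in> S" for u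
    using has_derivative_sum_pd assms(2)[OF that] .
  have "Ck_on k S (\<lambda>x. \<Sum>j\<in>J. v $ j *\<^sub>R pd j f x)" if "finite J" for J v
    using that
  proof induction
    case (insert x F)
    have "Ck_on k S (\<lambda>u. v $ x *\<^sub>R pd x f u)"
      using Ck_on_bounded_linear[OF assms(1) bounded_linear_scaleR_right assms(3)] .
    with insert show ?case by (simp add: Ck_on_add[OF assms(1)])
  qed (simp add: Ck_on_const)
  then show "Ck_on k S (\<lambda>x. \<Sum>j\<in>UNIV. v $ j *\<^sub>R pd j f x)" for v by simp
qed

section \<open>Test functions\<close>

definition expinv :: "nat \<Rightarrow> real \<Rightarrow> real" where
  "expinv m x = (if x > 0 then exp (- (1 / x)) / x ^ m else 0)"

lemma expinv_tendsto_0: "((\<lambda>h. expinv m h / h) \<longlongrightarrow> 0) (at 0)"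
proof -
  have "((\<lambda>x. (inverse x) ^ Suc m / exp (inverse x)) \<longlongrightarrow> (0::real)) (at_right 0)"
    by (rule filterlim_compose[OF tendsto_power_div_exp_0 filterlim_inverse_at_top_right])
  moreover have "\<forall>\<^sub>F x in at_right 0. (inverse x) ^ Suc m / exp (inverse x) = expinv m x / x"
    unfolding eventually_at_right_field
    by (rule exI[of _ 1]) (auto simp: expinv_def exp_minus field_simps)
  ultimately have r: "((\<lambda>h. expinv m h / h) \<longlongrightarrow> 0) (at_right 0)"
    by (rule Lim_transform_eventually)
  have "\<forall>\<^sub>F x in at_left 0. 0 = expinv m x / x"
    unfolding eventually_at_left_field
    by (rule exI[of _ "-1"]) (auto simp: expinv_def)
  then have l: "((\<lambda>h. expinv m h / h) \<longlongrightarrow> 0) (at_left 0)"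
    by (rule Lim_transform_eventually[OF tendsto_const])
  show ?thesis using filterlim_split_at[OF l r] .
qed

lemma expinv_has_derivative:
  "(expinv m has_real_derivative expinv (m + 2) x - real m * expinv (m + 1) x) (at x)"
proof (cases x "0::real" rule: linorder_cases)
  case less
  have "((\<lambda>x. 0) has_real_derivative 0) (at x)" by simp
  moreover have "expinv (m + 2) x - real m * expinv (m + 1) x = 0"
    using less by (simp add: expinv_def)
  moreover have "\<forall>\<^sub>F y in nhds x. 0 = expinv m y"
    using eventually_nhds_in_open[of "{..<0}" x] less
    by (auto elim!: eventually_mono simp: expinv_def)
  ultimately show ?thesis
    using less DERIV_cong_ev[of x x "\<lambda>x. 0" "expinv m" 0 0] by simp
next
  case equal
  have "expinv m 0 = 0" for m by (simp add: expinv_def)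
  then show ?thesis
    using expinv_tendsto_0[of m] equal unfolding DERIV_def by simp
next
  case greater
  have "((\<lambda>x. exp (- (1 / x)) / x ^ m) has_real_derivative
      (exp (- (1 / x)) * (1 / x\<^sup>2) * x ^ m - exp (- (1 / x)) * (real m * x ^ (m - 1))) / (x ^ m * x ^ m)) (at x)"
    using greater by (auto intro!: derivative_eq_intros simp: power2_eq_square)
  also have "(exp (- (1 / x)) * (1 / x\<^sup>2) * x ^ m - exp (- (1 / x)) * (real m * x ^ (m - 1))) / (x ^ m * x ^ m)
      = expinv (m + 2) x - real m * expinv (m + 1) x"
    using greater by (cases m) (auto simp: expinv_def field_simps power2_eq_square power_add)
  finally have "((\<lambda>x. exp (- (1 / x)) / x ^ m) has_real_derivative expinv (m + 2) x - real m * expinv (m + 1) x) (at x)" .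
  moreover have "\<forall>\<^sub>F y in nhds x. exp (- (1 / y)) / y ^ m = expinv m y"
    using eventually_nhds_in_open[of "{0<..}" x] greater
    by (auto elim!: eventually_mono simp: expinv_def)
  ultimately show ?thesis
    using DERIV_cong_ev[of x x "\<lambda>x. exp (- (1 / x)) / x ^ m" "expinv m"] by simp
qed

lemma smooth_expinv: "smooth_on UNIV (expinv m)"
proof -
  have "Ck_on k UNIV (expinv m)" for k m
  proof (induction k arbitrary: m)
    case 0
    have "continuous (at x) (expinv m)" for x
      using expinv_has_derivative DERIV_isCont by blast
    then show ?case by (simp add: continuous_at_imp_continuous_on)
  next
    case (Suc k)
    show ?case
    proof (rule Ck_on_SucI[OF open_UNIV])
      show "(expinv m has_derivative (\<lambda>v. (expinv (m + 2) x - real m * expinv (m + 1) x) * v)) (at x)" for x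
        using expinv_has_derivative unfolding has_field_derivative_def .
      have "Ck_on k UNIV (\<lambda>x. expinv (m + 2) x + - (real m * expinv (m + 1) x))"
        by (intro Ck_on_add[OF open_UNIV] Suc Ck_on_bounded_linear[OF open_UNIV bounded_linear_minus[OF bounded_linear_ident]]
            Ck_on_bounded_linear[OF open_UNIV bounded_linear_mult_right])
      then show "Ck_on k UNIV (\<lambda>x. (expinv (m + 2) x - real m * expinv (m + 1) x) * v)" for v
        using Ck_on_bounded_linear[OF open_UNIV bounded_linear_mult_left] by fastforce
    qed
  qed
  then show ?thesis by (simp add: smooth_on_def)
qed

lemma smooth_on_affine_compose:
  assumes "smooth_on S f" "bounded_linear L" "open T" "(\<lambda>x. c + L x) ` T \<subseteq> S"
  shows "smooth_on T (\<lambda>x. f (c + L x))"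
  using Ck_on_affine_compose[of S T L c _ f] assms unfolding smooth_on_def by blast

definition bump :: "real \<Rightarrow> real \<Rightarrow> real \<Rightarrow> real \<Rightarrow> real" where
  "bump n a b t = expinv 0 (n * (t - a)) * expinv 0 (n * (b - t))"

lemma smooth_bump: "smooth_on UNIV (bump n a b)"
proof -
  have "smooth_on UNIV (\<lambda>t. expinv 0 (- (n * a) + n * t))" "smooth_on UNIV (\<lambda>t. expinv 0 (n * b + (- n) * t))"
    by (intro smooth_on_affine_compose[OF smooth_expinv bounded_linear_mult_right]; simp)+
  then have "smooth_on UNIV (\<lambda>t. expinv 0 (- (n * a) + n * t) * expinv 0 (n * b + (- n) * t))"
    by (rule smooth_on_mult)
  then show ?thesis
    by (rule smooth_on_cong) (simp add: bump_def algebra_simps)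
qed

lemma expinv_0_range: "0 \<le> expinv 0 x" "expinv 0 x \<le> 1"
  by (auto simp: expinv_def)

lemma bump_range: "0 \<le> bump n a b t" "bump n a b t \<le> 1"
  by (auto simp: bump_def expinv_0_range mult_le_one)

lemma bump_eq_0: "n > 0 \<Longrightarrow> t \<le> a \<or> b \<le> t \<Longrightarrow> bump n a b t = 0"
  by (auto simp: bump_def expinv_def zero_less_mult_iff)

lemma bump_pos: "n > 0 \<Longrightarrow> a < t \<Longrightarrow> t < b \<Longrightarrow> bump n a b t > 0"
  by (auto simp: bump_def expinv_def)

lemma continuous_on_bump: "continuous_on S (bump n a b)"
  using smooth_on_continuous_on[OF smooth_bump] continuous_on_subset by blast

lemma borel_measurable_bump [measurable]: "bump n a b \<in> borel_measurable borel"
  by (rule borel_measurable_continuous_onI[OF continuous_on_bump])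

lemma bump_tendsto_indicator:
  "(\<lambda>k. bump (real (Suc k)) a b t) \<longlonglongrightarrow> indicator {a<..<b} t"
proof (cases "a < t \<and> t < b")
  case True
  have lim: "(\<lambda>k. expinv 0 (real (Suc k) * c)) \<longlonglongrightarrow> 1" if "c > 0" for c
  proof -
    have "(\<lambda>k. exp (- (inverse (real (Suc k)) * inverse c))) \<longlonglongrightarrow> exp (- (0 * inverse c))"
      by (intro tendsto_intros LIMSEQ_inverse_real_of_nat)
    moreover have "expinv 0 (real (Suc k) * c) = exp (- (inverse (real (Suc k)) * inverse c))" for k
    proof -
      have "real (Suc k) * c > 0" using that by simp
      then show ?thesis unfolding expinv_def by (simp add: divide_inverse mult.commute del: of_nat_Suc)
    qed
    ultimately show ?thesis by (simp del: of_nat_Suc)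
  qed
  show ?thesis
    unfolding bump_def using tendsto_mult[OF lim lim, of "t - a" "b - t"] True by simp
next
  case False
  then have "bump (real (Suc k)) a b t = 0" for k
    by (intro bump_eq_0) auto
  then show ?thesis using False by simp
qed

lemma bump_integrable:
  assumes "n > 0" shows "integrable lborel (bump n a b)"
proof -
  have "integrable lborel (\<lambda>x. indicator {a..b} x *\<^sub>R bump n a b x)"
    by (intro borel_integrable_compact continuous_on_bump) simp
  moreover have "(\<lambda>x. indicator {a..b} x *\<^sub>R bump n a b x) = bump n a b"
  proof
    show "indicator {a..b} x *\<^sub>R bump n a b x = bump n a b x" for x
      using bump_eq_0[OF assms, of x a b] by (cases "a \<le> x \<and> x \<le> b") (auto simp: indicator_def)
  qed
  ultimately show ?thesis by (simp only:)
qed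

definition bump_tail :: "real \<Rightarrow> real \<Rightarrow> real \<Rightarrow> real \<Rightarrow> real" where
  "bump_tail n a b x = (LINT t|lborel. indicator {x<..} t * bump n a b t)"

lemma bump_tail_integrable:
  "n > 0 \<Longrightarrow> integrable lborel (\<lambda>t. indicator {x<..} t * bump n a b t)"
  using integrable_mult_indicator[of "{x<..}" lborel "bump n a b"] bump_integrable by simp

lemma bump_tail_right: "n > 0 \<Longrightarrow> b \<le> x \<Longrightarrow> bump_tail n a b x = 0"
proof -
  assume "n > 0" "b \<le> x"
  then have "indicator {x<..} t * bump n a b t = 0" for t
    using bump_eq_0[of n t a b] by (cases "x < t") (auto simp: indicator_def)
  then show ?thesis unfolding bump_tail_def by (simp only: Bochner_Integration.integral_zero)
qed

lemma bump_tail_left: "n > 0 \<Longrightarrow> x \<le> a \<Longrightarrow> bump_tail n a b x = (LINT t|lborel. bump n a b t)"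
proof -
  assume "n > 0" "x \<le> a"
  then have "indicator {x<..} t * bump n a b t = bump n a b t" for t
    using bump_eq_0[of n t a b] by (cases "x < t") (auto simp: indicator_def)
  then show ?thesis unfolding bump_tail_def by presburger
qed

lemma bump_tail_range:
  assumes "n > 0"
  shows "0 \<le> bump_tail n a b x" "bump_tail n a b x \<le> (LINT t|lborel. bump n a b t)"
proof -
  show "0 \<le> bump_tail n a b x"
    unfolding bump_tail_def by (intro Bochner_Integration.integral_nonneg) (simp add: bump_range)
  have "indicator {x<..} t * bump n a b t \<le> bump n a b t" for t
    by (simp add: indicator_def bump_range)
  then show "bump_tail n a b x \<le> (LINT t|lborel. bump n a b t)"
    unfolding bump_tail_def
    by (intro integral_mono bump_tail_integrable bump_integrable assms)
qed

lemma bump_tail_has_derivative: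
  assumes "n > 0"
  shows "(bump_tail n a b has_real_derivative - bump n a b x) (at x)"
proof -
  define B where "B = max b (x + 1)"
  define R where "R t = integral {x - 2..t} (bump n a b)" for t
  have R: "(R has_real_derivative bump n a b t) (at t)" if "x - 2 < t" "t < B + 1" for t
  proof -
    have "(R has_vector_derivative bump n a b t) (at t within {x - 2..B + 1})"
      unfolding R_def using that by (intro integral_has_vector_derivative[OF continuous_on_bump]) simp
    moreover have "at t within {x - 2..B + 1} = at t"
      using that by (intro at_within_interior) simp
    ultimately show ?thesis
      by (simp only: has_real_derivative_iff_has_vector_derivative)
  qed
  have eq: "R B - R y = bump_tail n a b y" if "y < x + 1" and that': "x - 1 < y" for y
  proof -
    have le: "y \<le> B" using that by (simp add: B_def)
    have "bump_tail n a b y = (LINT t|lborel. bump n a b t * indicator {y..B} t)"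
      unfolding bump_tail_def
    proof (rule integral_cong_AE)
      show "AE t in lborel. indicator {y<..} t * bump n a b t = bump n a b t * indicator {y..B} t"
        using AE_lborel_singleton[of y]
        by eventually_elim (use bump_eq_0[OF assms, of _ a b] in \<open>force simp: indicator_def B_def\<close>)
    qed (auto intro: borel_measurable_continuous_onI continuous_on_bump)
    also have "\<dots> = R B - R y"
      using R that' continuous_on_bump[of UNIV n a b]
      by (intro integral_FTC_Icc_real[OF le]) (auto simp: continuous_on_eq_continuous_at)
    finally show ?thesis by simp
  qed
  have "((\<lambda>y. R B - R y) has_real_derivative - bump n a b x) (at x)"
    using R[of x] by (auto intro!: derivative_eq_intros simp: B_def)
  then show ?thesis
    using has_field_derivative_transform_within_open[of _ _ x "{x-1<..<x+1}" "bump_tail n a b"] eq by auto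
qed

lemma smooth_bump_tail: "n > 0 \<Longrightarrow> smooth_on UNIV (bump_tail n a b)"
proof -
  assume n: "n > 0"
  have "Ck_on k UNIV (bump_tail n a b)" for k
  proof (rule Ck_on_Suc_imp, rule Ck_on_SucI[OF open_UNIV])
    show "(bump_tail n a b has_derivative (\<lambda>v. - bump n a b x * v)) (at x)" for x
      using bump_tail_has_derivative[OF n] unfolding has_field_derivative_def .
    show "Ck_on k UNIV (\<lambda>x. - bump n a b x * v)" for v
      using smooth_on_bounded_linear[OF bounded_linear_mult_left smooth_on_minus[OF smooth_bump], of n a b v]
      by (simp add: smooth_on_def)
  qed
  then show ?thesis by (simp add: smooth_on_def)
qed

lemma smooth_on_compose_nth:
  fixes f :: "real \<Rightarrow> real" and j :: "'n::finite"
  assumes "smooth_on UNIV f"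
  shows "smooth_on UNIV (\<lambda>u::real^'n. f (u $ j - c))"
  using smooth_on_affine_compose[OF assms bounded_linear_vec_nth[of j] open_UNIV, of "- c"] by simp

lemma pd_compose_nth:
  fixes f :: "real \<Rightarrow> real"
  assumes "(f has_real_derivative f') (at (u $ j - c))"
  shows "pd i (\<lambda>u. f (u $ j - c)) u = (if i = j then f' else 0)"
proof -
  have d: "((\<lambda>u. u $ j - c) has_derivative (\<lambda>h. h $ j)) (at u)"
    by (rule has_derivative_eq_rhs[OF has_derivative_diff[OF bounded_linear_imp_has_derivative[OF bounded_linear_vec_nth]
          has_derivative_const]]) simp
  have "((\<lambda>u. f (u $ j - c)) has_derivative (\<lambda>h. f' * (h $ j))) (at u)"
    using has_derivative_compose[OF d assms[unfolded has_field_derivative_def]] .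
  from pd_unique[OF this, of i] show ?thesis by (auto simp: axis_def)
qed

lemma test_function_subset: "test_function U \<psi> \<Longrightarrow> U \<subseteq> V \<Longrightarrow> test_function V \<psi>"
  unfolding test_function_def by blast

lemma test_functionE:
  assumes "test_function U \<psi>"
  obtains K where "compact K" "K \<subseteq> U" "\<And>u. u \<notin> K \<Longrightarrow> \<psi> u = 0"
  using assms unfolding test_function_def by blast

lemma test_smooth: "test_function U \<psi> \<Longrightarrow> smooth_on UNIV \<psi>"
  by (simp add: test_function_def)

lemma pd_zero_outside:
  assumes "compact K" "\<And>u. u \<notin> K \<Longrightarrow> \<psi> u = 0" "u \<notin> K"
  shows "pd j \<psi> u = 0"
  using pd_cong[of "- K" u "\<lambda>_. 0" \<psi> j] assms compact_imp_closed by auto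

lemma test_pd: "test_function U \<psi> \<Longrightarrow> test_function U (pd j \<psi>)"
proof -
  assume t: "test_function U \<psi>"
  obtain K where K: "compact K" "K \<subseteq> U" "\<And>u. u \<notin> K \<Longrightarrow> \<psi> u = 0" by (rule test_functionE[OF t]) blast
  show ?thesis
    unfolding test_function_def
    using K(1,2) pd_zero_outside[OF K(1,3), where j = j] smooth_on_pd[OF test_smooth[OF t]]
    by (intro conjI exI[of _ K]) simp_all
qed

lemma test_mult: "test_function U \<theta> \<Longrightarrow> smooth_on UNIV \<Psi> \<Longrightarrow> test_function U (\<lambda>u. \<theta> u * \<Psi> u)"
  unfolding test_function_def by (auto intro!: smooth_on_mult)

lemma test_mult_local:
  assumes "test_function U \<psi>" "smooth_on U T"
  shows "test_function U (\<lambda>u. if u \<in> U then \<psi> u * T u else 0)" (is "test_function U ?f")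
proof -
  obtain K where K: "compact K" "K \<subseteq> U" "\<And>u. u \<notin> K \<Longrightarrow> \<psi> u = 0" by (rule test_functionE[OF assms(1)]) blast
  have "smooth_on U (\<lambda>u. \<psi> u * T u)"
    using smooth_on_mult[OF smooth_on_subset[OF test_smooth[OF assms(1)]] assms(2)] smooth_on_open[OF assms(2)] by simp
  then have "smooth_on U ?f" by (rule smooth_on_cong) simp
  moreover have "smooth_on (- K) ?f"
    by (rule smooth_on_cong[OF smooth_on_const]) (use K compact_imp_closed in auto)
  ultimately have "smooth_on (U \<union> - K) ?f" by (rule smooth_on_Un)
  moreover have "U \<union> - K = UNIV" using K(2) by blast
  ultimately show ?thesis unfolding test_function_def using K by auto
qed

definition bump2 :: "real \<Rightarrow> real^2 \<Rightarrow> real^2 \<Rightarrow> real^2 \<Rightarrow> real" where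
  "bump2 n a b u = bump n (a $ 1) (b $ 1) (u $ 1) * bump n (a $ 2) (b $ 2) (u $ 2)"

lemma mem_box_2: fixes u :: "real^2" shows "u \<in> box a b \<longleftrightarrow> a$1 < u$1 \<and> u$1 < b$1 \<and> a$2 < u$2 \<and> u$2 < b$(2::2)"
  by (auto simp: mem_box_cart forall_2)

lemma bump2_eq_0: "n > 0 \<Longrightarrow> u \<notin> box a b \<Longrightarrow> bump2 n a b u = 0"
  unfolding mem_box_2 bump2_def using bump_eq_0[of n] by (metis linorder_not_less mult_eq_0_iff)

lemma bump2_pos: "n > 0 \<Longrightarrow> u \<in> box a b \<Longrightarrow> bump2 n a b u > 0"
  unfolding mem_box_2 bump2_def using bump_pos[of n] by simp

lemma smooth_bump2: "smooth_on UNIV (bump2 n a b)"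
proof -
  have "smooth_on UNIV (\<lambda>u::real^2. bump n (a $ 1) (b $ 1) (u $ 1 - 0) * bump n (a $ 2) (b $ 2) (u $ 2 - 0))"
    by (intro smooth_on_mult smooth_on_compose_nth smooth_bump)
  then show ?thesis by (simp add: bump2_def[abs_def])
qed

lemma test_bump2: "n > 0 \<Longrightarrow> cbox a b \<subseteq> U \<Longrightarrow> test_function U (bump2 n a b)"
  unfolding test_function_def
  using smooth_bump2 bump2_eq_0 box_subset_cbox compact_cbox by (metis subsetD)

lemma has_bochner_integral_prod_2:
  fixes f g :: "real \<Rightarrow> real" and j k :: 2
  assumes "j \<noteq> k" "integrable lborel f" "integrable lborel g" "\<And>x. 0 \<le> f x" "\<And>x. 0 \<le> g x"
  shows "has_bochner_integral lborel (\<lambda>u. f (u $ j) * g (u $ k)) (integral\<^sup>L lborel f * integral\<^sup>L lborel g)"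
proof (rule has_bochner_integral_nn_integral)
  have [measurable]: "f \<in> borel_measurable borel" "g \<in> borel_measurable borel"
    using assms(2,3) borel_measurable_integrable by auto
  show "(\<lambda>u. f (u $ j) * g (u $ k)) \<in> borel_measurable lborel" by measurable
  show "AE u in lborel. 0 \<le> f (u $ j) * g (u $ k)" using assms by simp
  show "0 \<le> integral\<^sup>L lborel f * integral\<^sup>L lborel g" using assms by simp
  define F :: "real^2 \<Rightarrow> real \<Rightarrow> ennreal" where "F b = (if b = axis j 1 then f else g)" for b
  have U: "(UNIV :: 2 set) = {j, k}" using assms(1) exhaust_2[of j] exhaust_2[of k] by (auto simp: UNIV_2)
  have ne: "axis j (1::real) \<noteq> axis k 1" using assms(1) by (simp add: axis_eq_axis)
  have B: "(Basis :: (real^2) set) = {axis j 1, axis k 1}"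
    unfolding Basis_vec_def using U by auto
  have "(\<integral>\<^sup>+u. (\<Prod>b\<in>Basis. F b (u \<bullet> b)) \<partial>lborel) = (\<Prod>b\<in>Basis. (\<integral>\<^sup>+x. F b x \<partial>lborel))"
    by (rule nn_integral_lborel_prod) (auto simp: F_def)
  moreover have "(\<Prod>b\<in>Basis. F b (u \<bullet> b)) = ennreal (f (u $ j) * g (u $ k))" for u
    using ne assms by (simp add: B F_def inner_axis ennreal_mult)
  moreover have "(\<Prod>b\<in>Basis. (\<integral>\<^sup>+x. F b x \<partial>lborel)) = ennreal (integral\<^sup>L lborel f * integral\<^sup>L lborel g)"
    using ne assms by (simp add: B F_def nn_integral_eq_integral ennreal_mult)
  ultimately show "(\<integral>\<^sup>+u. ennreal (f (u $ j) * g (u $ k)) \<partial>lborel) = ennreal (integral\<^sup>L lborel f * integral\<^sup>L lborel g)"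
    by simp
qed

section \<open>Weak derivatives in the plane\<close>

lemma AE_lborel_local:
  fixes P :: "'a::euclidean_space \<Rightarrow> bool"
  assumes "\<And>u. u \<in> U \<Longrightarrow> \<exists>V. open V \<and> u \<in> V \<and> (AE x in lborel. x \<in> V \<longrightarrow> P x)"
  shows "AE x in lborel. x \<in> U \<longrightarrow> P x"
proof -
  define F where "F = {V. open V \<and> (AE x in lborel. x \<in> V \<longrightarrow> P x)}"
  obtain F' where F': "F' \<subseteq> F" "countable F'" "\<Union>F' = \<Union>F"
    using Lindelof[of F] unfolding F_def by auto
  have "AE x in lborel. \<forall>V\<in>F'. x \<in> V \<longrightarrow> P x"
    by (rule AE_ball_countable'[OF _ F'(2)]) (use F'(1) in \<open>auto simp: F_def\<close>)
  moreover have "U \<subseteq> \<Union>F'"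
    using assms unfolding F'(3) F_def by blast
  ultimately show ?thesis by (auto elim!: eventually_mono)
qed

lemma AE_lborel_negligible:
  fixes N :: "'a::euclidean_space set"
  assumes "negligible N" shows "AE x in lborel. x \<notin> N"
proof -
  have "N \<in> null_sets lebesgue" using assms negligible_iff_null_sets by blast
  then have "AE x in lebesgue. x \<notin> N" by (rule AE_not_in)
  then show ?thesis using AE_completion_iff by blast
qed

definition locint :: "(real^2) set \<Rightarrow> (real^2 \<Rightarrow> real) \<Rightarrow> bool" where
  "locint U f \<longleftrightarrow> (\<forall>K. compact K \<and> K \<subseteq> U \<longrightarrow> set_integrable lborel K f)"

lemma locint_supported_integrable:
  assumes "continuous_on UNIV \<theta>" "compact K" "K \<subseteq> U" "\<And>u. u \<notin> K \<Longrightarrow> \<theta> u = 0" "locint U f"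
  shows "integrable lborel (\<lambda>u. \<theta> u * f u)"
proof -
  have i: "integrable lborel (\<lambda>u. indicator K u *\<^sub>R f u)"
    using assms unfolding locint_def set_integrable_def by blast
  have m: "(\<lambda>u. indicator K u *\<^sub>R f u) \<in> borel_measurable borel"
    using borel_measurable_integrable[OF i] by simp
  have \<theta>[measurable]: "\<theta> \<in> borel_measurable borel"
    by (rule borel_measurable_continuous_onI[OF assms(1)])
  have eq: "\<theta> u * f u = \<theta> u * (indicator K u *\<^sub>R f u)" for u
    using assms(4)[of u] by (cases "u \<in> K") auto
  have "bounded (\<theta> ` K)"
    using compact_continuous_image[OF continuous_on_subset[OF assms(1)] assms(2)] compact_imp_bounded by blast
  then obtain C where C: "\<And>u. u \<in> K \<Longrightarrow> \<bar>\<theta> u\<bar> \<le> C"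
    unfolding bounded_iff by auto
  show ?thesis
  proof (rule Bochner_Integration.integrable_bound)
    show "integrable lborel (\<lambda>u. C * (indicator K u *\<^sub>R f u))" using i by simp
    show "(\<lambda>u. \<theta> u * f u) \<in> borel_measurable lborel"
      unfolding eq using m by simp
    have "norm (\<theta> u * f u) \<le> norm (C * (indicator K u *\<^sub>R f u))" for u
    proof (cases "u \<in> K")
      case True
      then have "\<bar>\<theta> u\<bar> * \<bar>f u\<bar> \<le> \<bar>C\<bar> * \<bar>f u\<bar>" using C[OF True] by (intro mult_right_mono) auto
      then show ?thesis using True by (simp add: abs_mult)
    qed (use assms(4) in auto)
    then show "AE u in lborel. norm (\<theta> u * f u) \<le> norm (C * (indicator K u *\<^sub>R f u))" by simp
  qed
qed

lemma test_integrable: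
  assumes "test_function U \<psi>" "locint U f"
  shows "integrable lborel (\<lambda>u. \<psi> u * f u)"
proof -
  obtain K where K: "compact K" "K \<subseteq> U" "\<And>u. u \<notin> K \<Longrightarrow> \<psi> u = 0" by (rule test_functionE[OF assms(1)]) blast
  show ?thesis
    by (rule locint_supported_integrable[OF smooth_on_continuous_on[OF test_smooth[OF assms(1)]] K assms(2)])
qed

lemma test_times_integrable:
  assumes "test_function U \<theta>" "continuous_on UNIV \<Psi>" "locint U f"
  shows "integrable lborel (\<lambda>u. \<Psi> u * (\<theta> u * f u))"
proof -
  obtain K where K: "compact K" "K \<subseteq> U" "\<And>u. u \<notin> K \<Longrightarrow> \<theta> u = 0" by (rule test_functionE[OF assms(1)]) blast
  have c: "continuous_on UNIV (\<lambda>u. \<Psi> u * \<theta> u)"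
    by (intro continuous_on_mult assms(2) smooth_on_continuous_on[OF test_smooth[OF assms(1)]])
  have "integrable lborel (\<lambda>u. (\<Psi> u * \<theta> u) * f u)"
    by (rule locint_supported_integrable[OF c K(1,2) _ assms(3)]) (simp add: K(3))
  then show ?thesis by (simp add: mult.assoc)
qed

lemma locint_mult:
  assumes "continuous_on U T" "locint U f"
  shows "locint U (\<lambda>u. T u * f u)"
  unfolding locint_def
proof (intro allI impI)
  fix K assume K: "compact K \<and> K \<subseteq> U"
  have i: "integrable lborel (\<lambda>u. indicator K u *\<^sub>R f u)"
    using assms(2) K unfolding locint_def set_integrable_def by blast
  have c: "continuous_on K T" using continuous_on_subset[OF assms(1)] K by blast
  have m: "(\<lambda>u. indicator K u *\<^sub>R T u) \<in> borel_measurable borel"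
    using borel_measurable_continuous_on_indicator[OF _ c] K borel_compact by blast
  have m2: "(\<lambda>u. indicator K u *\<^sub>R f u) \<in> borel_measurable borel"
    using borel_measurable_integrable[OF i] by simp
  have "bounded (T ` K)"
    using compact_continuous_image[OF c] K compact_imp_bounded by blast
  then obtain C where C: "\<And>u. u \<in> K \<Longrightarrow> \<bar>T u\<bar> \<le> C"
    unfolding bounded_iff by auto
  show "set_integrable lborel K (\<lambda>u. T u * f u)"
    unfolding set_integrable_def
  proof (rule Bochner_Integration.integrable_bound)
    show "integrable lborel (\<lambda>u. C * (indicator K u *\<^sub>R f u))" using i by simp
    have "(\<lambda>u. (indicator K u *\<^sub>R T u) * (indicator K u *\<^sub>R f u)) \<in> borel_measurable borel"
      using m m2 by (rule borel_measurable_times)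
    moreover have "(\<lambda>u. (indicator K u *\<^sub>R T u) * (indicator K u *\<^sub>R f u)) = (\<lambda>u. indicator K u *\<^sub>R (T u * f u))"
      by (auto simp: indicator_def)
    ultimately show "(\<lambda>u. indicator K u *\<^sub>R (T u * f u)) \<in> borel_measurable lborel" by simp
    have "norm (indicator K u *\<^sub>R (T u * f u)) \<le> norm (C * (indicator K u *\<^sub>R f u))" for u
    proof (cases "u \<in> K")
      case True
      then have "\<bar>T u\<bar> * \<bar>f u\<bar> \<le> \<bar>C\<bar> * \<bar>f u\<bar>" using C[OF True] by (intro mult_right_mono) auto
      then show ?thesis using True by (simp add: abs_mult)
    qed auto
    then show "AE u in lborel. norm (indicator K u *\<^sub>R (T u * f u)) \<le> norm (C * (indicator K u *\<^sub>R f u))" by simp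
  qed
qed

lemma locint_add: "locint U f \<Longrightarrow> locint U g \<Longrightarrow> locint U (\<lambda>u. f u + g u)"
  unfolding locint_def by (auto intro: set_integral_add(1))

lemma locint_zero: "locint U (\<lambda>u. 0)"
  unfolding locint_def set_integrable_def by simp

lemma locint_sum: "(\<And>i. i \<in> I \<Longrightarrow> locint U (f i)) \<Longrightarrow> locint U (\<lambda>u. \<Sum>i\<in>I. f i u)"
  by (induction I rule: infinite_finite_induct) (auto simp: locint_zero locint_add)

lemma locint_subset: "locint U f \<Longrightarrow> V \<subseteq> U \<Longrightarrow> locint V f"
  unfolding locint_def by blast

lemma locint_continuous: "continuous_on U f \<Longrightarrow> locint U f"
  unfolding locint_def set_integrable_def
  using borel_integrable_compact continuous_on_subset by blast

lemma AE_zero_of_bump_integrals: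
  assumes U: "open U" and f: "locint U f"
    and zero: "\<And>n a b. n > 0 \<Longrightarrow> cbox a b \<subseteq> U \<Longrightarrow> (LINT u|lborel. bump2 n a b u * f u) = 0"
  shows "AE u in lborel. u \<in> U \<longrightarrow> f u = 0"
proof (rule AE_lborel_local)
  fix u assume "u \<in> U"
  then obtain c d where cd: "cbox c d \<subseteq> U" "u \<in> box c d"
    using open_contains_cbox[OF U] by metis
  define g where "g u = indicator (cbox c d) u *\<^sub>R f u" for u
  have g: "integrable lborel g"
    using f cd(1) unfolding locint_def set_integrable_def g_def by simp
  have 1: "(LINT u|lborel. indicator (box a b) u *\<^sub>R g u) = 0" if "box a b \<subseteq> box c d" for a b
  proof (cases "box a b = {}")
    case False
    have sub: "cbox a b \<subseteq> cbox c d"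
      using closure_mono[OF that] False that by (metis box_subset_cbox closure_box subset_empty subset_box(3) closure_minimal closed_cbox subset_trans)
    then have eq: "bump2 n a b u * f u = bump2 n a b u * g u" if "n > 0" for n u
      using bump2_eq_0[OF that, of u a b] box_subset_cbox[of a b] by (cases "u \<in> box a b") (auto simp: g_def)
    have "(\<lambda>k. LINT u|lborel. bump2 (real (Suc k)) a b u * g u) \<longlonglongrightarrow> (LINT u|lborel. indicator (box a b) u *\<^sub>R g u)"
    proof (rule integral_dominated_convergence)
      show "integrable lborel (\<lambda>u. \<bar>g u\<bar>)" using g by simp
      have [measurable]: "g \<in> borel_measurable borel" using borel_measurable_integrable[OF g] by simp
      show "(\<lambda>u. indicator (box a b) u *\<^sub>R g u) \<in> borel_measurable lborel" by measurable
      have "bump2 n a b \<in> borel_measurable borel" for n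
        using smooth_on_continuous_on[OF smooth_bump2] by (rule borel_measurable_continuous_onI)
      then show "(\<lambda>u. bump2 (real (Suc k)) a b u * g u) \<in> borel_measurable lborel" for k by simp
      have "(\<lambda>k. bump2 (real (Suc k)) a b u) \<longlonglongrightarrow> indicator (box a b) u" for u
      proof -
        have "(\<lambda>k. bump2 (real (Suc k)) a b u) \<longlonglongrightarrow> indicator {a$1<..<b$1} (u$1) * indicator {a$2<..<b$2} (u$2)"
          unfolding bump2_def by (intro tendsto_mult bump_tendsto_indicator)
        then show ?thesis by (simp add: indicator_def mem_box_2 conj_assoc flip: of_bool_conj)
      qed
      then show "AE u in lborel. (\<lambda>k. bump2 (real (Suc k)) a b u * g u) \<longlonglongrightarrow> indicator (box a b) u *\<^sub>R g u"
        by (auto intro!: tendsto_mult)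
      have "\<bar>bump2 n a b u\<bar> \<le> 1" for n u
        unfolding bump2_def by (simp add: abs_mult bump_range mult_le_one)
      then have "norm (bump2 n a b u * g u) \<le> \<bar>g u\<bar>" for n u
        by (simp add: abs_mult mult_left_le_one_le)
      then show "AE u in lborel. norm (bump2 (real (Suc k)) a b u * g u) \<le> \<bar>g u\<bar>" for k by simp
    qed
    moreover have "(LINT u|lborel. bump2 (real (Suc k)) a b u * g u) = 0" for k
      using zero[of "real (Suc k)" a b] sub cd(1) eq[of "real (Suc k)"] by (simp del: of_nat_Suc)
    ultimately show ?thesis by (simp add: LIMSEQ_const_iff del: of_nat_Suc)
  qed simp
  have 2: "(LINT u|lborel. indicator (box a b) u *\<^sub>R g u) = 0" for a b
  proof -
    obtain a' b' where ab: "box a b \<inter> box c d = box a' b'"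
      using box_Int_box by blast
    have "(LINT u|lborel. indicator (box a b) u *\<^sub>R g u) = (LINT u|lborel. indicator (box a' b') u *\<^sub>R g u)"
    proof (rule integral_cong_AE)
      have [measurable]: "g \<in> borel_measurable borel" using borel_measurable_integrable[OF g] by simp
      show "(\<lambda>u. indicator (box a b) u *\<^sub>R g u) \<in> borel_measurable lborel"
        "(\<lambda>u. indicator (box a' b') u *\<^sub>R g u) \<in> borel_measurable lborel" by measurable
      show "AE u in lborel. indicator (box a b) u *\<^sub>R g u = indicator (box a' b') u *\<^sub>R g u"
        using AE_lborel_negligible[OF negligible_frontier_interval[of c d]]
        by eventually_elim (auto simp: ab[symmetric] g_def indicator_def)
    qed
    also have "\<dots> = 0" by (rule 1) (use ab in blast)
    finally show ?thesis .
  qed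
  have tot: "(LINT u|lborel. g u) = 0"
  proof -
    obtain a b where ab: "cbox c d \<subseteq> box a b"
      using bounded_subset_box_symmetric[OF bounded_cbox] by metis
    have "g u = indicator (box a b) u *\<^sub>R g u" for u
      using ab by (auto simp: g_def indicator_def)
    then have "g = (\<lambda>u. indicator (box a b) u *\<^sub>R g u)" by blast
    then show ?thesis using 2[of a b] by (simp only:)
  qed
  have "(LINT u:A|lborel. g u) = 0" if "A \<in> sets lborel" for A
  proof -
    have "Int_stable (range (\<lambda> (a, b). box a b :: (real^2) set))"
      by (auto simp: Int_stable_def box_Int_box)
    moreover have "range (\<lambda>(a, b). box a b :: (real^2) set) \<subseteq> Pow UNIV" by simp
    moreover have "A \<in> sigma_sets UNIV (range (\<lambda> (a, b). box a b :: (real^2) set))"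
      using that by (simp add: borel_eq_box)
    ultimately show ?thesis
    proof (induction rule: sigma_sets_induct_disjoint)
      case (basic A)
      then show ?case using 2 by (auto simp: set_lebesgue_integral_def)
    next
      case empty
      show ?case by (simp add: set_lebesgue_integral_def)
    next
      case (compl A)
      have A: "A \<in> sets lborel" using compl(1) by (simp add: borel_eq_box)
      have "(LINT u:(UNIV - A)|lborel. g u) = (LINT u|lborel. g u - indicator A u *\<^sub>R g u)"
        unfolding set_lebesgue_integral_def by (rule Bochner_Integration.integral_cong) (auto simp: indicator_def)
      also have "\<dots> = 0"
        using tot compl(2) integrable_mult_indicator[OF A g]
        by (simp add: Bochner_Integration.integral_diff[OF g] set_lebesgue_integral_def)
      finally show ?case .
    next
      case (union A)
      have A: "A i \<in> sets lborel" for i using union(2) by (auto simp: borel_eq_box)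
      have "(LINT u:(\<Union>i. A i)|lborel. g u) = (\<Sum>i. (LINT u:(A i)|lborel. g u))"
      proof (rule lebesgue_integral_countable_add[OF A])
        show "A i \<inter> A j = {}" if "i \<noteq> j" for i j
          using union(1) that by (auto simp: disjoint_family_on_def)
        show "set_integrable lborel (\<Union>i. A i) g"
          unfolding set_integrable_def using A g by (intro integrable_mult_indicator) auto
      qed
      then show ?case using union(3) by simp
    qed
  qed
  then have "AE u in lborel. g u = 0"
    using density_unique_real[OF g, of "\<lambda>_. 0"] by (simp add: set_lebesgue_integral_def)
  then have "AE x in lborel. x \<in> box c d \<longrightarrow> f x = 0"
    using box_subset_cbox[of c d] by (auto elim!: eventually_mono simp: g_def indicator_def)
  then show "\<exists>V. open V \<and> u \<in> V \<and> (AE x in lborel. x \<in> V \<longrightarrow> f x = 0)"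
    using cd(2) open_box by blast
qed

definition wk :: "(real^2) set \<Rightarrow> 2 \<Rightarrow> (real^2 \<Rightarrow> real) \<Rightarrow> (real^2 \<Rightarrow> real) \<Rightarrow> bool" where
  "wk U j f g \<longleftrightarrow> locint U f \<and> locint U g \<and>
     (\<forall>\<psi>. test_function U \<psi> \<longrightarrow> (LINT u|lborel. pd j \<psi> u * f u) = - (LINT u|lborel. \<psi> u * g u))"

lemma wkD:
  assumes "wk U j f g"
  shows "locint U f" "locint U g"
    "test_function U \<psi> \<Longrightarrow> (LINT u|lborel. pd j \<psi> u * f u) = - (LINT u|lborel. \<psi> u * g u)"
  using assms unfolding wk_def by blast+

lemma wk_subset: "wk U j f g \<Longrightarrow> V \<subseteq> U \<Longrightarrow> wk V j f g"
  unfolding wk_def using locint_subset test_function_subset by blast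

lemma wk_add:
  assumes "wk U j f g" "wk U j f' g'"
  shows "wk U j (\<lambda>u. f u + f' u) (\<lambda>u. g u + g' u)"
  unfolding wk_def
proof (intro conjI allI impI locint_add wkD[OF assms(1)] wkD[OF assms(2)])
  fix \<psi> assume t: "test_function U \<psi>"
  note i = test_integrable[OF t] test_integrable[OF test_pd[OF t]]
  show "(LINT u|lborel. pd j \<psi> u * (f u + f' u)) = - (LINT u|lborel. \<psi> u * (g u + g' u))"
    using wkD(3)[OF assms(1) t] wkD(3)[OF assms(2) t] i wkD(1,2)[OF assms(1)] wkD(1,2)[OF assms(2)]
    by (simp add: distrib_left)
qed

lemma wk_zero: "wk U j (\<lambda>u. 0) (\<lambda>u. 0)"
  by (simp add: wk_def locint_zero)

lemma wk_sum:
  "(\<And>i. i \<in> I \<Longrightarrow> wk U j (f i) (g i)) \<Longrightarrow> wk U j (\<lambda>u. \<Sum>i\<in>I. f i u) (\<lambda>u. \<Sum>i\<in>I. g i u)"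
  by (induction I rule: infinite_finite_induct) (auto simp: wk_zero wk_add)

lemma wk_cong_AE:
  assumes "wk U j f g" "locint U f'" "locint U g'"
    "AE u in lborel. u \<in> U \<longrightarrow> f u = f' u" "AE u in lborel. u \<in> U \<longrightarrow> g u = g' u"
  shows "wk U j f' g'"
  unfolding wk_def
proof (intro conjI allI impI assms(2,3))
  fix \<psi> assume t: "test_function U \<psi>"
  have eq: "(LINT u|lborel. \<theta> u * p u) = (LINT u|lborel. \<theta> u * q u)"
    if th: "test_function U \<theta>" "locint U p" "locint U q" "AE u in lborel. u \<in> U \<longrightarrow> p u = q u" for \<theta> p q
  proof (rule integral_cong_AE)
    obtain K where K: "compact K" "K \<subseteq> U" "\<And>u. u \<notin> K \<Longrightarrow> \<theta> u = 0" by (rule test_functionE[OF th(1)]) blast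
    show "AE u in lborel. \<theta> u * p u = \<theta> u * q u"
      using th(4) by eventually_elim (use K in force)
  qed (use test_integrable[OF th(1) th(2)] test_integrable[OF th(1) th(3)] borel_measurable_integrable in blast)+
  show "(LINT u|lborel. pd j \<psi> u * f' u) = - (LINT u|lborel. \<psi> u * g' u)"
    using wkD(3)[OF assms(1) t] eq[OF test_pd[OF t] wkD(1)[OF assms(1)] assms(2,4)]
      eq[OF t wkD(2)[OF assms(1)] assms(3,5)] by simp
qed

lemma wk_mult_smooth:
  assumes "wk U j f g" "smooth_on U T"
  shows "wk U j (\<lambda>u. T u * f u) (\<lambda>u. T u * g u + pd j T u * f u)"
  unfolding wk_def
proof (intro conjI allI impI locint_add locint_mult smooth_on_continuous_on smooth_on_pd assms(2) wkD(1,2)[OF assms(1)])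
  fix \<psi> assume t: "test_function U \<psi>"
  obtain K where K: "compact K" "K \<subseteq> U" "\<And>u. u \<notin> K \<Longrightarrow> \<psi> u = 0" by (rule test_functionE[OF t]) blast
  define \<theta> where "\<theta> u = (if u \<in> U then \<psi> u * T u else 0)" for u
  have t': "test_function U \<theta>" unfolding \<theta>_def by (rule test_mult_local[OF t assms(2)])
  have pd: "pd j \<theta> u = pd j \<psi> u * T u + \<psi> u * pd j T u" if "u \<in> U" for u
  proof -
    have d: "\<psi> differentiable (at u)" "T differentiable (at u)"
      using smooth_on_differentiable[OF test_smooth[OF t]] smooth_on_differentiable[OF assms(2) that] by auto
    have "pd j \<theta> u = pd j (\<lambda>u. \<psi> u * T u) u"
      by (rule pd_cong[OF smooth_on_open[OF assms(2)] that]) 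
        (use smooth_on_differentiable[OF test_smooth[OF t']] in \<open>auto simp: \<theta>_def\<close>)
    then show ?thesis using pd_mult[OF d] by simp
  qed
  note pd0 = pd_zero_outside[OF K(1,3)]
  have \<theta>0: "u \<notin> K \<Longrightarrow> \<theta> u = 0" for u by (simp add: \<theta>_def K(3))
  have 1: "pd j \<theta> u * f u = pd j \<psi> u * (T u * f u) + \<psi> u * (pd j T u * f u)" for u
    using pd[of u] pd0[where u = u and j = j] K(2,3) pd_zero_outside[OF K(1) \<theta>0, where u = u and j = j]
    by (cases "u \<in> K") (auto simp: algebra_simps)
  have 2: "\<theta> u * g u = \<psi> u * (T u * g u)" for u
    using K(2,3) by (cases "u \<in> K") (auto simp: \<theta>_def)
  have cT: "continuous_on U T" "continuous_on U (pd j T)"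
    by (intro smooth_on_continuous_on assms(2) smooth_on_pd)+
  have i: "integrable lborel (\<lambda>u. pd j \<psi> u * (T u * f u))" "integrable lborel (\<lambda>u. \<psi> u * (pd j T u * f u))"
     "integrable lborel (\<lambda>u. \<psi> u * (T u * g u))"
    by (intro test_integrable[OF t] test_integrable[OF test_pd[OF t]] locint_mult cT wkD(1,2)[OF assms(1)])+
  have "(LINT u|lborel. pd j \<psi> u * (T u * f u)) + (LINT u|lborel. \<psi> u * (pd j T u * f u)) = - (LINT u|lborel. \<psi> u * (T u * g u))"
    using wkD(3)[OF assms(1) t'] i unfolding 1 2 by simp
  then show "(LINT u|lborel. pd j \<psi> u * (T u * f u)) = - (LINT u|lborel. \<psi> u * (T u * g u + pd j T u * f u))"
    using i by (simp add: distrib_left)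
qed

lemma wk_test_mult:
  assumes "wk U j f g" "test_function U \<theta>" "smooth_on UNIV \<Psi>"
  shows "(LINT u|lborel. pd j \<Psi> u * (\<theta> u * f u)) = - (LINT u|lborel. \<Psi> u * (\<theta> u * g u + pd j \<theta> u * f u))"
proof -
  note t = test_mult[OF assms(2,3)]
  have c: "continuous_on UNIV \<Psi>" "continuous_on UNIV (pd j \<Psi>)"
    by (intro smooth_on_continuous_on assms(3) smooth_on_pd)+
  have "pd j (\<lambda>u. \<theta> u * \<Psi> u) u = pd j \<theta> u * \<Psi> u + \<theta> u * pd j \<Psi> u" for u
    using smooth_on_differentiable[OF test_smooth[OF assms(2)]] smooth_on_differentiable[OF assms(3)]
    by (intro pd_mult) auto
  then have 1: "pd j (\<lambda>u. \<theta> u * \<Psi> u) u * f u = \<Psi> u * (pd j \<theta> u * f u) + pd j \<Psi> u * (\<theta> u * f u)" for u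
    by (simp add: algebra_simps)
  have 2: "\<theta> u * \<Psi> u * g u = \<Psi> u * (\<theta> u * g u)" for u by simp
  have i: "integrable lborel (\<lambda>u. \<Psi> u * (pd j \<theta> u * f u))" "integrable lborel (\<lambda>u. pd j \<Psi> u * (\<theta> u * f u))"
     "integrable lborel (\<lambda>u. \<Psi> u * (\<theta> u * g u))"
    by (intro test_times_integrable[of U] assms(2) test_pd c wkD(1,2)[OF assms(1)])+
  have "(LINT u|lborel. \<Psi> u * (pd j \<theta> u * f u)) + (LINT u|lborel. pd j \<Psi> u * (\<theta> u * f u)) = - (LINT u|lborel. \<Psi> u * (\<theta> u * g u))"
    using wkD(3)[OF assms(1) t] i unfolding 1 2 by simp
  then show ?thesis using i by (simp add: distrib_left)
qed

section \<open>Regularity of linear first-order systems\<close>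

lemma negligible_coordinate: "negligible {v::real^'n. v $ j = c}"
proof -
  have "negligible {v::real^'n. v \<bullet> axis j 1 = c}"
    by (rule negligible_standard_hyperplane) (simp add: axis_in_Basis_iff)
  then show ?thesis by (simp add: inner_axis)
qed

lemma continuous_on_quadrant_integral:
  fixes h :: "real^2 \<Rightarrow> real"
  assumes "integrable lborel h"
  shows "continuous_on UNIV (\<lambda>u::real^2. LINT v|lborel. indicator {..<u$1} (v$1) * indicator {..<u$2} (v$2) * h v)"
  unfolding continuous_on_sequentially comp_def
proof (intro allI impI ballI, elim conjE)
  fix X :: "nat \<Rightarrow> real^2" and u assume X: "X \<longlonglongrightarrow> u"
  have lim: "(\<lambda>k. indicator {..<X k$j} (v$j) :: real) \<longlonglongrightarrow> indicator {..<u$j} (v$j)" if "v$j \<noteq> u$j" for v :: "real^2" and j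
  proof -
    have "(\<lambda>k. X k$j) \<longlonglongrightarrow> u$j" by (intro tendsto_intros X)
    then have "\<forall>\<^sub>F k in sequentially. (indicator {..<X k$j} (v$j) :: real) = indicator {..<u$j} (v$j)"
      using that order_tendstoD[of "\<lambda>k. X k$j" "u$j" sequentially "v$j"]
      by (cases "v$j < u$j") (auto elim!: eventually_mono simp: indicator_def)
    then show ?thesis by (rule tendsto_eventually)
  qed
  have [measurable]: "h \<in> borel_measurable borel" using borel_measurable_integrable[OF assms] by simp
  show "(\<lambda>k. LINT v|lborel. indicator {..<X k$1} (v$1) * indicator {..<X k$2} (v$2) * h v)
      \<longlonglongrightarrow> (LINT v|lborel. indicator {..<u$1} (v$1) * indicator {..<u$2} (v$2) * h v)"
  proof (rule integral_dominated_convergence[where w = "\<lambda>v. \<bar>h v\<bar>"])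
    show "AE v in lborel. (\<lambda>k. indicator {..<X k$1} (v$1) * indicator {..<X k$2} (v$2) * h v)
        \<longlonglongrightarrow> indicator {..<u$1} (v$1) * indicator {..<u$2} (v$2) * h v"
      using AE_lborel_negligible[OF negligible_coordinate[of 1 "u$1"]]
        AE_lborel_negligible[OF negligible_coordinate[of 2 "u$2"]]
      by eventually_elim (auto intro!: tendsto_mult lim)
    show "AE v in lborel. norm (indicator {..<X k$1} (v$1) * indicator {..<X k$2} (v$2) * h v) \<le> \<bar>h v\<bar>" for k
      by (auto simp: indicator_def)
  qed (use assms in \<open>auto\<close>)
qed

text \<open>
  The function \<open>\<eta> f\<close>, with \<open>\<eta>\<close> a bump on the box, is the integral of its weak mixed derivative h over
  the lower left quadrant; tested against products of bumps this is Fubini's theorem.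
\<close>

lemma wk_continuous_rep:
  assumes U: "cbox a b \<subseteq> U" and f1: "wk U 1 f f1" and f2: "wk U 2 f f2" and f21: "wk U 1 f2 f21"
  shows "\<exists>g. continuous_on (box a b) g \<and> (AE u in lborel. u \<in> box a b \<longrightarrow> f u = g u)"
proof -
  define \<eta> where "\<eta> = bump2 1 a b"
  have \<eta>: "test_function U \<eta>" unfolding \<eta>_def by (rule test_bump2) (use U in auto)
  have \<eta>2: "test_function U (pd 2 \<eta>)" by (rule test_pd[OF \<eta>])
  define h where "h u = (\<eta> u * f21 u + pd 1 \<eta> u * f2 u) + (pd 2 \<eta> u * f1 u + pd 1 (pd 2 \<eta>) u * f u)" for u
  note loc = wkD(1,2)[OF f1] wkD(1,2)[OF f2] wkD(2)[OF f21]
  have h: "integrable lborel h"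
    unfolding h_def
    by (intro Bochner_Integration.integrable_add test_integrable[of U] \<eta> \<eta>2 test_pd loc)
  have [measurable]: "h \<in> borel_measurable borel" using borel_measurable_integrable[OF h] by simp
  define F where "F u = (LINT v|lborel. indicator {..<u$1} (v$1) * indicator {..<u$2} (v$2) * h v)" for u :: "real^2"
  have F: "continuous_on UNIV F"
    unfolding F_def by (rule continuous_on_quadrant_integral[OF h])
  have "AE u in lborel. u \<in> box a b \<longrightarrow> \<eta> u * f u + - 1 * F u = 0"
  proof (rule AE_zero_of_bump_integrals[OF open_box])
    have Fl: "locint (box a b) F"
      by (rule locint_continuous[OF continuous_on_subset[OF F]]) simp
    have \<eta>fl: "locint (box a b) (\<lambda>u. \<eta> u * f u)"
      using locint_mult[OF continuous_on_subset[OF smooth_on_continuous_on[OF test_smooth[OF \<eta>]] subset_UNIV]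
          locint_subset[OF loc(1)], of "box a b"] U box_subset_cbox by blast
    show "locint (box a b) (\<lambda>u. \<eta> u * f u + - 1 * F u)"
      by (intro locint_add \<eta>fl locint_mult[OF continuous_on_const Fl])
    fix n :: real and c d assume n: "n > 0" and cd: "cbox c d \<subseteq> box a b"
    define \<beta>1 where "\<beta>1 = bump n (c$1) (d$1)"
    define \<beta>2 where "\<beta>2 = bump n (c$2) (d$2)"
    define P1 where "P1 = bump_tail n (c$1) (d$1)"
    define P2 where "P2 = bump_tail n (c$2) (d$2)"
    define \<psi> where "\<psi> = bump2 n c d"
    define \<Psi> where "\<Psi> u = P1 (u$1 - 0) * P2 (u$2 - 0)" for u :: "real^2"
    have sm: "smooth_on UNIV P1" "smooth_on UNIV P2" "smooth_on UNIV \<beta>1" "smooth_on UNIV \<beta>2"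
      unfolding P1_def P2_def \<beta>1_def \<beta>2_def using smooth_bump_tail[OF n] smooth_bump by auto
    have s\<Psi>: "smooth_on UNIV \<Psi>"
      unfolding \<Psi>_def by (intro smooth_on_mult smooth_on_compose_nth sm)
    have der: "(P1 has_real_derivative - \<beta>1 x) (at x)" "(P2 has_real_derivative - \<beta>2 x) (at x)" for x
      unfolding P1_def P2_def \<beta>1_def \<beta>2_def by (intro bump_tail_has_derivative n)+
    have dif: "(\<lambda>u::real^2. P1 (u$1 - 0)) differentiable (at u)" "(\<lambda>u::real^2. P2 (u$2 - 0)) differentiable (at u)"
      "(\<lambda>u::real^2. \<beta>1 (u$1 - 0)) differentiable (at u)" for u
      by (intro smooth_on_differentiable[OF smooth_on_compose_nth] sm UNIV_I)+
    have pd1: "pd 1 \<Psi> u = - (\<beta>1 (u$1 - 0) * P2 (u$2 - 0))" for u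
      unfolding \<Psi>_def using pd_mult[OF dif(1,2), where j = 1] pd_compose_nth[OF der(1), where u = u and j = 1 and c = 0 and i = 1]
        pd_compose_nth[OF der(2), where u = u and j = 2 and c = 0 and i = 1] by simp
    have pd2: "pd 2 (pd 1 \<Psi>) u = \<psi> u" for u
    proof -
      obtain D where D: "(\<beta>1 has_real_derivative D) (at (u$1 - 0))"
        using smooth_on_differentiable[OF sm(3)] real_differentiable_def by blast
      have "pd 2 (pd 1 \<Psi>) u = - pd 2 (\<lambda>u. \<beta>1 (u$1 - 0) * P2 (u$2 - 0)) u"
        unfolding pd1[abs_def] by (intro pd_minus differentiable_mult dif)
      also have "pd 2 (\<lambda>u. \<beta>1 (u$1 - 0) * P2 (u$2 - 0)) u = - \<psi> u"
        using pd_mult[OF dif(3,2), where j = 2] pd_compose_nth[OF D, where i = 2]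
          pd_compose_nth[OF der(2), where u = u and j = 2 and c = 0 and i = 2] by (simp add: \<psi>_def bump2_def \<beta>1_def \<beta>2_def)
      finally show ?thesis by simp
    qed
    have s1: "smooth_on UNIV (pd 1 \<Psi>)" by (rule smooth_on_pd[OF s\<Psi>])
    have c1: "continuous_on UNIV (pd 1 \<Psi>)" "continuous_on UNIV \<Psi>"
      by (intro smooth_on_continuous_on s1 s\<Psi>)+
    have t\<psi>: "test_function U \<psi>"
      unfolding \<psi>_def by (rule test_bump2[OF n]) (use cd U box_subset_cbox in blast)
    have e1: "(LINT u|lborel. \<psi> u * (\<eta> u * f u)) =
        - (LINT u|lborel. pd 1 \<Psi> u * (\<eta> u * f2 u + pd 2 \<eta> u * f u))"
      using wk_test_mult[OF f2 \<eta> s1] by (simp only: pd2)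
    have e2: "(LINT u|lborel. pd 1 \<Psi> u * (\<eta> u * f2 u)) = - (LINT u|lborel. \<Psi> u * (\<eta> u * f21 u + pd 1 \<eta> u * f2 u))"
      by (rule wk_test_mult[OF f21 \<eta> s\<Psi>])
    have e3: "(LINT u|lborel. pd 1 \<Psi> u * (pd 2 \<eta> u * f u)) = - (LINT u|lborel. \<Psi> u * (pd 2 \<eta> u * f1 u + pd 1 (pd 2 \<eta>) u * f u))"
      by (rule wk_test_mult[OF f1 \<eta>2 s\<Psi>])
    have i: "integrable lborel (\<lambda>u. pd 1 \<Psi> u * (\<eta> u * f2 u))" "integrable lborel (\<lambda>u. pd 1 \<Psi> u * (pd 2 \<eta> u * f u))"
        "integrable lborel (\<lambda>u. \<Psi> u * (\<eta> u * f21 u))" "integrable lborel (\<lambda>u. \<Psi> u * (pd 1 \<eta> u * f2 u))"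
        "integrable lborel (\<lambda>u. \<Psi> u * (pd 2 \<eta> u * f1 u))" "integrable lborel (\<lambda>u. \<Psi> u * (pd 1 (pd 2 \<eta>) u * f u))"
      by (intro test_times_integrable[of U] \<eta> \<eta>2 test_pd loc c1)+
    have "(LINT u|lborel. \<psi> u * (\<eta> u * f u)) = (LINT u|lborel. \<Psi> u * h u)"
      unfolding h_def using e1 e2 e3 i by (simp add: distrib_left)
    also have "\<dots> = (LINT v|lborel. LINT u|lborel. \<psi> u * (indicator {..<u$1} (v$1) * indicator {..<u$2} (v$2) * h v))"
    proof (rule Bochner_Integration.integral_cong[OF refl])
      fix v :: "real^2"
      have "has_bochner_integral lborel
          (\<lambda>u::real^2. (indicator {v$1<..} (u$1) * \<beta>1 (u$1)) * (indicator {v$2<..} (u$2) * \<beta>2 (u$2)))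
          ((LINT t|lborel. indicator {v$1<..} t * \<beta>1 t) * (LINT t|lborel. indicator {v$2<..} t * \<beta>2 t))"
        unfolding \<beta>1_def \<beta>2_def
        by (rule has_bochner_integral_prod_2) (auto intro!: bump_tail_integrable[OF n] simp: bump_range)
      then have "(LINT u::real^2|lborel. (indicator {v$1<..} (u$1) * \<beta>1 (u$1)) * (indicator {v$2<..} (u$2) * \<beta>2 (u$2))) = \<Psi> v"
        by (simp add: has_bochner_integral_integral_eq \<Psi>_def P1_def P2_def bump_tail_def \<beta>1_def \<beta>2_def)
      moreover have "(indicator {v$1<..} (u$1) * \<beta>1 (u$1)) * (indicator {v$2<..} (u$2) * \<beta>2 (u$2))
          = \<psi> u * (indicator {..<u$1} (v$1) * indicator {..<u$2} (v$2))" for u :: "real^2"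
        by (simp add: \<psi>_def bump2_def \<beta>1_def \<beta>2_def indicator_def)
      ultimately have "(LINT u|lborel. \<psi> u * (indicator {..<u$1} (v$1) * indicator {..<u$2} (v$2))) = \<Psi> v"
        by (simp only:)
      then have "(LINT u|lborel. (\<psi> u * (indicator {..<u$1} (v$1) * indicator {..<u$2} (v$2))) * h v) = \<Psi> v * h v"
        by (simp only: integral_mult_left_zero)
      then show "\<Psi> v * h v = (LINT u|lborel. \<psi> u * (indicator {..<u$1} (v$1) * indicator {..<u$2} (v$2) * h v))"
        by (simp add: mult.assoc)
    qed
    also have "\<dots> = (LINT u|lborel. LINT v|lborel. \<psi> u * (indicator {..<u$1} (v$1) * indicator {..<u$2} (v$2) * h v))"
    proof (rule lborel_pair.Fubini_integral)
      have \<psi>i: "integrable lborel \<psi>"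
        using test_integrable[OF t\<psi> locint_continuous[OF continuous_on_const], of 1] by simp
      have [measurable]: "\<psi> \<in> borel_measurable borel" using borel_measurable_integrable[OF \<psi>i] by simp
      have "integrable (lborel \<Otimes>\<^sub>M lborel) (\<lambda>(u, v). \<psi> u * h v)"
      proof (rule lborel_pair.Fubini_integrable)
        show "(\<lambda>(u, v). \<psi> u * h v) \<in> borel_measurable (lborel \<Otimes>\<^sub>M lborel)" by measurable
        show "integrable lborel (\<lambda>u. LINT v|lborel. norm (case (u, v) of (u, v) \<Rightarrow> \<psi> u * h v))"
          using \<psi>i by (simp add: abs_mult)
        show "AE u in lborel. integrable lborel (\<lambda>v. case (u, v) of (u, v) \<Rightarrow> \<psi> u * h v)"
          using h by simp
      qed
      then show "integrable (lborel \<Otimes>\<^sub>M lborel)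
          (\<lambda>(u, v). \<psi> u * (indicator {..<u$1} (v$1) * indicator {..<u$2} (v$2) * h v))"
      proof (rule Bochner_Integration.integrable_bound)
        have [measurable]: "(\<lambda>x::real^2. x $ j) \<in> borel_measurable borel" for j
          by (intro borel_measurable_continuous_onI continuous_intros)
        have "(\<lambda>(u, v). \<psi> u * ((if v$1 < u$1 then 1 else 0) * (if v$2 < u$2 then 1 else 0) * h v))
            \<in> borel_measurable (lborel \<Otimes>\<^sub>M lborel)"
          by measurable
        moreover have "(\<lambda>(u, v). \<psi> u * ((if v$1 < u$1 then 1 else 0) * (if v$2 < u$2 then 1 else 0) * h v)) =
           (\<lambda>(u, v). \<psi> u * (indicator {..<u$1} (v$1) * indicator {..<u$2} (v$2) * h v))"
          by (auto simp: indicator_def fun_eq_iff)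
        ultimately show "(\<lambda>(u, v). \<psi> u * (indicator {..<u$1} (v$1) * indicator {..<u$2} (v$2) * h v))
            \<in> borel_measurable (lborel \<Otimes>\<^sub>M lborel)" by simp
        show "AE x in lborel \<Otimes>\<^sub>M lborel. norm (case x of (u, v) \<Rightarrow> \<psi> u * (indicator {..<u$1} (v$1) * indicator {..<u$2} (v$2) * h v))
            \<le> norm (case x of (u, v) \<Rightarrow> \<psi> u * h v)"
          by (auto simp: indicator_def)
      qed
    qed
    also have "\<dots> = (LINT u|lborel. \<psi> u * F u)"
      by (simp add: F_def)
    finally have "(LINT u|lborel. \<psi> u * (\<eta> u * f u)) = (LINT u|lborel. \<psi> u * F u)" .
    moreover have "integrable lborel (\<lambda>u. \<psi> u * (\<eta> u * f u))" "integrable lborel (\<lambda>u. \<psi> u * F u)"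
      using test_integrable[OF _ Fl] test_integrable[OF _ \<eta>fl] test_bump2[OF n cd] unfolding \<psi>_def by auto
    ultimately show "(LINT u|lborel. bump2 n c d u * (\<eta> u * f u + - 1 * F u)) = 0"
      unfolding \<psi>_def[symmetric] by (simp add: right_diff_distrib)
  qed
  moreover have pos: "\<eta> u > 0" if "u \<in> box a b" for u
    unfolding \<eta>_def using bump2_pos[OF _ that] by simp
  ultimately have "AE u in lborel. u \<in> box a b \<longrightarrow> f u = F u / \<eta> u"
  proof (elim eventually_mono, intro impI)
    fix u assume "u \<in> box a b \<longrightarrow> \<eta> u * f u + - 1 * F u = 0" and u: "u \<in> box a b"
    then have "\<eta> u * f u = F u" by simp
    then show "f u = F u / \<eta> u" using pos[OF u] by (simp add: field_simps)
  qed
  moreover have "continuous_on (box a b) (\<lambda>u. F u / \<eta> u)"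
  proof (intro continuous_on_divide continuous_on_subset[OF F] ballI)
    show "continuous_on (box a b) \<eta>"
      using smooth_on_continuous_on[OF test_smooth[OF \<eta>]] continuous_on_subset by blast
    show "\<eta> u \<noteq> 0" if "u \<in> box a b" for u using pos[OF that] by simp
  qed simp
  ultimately show ?thesis by blast
qed

lemma bump_shift_integral:
  "n > 0 \<Longrightarrow> (LINT x|lborel. bump n a b (x - s)) = (LINT x|lborel. bump n a b x)"
  using lborel_integral_real_affine[of 1 "\<lambda>x. bump n a b (x - s)" s] by simp

lemma bump_integral_pos:
  assumes "n > 0" "a < b" shows "(LINT x|lborel. bump n a b x) > 0"
proof -
  have "(LINT x|lborel. bump n a b x) \<noteq> 0"
  proof
    assume "(LINT x|lborel. bump n a b x) = 0"
    then have "AE x in lborel. bump n a b x = 0"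
      using integral_nonneg_eq_0_iff_AE[OF bump_integrable[OF assms(1)]] bump_range(1) by simp
    then have "AE x in lborel. x \<notin> {a<..<b}"
      by eventually_elim (use bump_pos[OF assms(1)] in force)
    then have "emeasure lborel {a<..<b} = 0"
      by (subst (asm) AE_iff_measurable[OF _ refl]) (auto simp: greaterThanLessThan_def Int_def)
    then show False using assms(2) by simp
  qed
  moreover have "(LINT x|lborel. bump n a b x) \<ge> 0"
    by (rule Bochner_Integration.integral_nonneg) (simp add: bump_range)
  ultimately show ?thesis by simp
qed

lemma integral_diff_bound:
  fixes w q :: "'a \<Rightarrow> real"
  assumes w: "integrable M w" "\<And>x. 0 \<le> w x" and wq: "integrable M (\<lambda>x. w x * q x)"
    and q: "\<And>x. w x \<noteq> 0 \<Longrightarrow> \<bar>q x - c\<bar> \<le> e"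
  shows "\<bar>(LINT x|M. w x * q x) - c * (LINT x|M. w x)\<bar> \<le> e * (LINT x|M. w x)"
proof -
  have i: "integrable M (\<lambda>x. w x * q x - c * w x)" using w(1) wq by simp
  have "\<bar>w x * q x - c * w x\<bar> \<le> e * w x" for x
  proof (cases "w x = 0")
    case False
    have "w x * \<bar>q x - c\<bar> \<le> w x * e" using q[OF False] w(2) by (rule mult_left_mono)
    then show ?thesis using w(2)[of x] by (simp add: abs_mult_pos' algebra_simps flip: right_diff_distrib)
  qed simp
  then have "\<bar>LINT x|M. w x * q x - c * w x\<bar> \<le> (LINT x|M. e * w x)"
    using w(1) i by (intro order_trans[OF integral_abs_bound] integral_mono) auto
  then show ?thesis using w(1) wq by simp
qed

text \<open>
  Testing the weak derivative against the product of a difference of two bump primitives and a bump: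
  the left hand side approximates a difference of values of f, the right hand side the integral of g
  over a segment.
\<close>

lemma wk_increment_le:
  fixes f g :: "real^2 \<Rightarrow> real" and j k :: 2
  assumes wk: "wk (box a b) j f g" and f: "continuous_on (box a b) f"
    and g: "\<And>v. v \<in> box a b \<Longrightarrow> \<bar>g v - \<gamma>\<bar> \<le> \<delta>"
    and u: "u \<in> box a b" "u' \<in> box a b" and jk: "j \<noteq> k" "u' $ k = u $ k" and lt: "u $ j < u' $ j"
  shows "\<bar>f u' - f u - \<gamma> * (u' $ j - u $ j)\<bar> \<le> \<delta> * (u' $ j - u $ j)"
proof (rule field_le_epsilon)
  fix e :: real assume "e > 0"
  define \<epsilon> where "\<epsilon> = e / 3"
  have \<epsilon>: "\<epsilon> > 0" using \<open>e > 0\<close> by (simp add: \<epsilon>_def)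
  have all: "i = j \<or> i = k" for i using jk(1) exhaust_2[of i] exhaust_2[of j] exhaust_2[of k] by auto
  have iff: "(\<forall>i. Q i) \<longleftrightarrow> Q j \<and> Q k" for Q :: "2 \<Rightarrow> bool"
  proof
    assume q: "Q j \<and> Q k"
    show "\<forall>i. Q i"
    proof
      show "Q i" for i using all[of i] q by blast
    qed
  qed simp
  have mem: "v \<in> box a b \<longleftrightarrow> a$j < v$j \<and> v$j < b$j \<and> a$k < v$k \<and> v$k < b$k" for v
    unfolding mem_box_cart iff by blast
  have dle: "dist v w \<le> \<bar>v$j - w$j\<bar> + \<bar>v$k - w$k\<bar>" for v w :: "real^2"
  proof -
    have "dist v w \<le> (\<Sum>i\<in>UNIV. \<bar>(v - w)$i\<bar>)" unfolding dist_norm by (rule norm_le_l1_cart)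
    also have "UNIV = {j, k}" using all by auto
    finally show ?thesis using jk(1) by simp
  qed
  have near: "\<exists>r>0. \<forall>v\<in>box a b. dist v w < r \<longrightarrow> \<bar>f v - f w\<bar> \<le> \<epsilon>" if "w \<in> box a b" for w
    using f that \<epsilon> unfolding continuous_on_iff dist_real_def by (meson less_imp_le)
  obtain r where r: "r > 0" "\<And>v. v \<in> box a b \<Longrightarrow> dist v u < r \<Longrightarrow> \<bar>f v - f u\<bar> \<le> \<epsilon>"
    using near[OF u(1)] by blast
  obtain r' where r': "r' > 0" "\<And>v. v \<in> box a b \<Longrightarrow> dist v u' < r' \<Longrightarrow> \<bar>f v - f u'\<bar> \<le> \<epsilon>"
    using near[OF u(2)] by blast
  define s t c where "s = u$j" and "t = u'$j" and "c = u$k"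
  have st: "s < t" using lt by (simp add: s_def t_def)
  have \<delta>: "\<delta> \<ge> 0" using g[OF u(1)] by linarith
  define H where "H = {r / 4, r' / 4, (b$j - t) / 2, (b$k - c) / 2, (t - s) / 2, \<epsilon> / (\<delta> + \<bar>\<gamma>\<bar> + 1)}"
  define h where "h = Min H"
  have h: "h > 0"
    unfolding h_def H_def using r(1) r'(1) \<epsilon> \<delta> u st unfolding mem t_def c_def by (subst Min_gr_iff) (auto simp: jk(2))
  have hle: "h \<le> x" if "x \<in> H" for x
    unfolding h_def by (rule Min_le) (use that in \<open>auto simp: H_def\<close>)
  have hr: "2 * h < r" "2 * h < r'" "t + h < b$j" "c + h < b$k" "s + h < t" "h \<le> \<epsilon> / (\<delta> + \<bar>\<gamma>\<bar> + 1)"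
    using hle[of "r/4"] hle[of "r'/4"] hle[of "(b$j - t)/2"] hle[of "(b$k - c)/2"] hle[of "(t - s)/2"]
      hle[of "\<epsilon> / (\<delta> + \<bar>\<gamma>\<bar> + 1)"] h r(1) r'(1) u st
    unfolding mem by (auto simp: H_def t_def c_def jk(2))
  have hg: "(\<delta> + \<bar>\<gamma>\<bar>) * h \<le> \<epsilon>"
  proof -
    have "(\<delta> + \<bar>\<gamma>\<bar> + 1) * h \<le> \<epsilon>" using hr(6) \<delta> by (simp add: field_simps)
    then show ?thesis using h by (simp add: distrib_right)
  qed
  define \<beta> where "\<beta> = bump 1 0 h"
  define T where "T = bump_tail 1 0 h"
  define m where "m = (LINT x|lborel. \<beta> x)"
  have m: "m > 0" unfolding m_def \<beta>_def using bump_integral_pos h by simp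
  have \<beta>s: "integrable lborel (\<lambda>x. \<beta> (x - q))" "(LINT x|lborel. \<beta> (x - q)) = m" for q
  proof -
    show "(LINT x|lborel. \<beta> (x - q)) = m" unfolding \<beta>_def m_def by (rule bump_shift_integral) simp
    then show "integrable lborel (\<lambda>x. \<beta> (x - q))" using m not_integrable_integral_eq by fastforce
  qed
  have \<beta>0: "0 \<le> \<beta> x" for x by (simp add: \<beta>_def bump_range)
  have \<beta>z: "\<beta> x \<noteq> 0 \<Longrightarrow> 0 < x \<and> x < h" for x using bump_eq_0[of 1 x 0 h] unfolding \<beta>_def by force
  define P where "P x = T (x - t) - T (x - s)" for x
  have Tr: "0 \<le> T x" "T x \<le> m" for x unfolding T_def m_def \<beta>_def by (simp_all add: bump_tail_range)
  have Tl: "x \<le> 0 \<Longrightarrow> T x = m" and Tz: "h \<le> x \<Longrightarrow> T x = 0" for x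
    unfolding T_def m_def \<beta>_def by (simp_all add: bump_tail_left bump_tail_right)
  have T_anti: "T y \<le> T x" if "x \<le> y" for x y
    by (rule DERIV_nonpos_imp_nonincreasing[OF that])
      (use bump_tail_has_derivative[of 1 0 h] \<beta>0 in \<open>auto simp: T_def \<beta>_def intro!: exI\<close>)
  have P0: "0 \<le> P x" for x unfolding P_def using T_anti[of "x - t" "x - s"] st by simp
  have Pm: "P x \<le> m" for x unfolding P_def using Tr[of "x - t"] Tr[of "x - s"] by simp
  have Pz: "P x \<noteq> 0 \<Longrightarrow> s < x \<and> x < t + h" for x
    unfolding P_def using Tl[of "x - t"] Tl[of "x - s"] Tz[of "x - t"] Tz[of "x - s"] st h
    by (cases "x \<le> s"; cases "t + h \<le> x") auto
  have P1: "P x = m" if "s + h \<le> x" "x \<le> t" for x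
    unfolding P_def using Tl[of "x - t"] Tz[of "x - s"] that by simp
  have sT: "smooth_on UNIV T" unfolding T_def by (rule smooth_bump_tail) simp
  have s\<beta>: "smooth_on UNIV \<beta>" unfolding \<beta>_def by (rule smooth_bump)
  have Pc: "continuous_on UNIV P"
    unfolding P_def by (intro continuous_on_diff continuous_on_compose2[OF smooth_on_continuous_on[OF sT]] continuous_intros) auto
  have Pi: "integrable lborel P"
  proof -
    have "integrable lborel (\<lambda>x. indicator {s..t + h} x *\<^sub>R P x)"
      using continuous_on_subset[OF Pc] by (intro borel_integrable_compact) auto
    moreover have "(\<lambda>x. indicator {s..t + h} x *\<^sub>R P x) = P"
      using Pz by (fastforce simp: indicator_def)
    ultimately show ?thesis by (simp only:)
  qed
  define p where "p = (LINT x|lborel. P x)"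
  have p: "m * (t - s - h) \<le> p" "p \<le> m * (t - s + h)"
  proof -
    have ind: "integrable lborel (\<lambda>x. m * indicator {y..z} x)" for y z :: real
      by (intro integrable_mult_right integrable_real_indicator) (auto simp: emeasure_lborel_Icc_eq)
    have "(LINT x|lborel. m * indicator {s + h..t} x) \<le> p"
      unfolding p_def by (rule integral_mono[OF ind Pi]) (use P1 P0 in \<open>auto simp: indicator_def\<close>)
    then show "m * (t - s - h) \<le> p" using hr(5) by (simp add: algebra_simps)
    have "P x \<le> m * indicator {s..t + h} x" for x
      using Pm[of x] Pz[of x] by (cases "P x = 0") (use m in \<open>auto simp: indicator_def\<close>)
    then have "p \<le> (LINT x|lborel. m * indicator {s..t + h} x)"
      unfolding p_def by (intro integral_mono[OF Pi ind])
    then show "p \<le> m * (t - s + h)" using st h by (simp add: algebra_simps)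
  qed
  define \<psi> where "\<psi> v = P (v$j) * \<beta> (v$k - c)" for v :: "real^2"
  define w where "w q v = \<beta> (v$j - q) * \<beta> (v$k - c)" for q and v :: "real^2"
  have \<psi>_alt: "\<psi> = (\<lambda>v. (T (v$j - t) - T (v$j - s)) * \<beta> (v$k - c))" by (simp add: \<psi>_def[abs_def] P_def)
  have supp: "v \<in> cbox (\<chi> i. if i = j then s else c) (\<chi> i. if i = j then t + h else c + h)"
    if "s \<le> v$j" "v$j \<le> t + h" "c \<le> v$k" "v$k \<le> c + h" for v
    unfolding mem_box_cart iff using that jk(1) by simp
  have ctest: "test_function (box a b) \<theta>"
    if sm: "smooth_on UNIV \<theta>" and nz: "\<And>v. \<theta> v \<noteq> 0 \<Longrightarrow> s \<le> v$j \<and> v$j \<le> t + h \<and> c \<le> v$k \<and> v$k \<le> c + h" for \<theta>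
  proof -
    let ?K = "cbox (\<chi> i. if i = j then s else c) (\<chi> i. if i = j then t + h else c + h) :: (real^2) set"
    have "?K \<subseteq> box a b"
    proof
      fix v assume v: "v \<in> ?K"
      then have "s \<le> v$j \<and> v$j \<le> t + h" "c \<le> v$k \<and> v$k \<le> c + h"
        unfolding mem_box_cart iff using jk(1) by simp_all
      then show "v \<in> box a b" using u hr unfolding mem s_def t_def c_def by auto
    qed
    then show ?thesis unfolding test_function_def using sm nz supp compact_cbox by metis
  qed
  have t\<psi>: "test_function (box a b) \<psi>"
  proof (rule ctest)
    show "smooth_on UNIV \<psi>" unfolding \<psi>_alt by (intro smooth_on_mult smooth_on_diff smooth_on_compose_nth sT s\<beta>)
    show "s \<le> v$j \<and> v$j \<le> t + h \<and> c \<le> v$k \<and> v$k \<le> c + h" if "\<psi> v \<noteq> 0" for v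
      using that Pz[of "v$j"] \<beta>z[of "v$k - c"] by (auto simp: \<psi>_def)
  qed
  have tw: "test_function (box a b) (w q)" if "q = s \<or> q = t" for q
  proof (rule ctest)
    show "smooth_on UNIV (w q)" unfolding w_def[abs_def] by (intro smooth_on_mult smooth_on_compose_nth s\<beta>)
    show "s \<le> v$j \<and> v$j \<le> t + h \<and> c \<le> v$k \<and> v$k \<le> c + h" if "w q v \<noteq> 0" for v
      using that \<open>q = s \<or> q = t\<close> \<beta>z[of "v$j - q"] \<beta>z[of "v$k - c"] st by (auto simp: w_def)
  qed
  have pd\<psi>: "pd j \<psi> v = w s v - w t v" for v
  proof -
    have dT: "(T has_real_derivative - \<beta> x) (at x)" for x
      unfolding T_def \<beta>_def by (rule bump_tail_has_derivative) simp
    obtain D where D: "(\<beta> has_real_derivative D) (at (v$k - c))"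
      using smooth_on_differentiable[OF s\<beta>] real_differentiable_def by blast
    have df: "(\<lambda>v::real^2. T (v$j - q)) differentiable (at v)" "(\<lambda>v::real^2. \<beta> (v$k - c)) differentiable (at v)" for q
      by (intro smooth_on_differentiable[OF smooth_on_compose_nth] sT s\<beta> UNIV_I)+
    have "pd j \<psi> v = pd j (\<lambda>v. T (v$j - t) - T (v$j - s)) v * \<beta> (v$k - c)
        + (T (v$j - t) - T (v$j - s)) * pd j (\<lambda>v. \<beta> (v$k - c)) v"
      unfolding \<psi>_alt by (rule pd_mult) (intro differentiable_diff df)+
    also have "pd j (\<lambda>v. \<beta> (v$k - c)) v = 0"
      using pd_compose_nth[OF D, where i = j] jk(1) by simp
    also have "pd j (\<lambda>v. T (v$j - t) - T (v$j - s)) v = - \<beta> (v$j - t) + \<beta> (v$j - s)"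
      using pd_diff[OF df(1) df(1), where j = j] pd_compose_nth[OF dT, where u = v and j = j and i = j] by simp
    finally show ?thesis by (simp add: w_def algebra_simps)
  qed
  have i1: "integrable lborel (w q)" "(LINT v|lborel. w q v) = m * m" for q
    using has_bochner_integral_prod_2[OF jk(1) \<beta>s(1)[of q] \<beta>s(1)[of c]] \<beta>0 unfolding w_def[abs_def]
    by (auto simp: has_bochner_integral_iff \<beta>s(2))
  have i2: "integrable lborel \<psi>" "(LINT v|lborel. \<psi> v) = p * m"
    using has_bochner_integral_prod_2[OF jk(1) Pi \<beta>s(1)[of c]] \<beta>0 P0 unfolding \<psi>_def[abs_def]
    by (auto simp: has_bochner_integral_iff \<beta>s(2) p_def)
  have i3: "integrable lborel (\<lambda>v. w q v * f v)" if "q = s \<or> q = t" for q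
    by (rule test_integrable[OF tw[OF that] wkD(1)[OF wk]])
  have i4: "integrable lborel (\<lambda>v. \<psi> v * g v)"
    by (rule test_integrable[OF t\<psi> wkD(2)[OF wk]])
  have inbox: "v \<in> box a b" if "s \<le> v$j" "v$j \<le> t + h" "c \<le> v$k" "v$k \<le> c + h" for v
    using that u hr unfolding mem s_def t_def c_def by auto
  have fu: "\<bar>(LINT v|lborel. w s v * f v) - f u * (m * m)\<bar> \<le> \<epsilon> * (m * m)"
    unfolding i1(2)[of s, symmetric]
  proof (rule integral_diff_bound[OF i1(1) _ i3])
    fix v assume "w s v \<noteq> 0"
    then have v: "s < v$j" "v$j < s + h" "c < v$k" "v$k < c + h"
      using \<beta>z[of "v$j - s"] \<beta>z[of "v$k - c"] by (auto simp: w_def)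
    have "dist v u < r" using dle[of v u] v hr(1) by (simp add: s_def c_def)
    moreover have "v \<in> box a b" by (rule inbox) (use v st in auto)
    ultimately show "\<bar>f v - f u\<bar> \<le> \<epsilon>" by (rule r(2)[rotated])
  qed (auto simp: w_def \<beta>0)
  have fu': "\<bar>(LINT v|lborel. w t v * f v) - f u' * (m * m)\<bar> \<le> \<epsilon> * (m * m)"
    unfolding i1(2)[of t, symmetric]
  proof (rule integral_diff_bound[OF i1(1) _ i3])
    fix v assume "w t v \<noteq> 0"
    then have v: "t < v$j" "v$j < t + h" "c < v$k" "v$k < c + h"
      using \<beta>z[of "v$j - t"] \<beta>z[of "v$k - c"] by (auto simp: w_def)
    have "dist v u' < r'" using dle[of v u'] v hr(2) by (simp add: t_def c_def jk(2))
    moreover have "v \<in> box a b" by (rule inbox) (use v st in auto)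
    ultimately show "\<bar>f v - f u'\<bar> \<le> \<epsilon>" by (rule r'(2)[rotated])
  qed (auto simp: w_def \<beta>0)
  have gg: "\<bar>(LINT v|lborel. \<psi> v * g v) - \<gamma> * (p * m)\<bar> \<le> \<delta> * (p * m)"
    unfolding i2(2)[symmetric]
  proof (rule integral_diff_bound[OF i2(1) _ i4])
    fix v assume "\<psi> v \<noteq> 0"
    then have "s < v$j" "v$j < t + h" "c < v$k" "v$k < c + h"
      using Pz[of "v$j"] \<beta>z[of "v$k - c"] by (auto simp: \<psi>_def)
    then show "\<bar>g v - \<gamma>\<bar> \<le> \<delta>" by (intro g inbox) auto
  qed (auto simp: \<psi>_def \<beta>0 P0)
  have "(LINT v|lborel. w s v * f v) - (LINT v|lborel. w t v * f v) = - (LINT v|lborel. \<psi> v * g v)"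
    using wkD(3)[OF wk t\<psi>] i3 unfolding pd\<psi> left_diff_distrib by simp
  then have A: "\<bar>(f u' - f u) * (m * m) - \<gamma> * (p * m)\<bar> \<le> 2 * \<epsilon> * (m * m) + \<delta> * (p * m)"
    using fu fu' gg by (simp add: abs_le_iff algebra_simps)
  have pm: "\<bar>p * m - (t - s) * (m * m)\<bar> \<le> h * (m * m)"
  proof -
    have "m * (t - s - h) * m \<le> p * m" "p * m \<le> m * (t - s + h) * m"
      using p m by (intro mult_right_mono; simp)+
    then show ?thesis by (simp add: abs_le_iff algebra_simps)
  qed
  have "\<bar>f u' - f u - \<gamma> * (t - s)\<bar> * (m * m) = \<bar>(f u' - f u - \<gamma> * (t - s)) * (m * m)\<bar>"
    by (simp add: abs_mult)
  also have "\<dots> = \<bar>((f u' - f u) * (m * m) - \<gamma> * (p * m)) + \<gamma> * (p * m - (t - s) * (m * m))\<bar>"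
    by (simp add: algebra_simps)
  also have "\<dots> \<le> 2 * \<epsilon> * (m * m) + \<delta> * (p * m) + \<bar>\<gamma>\<bar> * (h * (m * m))"
    using A mult_left_mono[OF pm, of "\<bar>\<gamma>\<bar>"] by (intro order_trans[OF abs_triangle_ineq] add_mono) (auto simp: abs_mult)
  also have "\<delta> * (p * m) \<le> \<delta> * ((t - s + h) * (m * m))"
    using pm \<delta> by (intro mult_left_mono) (auto simp: abs_le_iff algebra_simps)
  finally have "\<bar>f u' - f u - \<gamma> * (t - s)\<bar> * (m * m) \<le> (2 * \<epsilon> + \<delta> * (t - s) + (\<delta> + \<bar>\<gamma>\<bar>) * h) * (m * m)"
    by (simp add: algebra_simps)
  then have "\<bar>f u' - f u - \<gamma> * (t - s)\<bar> \<le> 2 * \<epsilon> + \<delta> * (t - s) + (\<delta> + \<bar>\<gamma>\<bar>) * h"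
    using m mult_le_cancel_right_pos[of "m * m"] by simp
  then show "\<bar>f u' - f u - \<gamma> * (u' $ j - u $ j)\<bar> \<le> \<delta> * (u' $ j - u $ j) + e"
    using hg unfolding \<epsilon>_def s_def t_def by simp
qed

lemma wk_increment:
  fixes f g :: "real^2 \<Rightarrow> real" and j k :: 2
  assumes wk: "wk (box a b) j f g" and f: "continuous_on (box a b) f"
    and g: "\<And>v. v \<in> box a b \<Longrightarrow> \<bar>g v - \<gamma>\<bar> \<le> \<delta>"
    and u: "u \<in> box a b" "u' \<in> box a b" and jk: "j \<noteq> k" "u' $ k = u $ k"
  shows "\<bar>f u' - f u - \<gamma> * (u' $ j - u $ j)\<bar> \<le> \<delta> * \<bar>u' $ j - u $ j\<bar>"
proof (cases "u $ j" "u' $ j" rule: linorder_cases)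
  case less
  then show ?thesis using wk_increment_le[OF wk f g u jk] by simp
next
  case equal
  then have "u = u'" using jk exhaust_2[of j] exhaust_2[of k] by (auto simp: vec_eq_iff forall_2)
  then show ?thesis by simp
next
  case greater
  then show ?thesis using wk_increment_le[OF wk f g u(2,1) jk(1) jk(2)[symmetric]] by (simp add: abs_le_iff algebra_simps)
qed

lemma wk_continuous_has_derivative:
  fixes f :: "real^2 \<Rightarrow> real"
  assumes wk: "\<And>j. wk (box a b) j f (g j)" and f: "continuous_on (box a b) f"
    and g: "\<And>j. continuous_on (box a b) (g j)" and u: "u \<in> box a b"
  shows "(f has_derivative (\<lambda>h. \<Sum>j\<in>UNIV. h $ j *\<^sub>R g j u)) (at u)"
  unfolding has_derivative_at_alt
proof (intro conjI allI impI)
  show "bounded_linear (\<lambda>h. \<Sum>j\<in>UNIV. h $ j *\<^sub>R g j u)"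
    by (intro bounded_linear_sum bounded_linear_scaleR_const bounded_linear_vec_nth)
  fix e :: real assume e: "e > 0"
  define S where "S j = {v \<in> box a b. \<bar>g j v - g j u\<bar> < e / 2}" for j
  have "open (S j)" for j
  proof -
    have "open (box a b \<inter> g j -` {g j u - e / 2 <..< g j u + e / 2})"
      by (rule continuous_open_preimage[OF g open_box]) simp
    moreover have "S j = box a b \<inter> g j -` {g j u - e / 2 <..< g j u + e / 2}"
      unfolding S_def greaterThanLessThan_iff vimage_def abs_less_iff by (intro set_eqI iffI; simp; linarith)
    ultimately show ?thesis by simp
  qed
  then have "open (S 1 \<inter> S 2)" "u \<in> S 1 \<inter> S 2" using u e by (auto simp: S_def)
  then obtain c d where cd: "box c d \<subseteq> S 1 \<inter> S 2" "u \<in> box c d"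
    using open_contains_box by metis
  then have sub: "box c d \<subseteq> box a b" by (auto simp: S_def)
  obtain r where r: "r > 0" "ball u r \<subseteq> box c d"
    using openE[OF open_box cd(2)] by blast
  have gb: "\<bar>g j v - g j u\<bar> \<le> e / 2" if "v \<in> box c d" for v j
    using cd(1) that exhaust_2[of j] by (auto simp: S_def)
  note wk' = wk_subset[OF wk sub] and f' = continuous_on_subset[OF f sub]
  show "\<exists>d>0. \<forall>y. norm (y - u) < d \<longrightarrow> norm (f y - f u - (\<Sum>j\<in>UNIV. (y - u) $ j *\<^sub>R g j u)) \<le> e * norm (y - u)"
  proof (intro exI[of _ r] conjI allI impI r(1))
    fix y assume y: "norm (y - u) < r"
    then have yb: "y \<in> box c d" using r(2) by (auto simp: dist_norm norm_minus_commute subset_iff)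
    define z :: "real^2" where "z = (\<chi> i. if i = 1 then y $ 1 else u $ 2)"
    have z: "z $ 1 = y $ 1" "z $ 2 = u $ 2" by (simp_all add: z_def)
    have zb: "z \<in> box c d" using yb cd(2) unfolding mem_box_2 z by simp
    have "\<bar>f z - f u - g 1 u * (z $ 1 - u $ 1)\<bar> \<le> e / 2 * \<bar>z $ 1 - u $ 1\<bar>"
      by (rule wk_increment[OF wk' f' gb cd(2) zb, where k = 2]) (simp_all add: z)
    moreover have "\<bar>f y - f z - g 2 u * (y $ 2 - z $ 2)\<bar> \<le> e / 2 * \<bar>y $ 2 - z $ 2\<bar>"
      by (rule wk_increment[OF wk' f' gb zb yb, where k = 1]) (simp_all add: z)
    moreover have "\<bar>(y - u) $ i\<bar> \<le> norm (y - u)" for i by (rule component_le_norm_cart)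
    then have "e / 2 * \<bar>y $ 1 - u $ 1\<bar> \<le> e / 2 * norm (y - u)" "e / 2 * \<bar>y $ 2 - u $ 2\<bar> \<le> e / 2 * norm (y - u)"
      using e by (intro mult_left_mono; simp)+
    ultimately have "\<bar>f z - f u - g 1 u * (y $ 1 - u $ 1)\<bar> \<le> e / 2 * norm (y - u)"
        "\<bar>f y - f z - g 2 u * (y $ 2 - u $ 2)\<bar> \<le> e / 2 * norm (y - u)"
      unfolding z by linarith+
    moreover have "f y - f u - (\<Sum>j\<in>UNIV. (y - u) $ j *\<^sub>R g j u) =
        (f z - f u - g 1 u * (y $ 1 - u $ 1)) + (f y - f z - g 2 u * (y $ 2 - u $ 2))"
      by (simp add: sum_2)
    ultimately show "norm (f y - f u - (\<Sum>j\<in>UNIV. (y - u) $ j *\<^sub>R g j u)) \<le> e * norm (y - u)"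
      unfolding real_norm_def by linarith
  qed
qed

lemma wk_system_smooth:
  fixes y :: "'i::finite \<Rightarrow> real^2 \<Rightarrow> real" and A :: "2 \<Rightarrow> 'i \<Rightarrow> 'i \<Rightarrow> real^2 \<Rightarrow> real"
  assumes U: "cbox a b \<subseteq> U" and A: "\<And>j p q. smooth_on U (A j p q)"
    and y: "\<And>j p. wk U j (y p) (\<lambda>u. \<Sum>q\<in>UNIV. A j p q u * y q u)"
  shows "\<exists>z. \<forall>p. smooth_on (box a b) (z p) \<and> (AE u in lborel. u \<in> box a b \<longrightarrow> y p u = z p u) \<and>
    (\<forall>u\<in>box a b. \<forall>j. pd j (z p) u = (\<Sum>q\<in>UNIV. A j p q u * z q u))"
proof -
  have B: "box a b \<subseteq> U" using U box_subset_cbox by blast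
  have "\<exists>g. continuous_on (box a b) g \<and> (AE u in lborel. u \<in> box a b \<longrightarrow> y p u = g u)" for p
    by (rule wk_continuous_rep[OF U y y wk_sum]) (rule wk_mult_smooth[OF y A])
  then obtain z where z: "\<And>p. continuous_on (box a b) (z p)" "\<And>p. AE u in lborel. u \<in> box a b \<longrightarrow> y p u = z p u"
    by metis
  have As: "smooth_on (box a b) (A j p q)" for j p q
    by (rule smooth_on_subset[OF A open_box B])
  define g where "g p j u = (\<Sum>q\<in>UNIV. A j p q u * z q u)" for p j u
  have gc: "continuous_on (box a b) (g p j)" for p j
    unfolding g_def[abs_def] by (intro continuous_on_sum continuous_on_mult smooth_on_continuous_on As z)
  have "AE u in lborel. \<forall>p\<in>UNIV. u \<in> box a b \<longrightarrow> y p u = z p u"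
    by (rule AE_ball_countable'[OF z(2)]) (simp add: countable_finite)
  then have "AE u in lborel. u \<in> box a b \<longrightarrow> (\<Sum>q\<in>UNIV. A j p q u * y q u) = g p j u" for p j
    by eventually_elim (auto simp: g_def)
  then have wz: "wk (box a b) j (z p) (g p j)" for p j
    by (intro wk_cong_AE[OF wk_subset[OF y B] locint_continuous[OF z(1)] locint_continuous[OF gc] z(2)])
  have der: "(z p has_derivative (\<lambda>h. \<Sum>j\<in>UNIV. h $ j *\<^sub>R g p j u)) (at u)" if "u \<in> box a b" for p u
    by (rule wk_continuous_has_derivative[OF wz z(1) gc that])
  have pdz: "pd j (z p) u = g p j u" if "u \<in> box a b" for p j u
    unfolding pd_unique[OF der[OF that]] by (simp add: axis_def if_distrib[of "\<lambda>x. x * _"] cong: if_cong)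
  have "Ck_on k (box a b) (z p)" for k p
  proof (induction k arbitrary: p)
    case 0
    then show ?case using z(1) by simp
  next
    case (Suc k)
    show ?case
    proof (rule Ck_on_Suc_pd[OF open_box])
      show "z p differentiable (at u)" if "u \<in> box a b" for u
        using der[OF that] differentiable_def by blast
      have "Ck_on k (box a b) (\<lambda>u. \<Sum>q\<in>Q. A j p q u * z q u)" if "finite Q" for Q j
        using that
      proof induction
        case (insert q Q)
        have "Ck_on k (box a b) (\<lambda>u. A j p q u * z q u)"
          using As Suc by (intro Ck_on_bilinear[OF open_box bounded_bilinear_mult]) (auto simp: smooth_on_def)
        with insert show ?case by (simp add: Ck_on_add[OF open_box])
      qed (simp add: Ck_on_const)
      then have "Ck_on k (box a b) (g p j)" for j by (simp add: g_def[abs_def])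
      then show "Ck_on k (box a b) (pd j (z p))" for j
        by (rule Ck_on_cong[OF open_box, rotated]) (simp add: pdz)
    qed
  qed
  then have "smooth_on (box a b) (z p)" for p by (simp add: smooth_on_def open_box)
  then show ?thesis using z(2) pdz unfolding g_def by blast
qed

subsection \<open>Symmetry of second derivatives\<close>

lemma pd_has_real_derivative_line:
  fixes f :: "real^'n \<Rightarrow> real"
  assumes "f differentiable (at (p + t *\<^sub>R axis j 1))"
  shows "((\<lambda>s. f (p + s *\<^sub>R axis j 1)) has_real_derivative pd j f (p + t *\<^sub>R axis j 1)) (at t)"
proof -
  have 1: "((\<lambda>s. p + s *\<^sub>R axis j 1) has_derivative (\<lambda>s. s *\<^sub>R axis j 1)) (at t)"
    by (auto intro!: derivative_eq_intros)
  have "(f has_derivative frechet_derivative f (at (p + t *\<^sub>R axis j 1))) (at (p + t *\<^sub>R axis j 1))"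
    using assms frechet_derivative_works by blast
  from has_derivative_compose[OF 1 this]
  have "((\<lambda>s. f (p + s *\<^sub>R axis j 1)) has_derivative (\<lambda>s. frechet_derivative f (at (p + t *\<^sub>R axis j 1)) (s *\<^sub>R axis j 1))) (at t)" .
  then show ?thesis
    unfolding has_field_derivative_def pd_def
    by (rule has_derivative_eq_rhs)
      (simp add: fun_eq_iff linear_cmul[OF linear_frechet_derivative[OF assms]])
qed

lemma second_difference_mvt:
  fixes f :: "real^'n \<Rightarrow> real"
  assumes f: "smooth_on S f" and h: "h > 0"
    and S: "\<And>s t. 0 \<le> s \<Longrightarrow> s \<le> h \<Longrightarrow> 0 \<le> t \<Longrightarrow> t \<le> h \<Longrightarrow> p + s *\<^sub>R axis i 1 + t *\<^sub>R axis j 1 \<in> S"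
  shows "\<exists>s t. 0 \<le> s \<and> s \<le> h \<and> 0 \<le> t \<and> t \<le> h \<and>
    f (p + h *\<^sub>R axis i 1 + h *\<^sub>R axis j 1) - f (p + h *\<^sub>R axis i 1) - f (p + h *\<^sub>R axis j 1) + f p
      = h * h * pd j (pd i f) (p + s *\<^sub>R axis i 1 + t *\<^sub>R axis j 1)"
proof -
  let ?F = "\<lambda>s. f ((p + h *\<^sub>R axis j 1) + s *\<^sub>R axis i 1) - f (p + s *\<^sub>R axis i 1)"
  let ?F' = "\<lambda>s. pd i f ((p + h *\<^sub>R axis j 1) + s *\<^sub>R axis i 1) - pd i f (p + s *\<^sub>R axis i 1)"
  have "\<exists>s. 0 < s \<and> s < h \<and> ?F h - ?F 0 = (h - 0) * ?F' s"
  proof (rule MVT2[OF h])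
    fix s assume s: "0 \<le> s" "s \<le> h"
    have "f differentiable (at ((p + h *\<^sub>R axis j 1) + s *\<^sub>R axis i 1))" "f differentiable (at (p + s *\<^sub>R axis i 1))"
      using S[OF s, of h] S[OF s, of 0] h by (auto intro!: smooth_on_differentiable[OF f] simp: add_ac)
    then show "(?F has_real_derivative ?F' s) (at s)"
      by (intro DERIV_diff pd_has_real_derivative_line)
  qed
  then obtain s where s: "0 < s" "s < h" "?F h - ?F 0 = h * ?F' s" by auto
  let ?G = "\<lambda>t. pd i f ((p + s *\<^sub>R axis i 1) + t *\<^sub>R axis j 1)"
  have "\<exists>t. 0 < t \<and> t < h \<and> ?G h - ?G 0 = (h - 0) * pd j (pd i f) ((p + s *\<^sub>R axis i 1) + t *\<^sub>R axis j 1)"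
  proof (rule MVT2[OF h])
    fix t assume t: "0 \<le> t" "t \<le> h"
    show "(?G has_real_derivative pd j (pd i f) ((p + s *\<^sub>R axis i 1) + t *\<^sub>R axis j 1)) (at t)"
      using S[of s t] s t by (intro pd_has_real_derivative_line smooth_on_differentiable[OF smooth_on_pd[OF f]]) auto
  qed
  then obtain t where t: "0 < t" "t < h" "?G h - ?G 0 = h * pd j (pd i f) ((p + s *\<^sub>R axis i 1) + t *\<^sub>R axis j 1)" by auto
  have "?F' s = ?G h - ?G 0" by (simp add: add_ac)
  then have "?F h - ?F 0 = h * (h * pd j (pd i f) ((p + s *\<^sub>R axis i 1) + t *\<^sub>R axis j 1))"
    using s(3) t(3) by (simp only:)
  then show ?thesis
    using s t by (intro exI[of _ s] exI[of _ t]) (simp add: add_ac algebra_simps)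
qed

lemma pd_commute_real:
  fixes f :: "real^'n \<Rightarrow> real"
  assumes f: "smooth_on S f" and p: "p \<in> S"
  shows "pd i (pd j f) p = pd j (pd i f) p"
proof (rule ccontr)
  let ?A = "pd i (pd j f)" and ?B = "pd j (pd i f)"
  assume "?A p \<noteq> ?B p"
  define e where "e = \<bar>?A p - ?B p\<bar> / 2"
  have e: "e > 0" using \<open>?A p \<noteq> ?B p\<close> by (simp add: e_def)
  have near: "\<exists>r>0. \<forall>q. dist q p < r \<longrightarrow> q \<in> S \<and> \<bar>g q - g p\<bar> < e" if "continuous_on S g" for g :: "real^'n \<Rightarrow> real"
  proof -
    have "open (S \<inter> g -` {g p - e <..< g p + e})"
      by (rule continuous_open_preimage[OF that smooth_on_open[OF f]]) simp
    moreover have "p \<in> S \<inter> g -` {g p - e <..< g p + e}" using p e by simp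
    ultimately obtain r where r: "r > 0" "ball p r \<subseteq> S \<inter> g -` {g p - e <..< g p + e}"
      using openE by metis
    have "q \<in> S \<and> \<bar>g q - g p\<bar> < e" if "dist q p < r" for q
    proof -
      have "q \<in> ball p r" using that by (simp add: dist_commute)
      then have "q \<in> S" "g q \<in> {g p - e <..< g p + e}" using r(2) by auto
      then show ?thesis unfolding greaterThanLessThan_iff by linarith
    qed
    then show ?thesis using r(1) by blast
  qed
  have "continuous_on S ?A" "continuous_on S ?B"
    by (intro smooth_on_continuous_on smooth_on_pd f)+
  from near[OF this(1)] near[OF this(2)]
  obtain r1 r2 where r: "r1 > 0" "\<And>q. dist q p < r1 \<Longrightarrow> q \<in> S \<and> \<bar>?A q - ?A p\<bar> < e"
    "r2 > 0" "\<And>q. dist q p < r2 \<Longrightarrow> q \<in> S \<and> \<bar>?B q - ?B p\<bar> < e"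
    by (elim exE conjE) auto
  define h where "h = min r1 r2 / 3"
  have h: "h > 0" "2 * h < r1" "2 * h < r2" using r(1,3) by (auto simp: h_def)
  have d: "dist (p + s *\<^sub>R axis k 1 + t *\<^sub>R axis l 1) p \<le> 2 * h" if "0 \<le> s" "s \<le> h" "0 \<le> t" "t \<le> h" for s t k l
  proof -
    have "dist (p + s *\<^sub>R axis k 1 + t *\<^sub>R axis l 1) p = norm (s *\<^sub>R axis k 1 + t *\<^sub>R axis l 1 :: real^'n)"
      by (simp add: dist_norm)
    also have "\<dots> \<le> \<bar>s\<bar> + \<bar>t\<bar>" by (rule norm_triangle_le) simp
    finally show ?thesis using that by simp
  qed
  have inS: "p + s *\<^sub>R axis k 1 + t *\<^sub>R axis l 1 \<in> S" if "0 \<le> s" "s \<le> h" "0 \<le> t" "t \<le> h" for s t k l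
    using r(2)[OF order_le_less_trans[OF d[OF that] h(2)]] by blast
  obtain s t where 1: "0 \<le> s" "s \<le> h" "0 \<le> t" "t \<le> h"
    "f (p + h *\<^sub>R axis i 1 + h *\<^sub>R axis j 1) - f (p + h *\<^sub>R axis i 1) - f (p + h *\<^sub>R axis j 1) + f p
      = h * h * ?B (p + s *\<^sub>R axis i 1 + t *\<^sub>R axis j 1)"
    using second_difference_mvt[OF f h(1) inS] by blast
  obtain s' t' where 2: "0 \<le> s'" "s' \<le> h" "0 \<le> t'" "t' \<le> h"
    "f (p + h *\<^sub>R axis j 1 + h *\<^sub>R axis i 1) - f (p + h *\<^sub>R axis j 1) - f (p + h *\<^sub>R axis i 1) + f p
      = h * h * ?A (p + s' *\<^sub>R axis j 1 + t' *\<^sub>R axis i 1)"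
    using second_difference_mvt[OF f h(1) inS] by blast
  have "h * h * ?B (p + s *\<^sub>R axis i 1 + t *\<^sub>R axis j 1) = h * h * ?A (p + s' *\<^sub>R axis j 1 + t' *\<^sub>R axis i 1)"
  proof -
    have eq: "p + h *\<^sub>R axis j 1 + h *\<^sub>R axis i 1 = p + h *\<^sub>R axis i 1 + h *\<^sub>R axis j 1" by (simp add: add_ac)
    show ?thesis using 1(5) 2(5)[unfolded eq] by linarith
  qed
  then have "?B (p + s *\<^sub>R axis i 1 + t *\<^sub>R axis j 1) = ?A (p + s' *\<^sub>R axis j 1 + t' *\<^sub>R axis i 1)"
    using h(1) by simp
  moreover have "\<bar>?B (p + s *\<^sub>R axis i 1 + t *\<^sub>R axis j 1) - ?B p\<bar> < e"
    using r(4)[OF order_le_less_trans[OF d[OF 1(1-4)] h(3)]] by blast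
  moreover have "\<bar>?A (p + s' *\<^sub>R axis j 1 + t' *\<^sub>R axis i 1) - ?A p\<bar> < e"
    using r(2)[OF order_le_less_trans[OF d[OF 2(1-4)] h(2)]] by blast
  ultimately have "\<bar>?A (p + s' *\<^sub>R axis j 1 + t' *\<^sub>R axis i 1) - ?A p\<bar> +
      \<bar>?A (p + s' *\<^sub>R axis j 1 + t' *\<^sub>R axis i 1) - ?B p\<bar> < \<bar>?A p - ?B p\<bar>"
    unfolding e_def by simp
  moreover have "\<bar>a - b\<bar> \<le> \<bar>x - a\<bar> + \<bar>x - b\<bar>" for a b x :: real by arith
  ultimately show False by (meson not_less)
qed

lemma pd_commute:
  fixes f :: "real^'n \<Rightarrow> 'b::euclidean_space"
  assumes f: "smooth_on S f" and p: "p \<in> S"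
  shows "pd i (pd j f) p = pd j (pd i f) p"
proof -
  have "pd i (pd j f) p \<bullet> b = pd j (pd i f) p \<bullet> b" for b
  proof -
    have bl: "bounded_linear (\<lambda>x::'b. x \<bullet> b)" by (rule bounded_linear_inner_left)
    have *: "pd k (pd l (\<lambda>u. f u \<bullet> b)) p = pd k (pd l f) p \<bullet> b" for k l
    proof -
      have "pd k (pd l (\<lambda>u. f u \<bullet> b)) p = pd k (\<lambda>u. pd l f u \<bullet> b) p"
      proof (rule pd_cong[OF smooth_on_open[OF f] p])
        show "pd l (\<lambda>u. f u \<bullet> b) u = pd l f u \<bullet> b" if "u \<in> S" for u
          by (rule pd_bounded_linear[OF bl smooth_on_differentiable[OF f that]])
        show "pd l (\<lambda>u. f u \<bullet> b) differentiable (at p)"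
          by (rule smooth_on_differentiable[OF smooth_on_pd[OF smooth_on_bounded_linear[OF bl f]] p])
      qed
      also have "\<dots> = pd k (pd l f) p \<bullet> b"
        by (rule pd_bounded_linear[OF bl smooth_on_differentiable[OF smooth_on_pd[OF f] p]])
      finally show ?thesis .
    qed
    show ?thesis
      using pd_commute_real[OF smooth_on_bounded_linear[OF bl f] p, of i j] unfolding * .
  qed
  then show ?thesis by (simp add: euclidean_eq_iff[where 'a = 'b])
qed

section \<open>Vector algebra of a surface frame\<close>

lemma cross3_cramer:
  fixes X :: "real^3"
  shows "(cross3 p q \<bullet> N) *\<^sub>R X = (cross3 X q \<bullet> N) *\<^sub>R p + (cross3 p X \<bullet> N) *\<^sub>R q + (cross3 p q \<bullet> X) *\<^sub>R N"
  by (simp add: vec_eq_iff forall_3 cross3_def inner_vec_def sum_3) algebra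

lemma cross3_triple_cyclic: "cross3 a b \<bullet> c = cross3 b c \<bullet> a" "cross3 a b \<bullet> c = a \<bullet> cross3 b c"
  by (simp_all add: cross3_def inner_vec_def sum_3 algebra_simps)

lemma cross3_binet: "cross3 a b \<bullet> cross3 c d = (a \<bullet> c) * (b \<bullet> d) - (a \<bullet> d) * (b \<bullet> (c::real^3))"
  by (simp add: cross3_def inner_vec_def sum_3 algebra_simps)

lemma cross3_double: "cross3 a (cross3 b c) = (a \<bullet> c) *\<^sub>R b - (a \<bullet> b) *\<^sub>R c"
  by (simp add: vec_eq_iff forall_3 cross3_def inner_vec_def sum_3 algebra_simps)

lemma cross3_linear:
  "cross3 (a + b) c = cross3 a c + cross3 b c" "cross3 a (b + c) = cross3 a b + cross3 a c"
  "cross3 (a - b) c = cross3 a c - cross3 b c" "cross3 a (b - c) = cross3 a b - cross3 a c"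
  "cross3 (r *\<^sub>R a) b = r *\<^sub>R cross3 a b" "cross3 a (r *\<^sub>R b) = r *\<^sub>R cross3 a b"
  by (rule cross_add_left cross_add_right Cross3.left_diff_distrib Cross3.right_diff_distrib cross_mult_left cross_mult_right)+

locale frame =
  fixes p q N :: "real^3" and D :: real
  assumes NN: "N \<bullet> N = 1" and pN: "p \<bullet> N = 0" and qN: "q \<bullet> N = 0"
    and pq: "cross3 p q = D *\<^sub>R N" and D: "D \<noteq> 0"
begin

lemma D_eq: "cross3 p q \<bullet> N = D"
  by (simp add: pq NN)

lemma tangent_expansion:
  assumes "X \<bullet> N = 0"
  shows "X = ((cross3 X q \<bullet> N) / D) *\<^sub>R p + ((cross3 p X \<bullet> N) / D) *\<^sub>R q"
proof -
  have "D *\<^sub>R X = (cross3 X q \<bullet> N) *\<^sub>R p + (cross3 p X \<bullet> N) *\<^sub>R q"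
    using cross3_cramer[of p q N X] assms by (simp add: D_eq pq NN inner_commute)
  then have "(1 / D) *\<^sub>R (D *\<^sub>R X) = (1 / D) *\<^sub>R ((cross3 X q \<bullet> N) *\<^sub>R p + (cross3 p X \<bullet> N) *\<^sub>R q)"
    by (simp only:)
  then show ?thesis using D by (simp add: scaleR_add_right)
qed

lemma tangentE:
  assumes "X \<bullet> N = 0" obtains a b where "X = a *\<^sub>R p + b *\<^sub>R q"
  using tangent_expansion[OF assms] by blast

lemma tangent_zero:
  assumes "X \<bullet> N = 0" "X \<bullet> p = 0" "X \<bullet> q = 0" shows "X = 0"
proof -
  obtain a b where X: "X = a *\<^sub>R p + b *\<^sub>R q" using tangentE[OF assms(1)] .
  have "X \<bullet> X = a * (X \<bullet> p) + b * (X \<bullet> q)" by (subst (2) X) (simp add: inner_add_right)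
  then show ?thesis using assms by simp
qed

lemma tangent_eqI:
  assumes "X \<bullet> N = 0" "Y \<bullet> N = 0" "X \<bullet> p = Y \<bullet> p" "X \<bullet> q = Y \<bullet> q" shows "X = Y"
  using tangent_zero[of "X - Y"] assms by (simp add: inner_diff_left)

lemma cross_tangent: "X \<bullet> N = 0 \<Longrightarrow> Y \<bullet> N = 0 \<Longrightarrow> cross3 X Y = (cross3 X Y \<bullet> N) *\<^sub>R N"
proof -
  assume "X \<bullet> N = 0" "Y \<bullet> N = 0"
  then have "cross3 N (cross3 X Y) = 0" by (simp add: cross3_double inner_commute)
  then have "cross3 N (cross3 N (cross3 X Y)) = 0" by simp
  then have "(N \<bullet> cross3 X Y) *\<^sub>R N - cross3 X Y = 0" by (simp add: cross3_double[of N N] NN)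
  then show ?thesis by (simp add: inner_commute)
qed

lemma rot_simps:
  "cross3 N p \<bullet> q = D" "cross3 N q \<bullet> p = - D" "cross3 N p \<bullet> p = 0" "cross3 N q \<bullet> q = 0"
  "cross3 N X \<bullet> N = 0" "cross3 X N \<bullet> N = 0"
  using D_eq cross3_triple_cyclic(1)[of N p q] cross3_triple_cyclic(1)[of N q p] cross_skew[of q p]
  by (simp_all add: dot_cross_self)

end

lemma frame_exI:
  assumes "frame p q N D"
  shows "\<exists>e1 e2. e1 \<bullet> N = 0 \<and> e2 \<bullet> N = 0 \<and> norm e1 = 1 \<and> norm e2 = 1 \<and> e1 \<bullet> e2 = 0 \<and> cross3 e1 e2 = N"
proof -
  interpret frame p q N D by (rule assms)
  have p0: "p \<noteq> 0" using D_eq D by auto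
  define e where "e = (1 / norm p) *\<^sub>R p"
  have e: "e \<bullet> N = 0" "norm e = 1" using p0 pN by (simp_all add: e_def)
  then have ee: "e \<bullet> e = 1" by (simp add: dot_square_norm)
  have c: "cross3 e (cross3 N e) = N" using e ee by (simp add: cross3_double)
  have "cross3 N e \<bullet> cross3 N e = 1" using e ee NN by (simp add: cross3_binet inner_commute)
  then have "norm (cross3 N e) = 1" by (simp add: norm_eq_sqrt_inner)
  then show ?thesis using e c by (intro exI[of _ e] exI[of _ "cross3 N e"]) (simp add: dot_cross_self)
qed

section \<open>Calculus in a chart\<close>

lemma local_param_smooth: "local_param M U \<phi> \<Longrightarrow> smooth_on U \<phi>"
  unfolding local_param_def by blast

lemma local_param_in: "local_param M U \<phi> \<Longrightarrow> u \<in> U \<Longrightarrow> \<phi> u \<in> M"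
  unfolding local_param_def using openin_imp_subset by fastforce

lemma local_param_deriv:
  assumes "local_param M U \<phi>" "u \<in> U"
  shows "frechet_derivative \<phi> (at u) h = h$1 *\<^sub>R pd 1 \<phi> u + h$2 *\<^sub>R pd 2 \<phi> u"
  by (subst frechet_eq_sum_pd[OF smooth_on_differentiable[OF local_param_smooth]]) (use assms in \<open>auto simp: sum_2\<close>)

lemma local_param_cross_nonzero:
  assumes lp: "local_param M U \<phi>" and u: "u \<in> U" shows "cross3 (pd 1 \<phi> u) (pd 2 \<phi> u) \<noteq> 0"
proof
  let ?p = "pd 1 \<phi> u" and ?q = "pd 2 \<phi> u"
  assume "cross3 ?p ?q = 0"
  then have 0: "cross3 ?p (cross3 ?p ?q) = 0" "cross3 ?q (cross3 ?p ?q) = 0" by simp_all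
  have inj: "inj (frechet_derivative \<phi> (at u))" using lp u unfolding local_param_def by blast
  have lin: "linear (frechet_derivative \<phi> (at u))"
    by (rule linear_frechet_derivative[OF smooth_on_differentiable[OF local_param_smooth[OF lp] u]])
  have ker: "h = 0" if "h$1 *\<^sub>R ?p + h$2 *\<^sub>R ?q = 0" for h :: "real^2"
    using that local_param_deriv[OF lp u, of h] linear_injective_0[OF lin] inj by simp
  have "vector [?p \<bullet> ?q, - (?p \<bullet> ?p)] = (0 :: real^2)"
    by (rule ker) (use 0(1) in \<open>simp add: cross3_double\<close>)
  then have "?p \<bullet> ?p = 0" by (simp add: vec_eq_iff forall_2)
  then have "vector [1, 0] = (0 :: real^2)" by (intro ker) simp
  then show False by (simp add: vec_eq_iff forall_2)
qed

lemma local_param_subset: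
  assumes "local_param M U \<phi>" "open V" "V \<subseteq> U"
  shows "local_param M V \<phi>"
proof -
  obtain \<psi> where \<psi>: "homeomorphism U (\<phi> ` U) \<phi> \<psi>" and o: "openin (top_of_set M) (\<phi> ` U)"
    using assms(1) unfolding local_param_def by blast
  have "openin (top_of_set U) V" using assms by (simp add: open_subset)
  then have "openin (top_of_set (\<phi> ` U)) (\<phi> ` V)"
    using homeomorphism_imp_open_map[OF \<psi>] by blast
  then have "openin (top_of_set M) (\<phi> ` V)" using o openin_trans by blast
  moreover have "homeomorphism V (\<phi> ` V) \<phi> \<psi>"
    by (rule homeomorphism_of_subsets[OF \<psi> assms(3) subset_refl refl])
  moreover have "smooth_on V \<phi>" using smooth_on_subset[OF local_param_smooth[OF assms(1)] assms(2,3)] .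
  moreover have "\<forall>u\<in>V. inj (frechet_derivative \<phi> (at u))" using assms unfolding local_param_def by blast
  ultimately show ?thesis unfolding local_param_def by blast
qed

lemma local_param_inverse_derivative:
  assumes "local_param M U \<phi>" "u \<in> U" "homeomorphism U (\<phi> ` U) \<phi> \<psi>"
  shows "\<exists>L. (\<psi> has_derivative L) (at (\<phi> u) within M)"
proof -
  define A where "A = frechet_derivative \<phi> (at u)"
  have dA: "(\<phi> has_derivative A) (at u)"
    unfolding A_def by (rule smooth_on_has_derivative[OF local_param_smooth[OF assms(1)] assms(2)])
  then have lA: "linear A" using has_derivative_linear by blast
  have iA: "inj A" using assms(1,2) unfolding local_param_def A_def by blast
  obtain L where L: "linear L" "L \<circ> A = id" using linear_injective_left_inverse[OF lA iA] by blast
  obtain c where c: "c > 0" "\<And>h. c * norm h \<le> norm (A h)" using linear_inj_bounded_below_pos[OF lA iA] by blast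
  have bL: "bounded_linear L" using L(1) linear_conv_bounded_linear by blast
  obtain K where K: "K > 0" "\<And>y. norm (L y) \<le> norm y * K" using bounded_linear.pos_bounded[OF bL] by blast
  have inv: "\<psi> (\<phi> v) = v" if "v \<in> U" for v using homeomorphism_apply1[OF assms(3) that] .
  have "(\<psi> has_derivative L) (at (\<phi> u) within (\<phi> ` U))"
    unfolding has_derivative_within_alt
  proof (intro conjI bL allI impI)
    fix e :: real assume e: "e > 0"
    define e1 where "e1 = min (c / 2) (e * c / (2 * K))"
    have e1: "e1 > 0" "e1 \<le> c / 2" "K * e1 \<le> e * c / 2"
      using e c(1) K(1) by (auto simp: e1_def min_def field_simps)
    obtain d1 where d1: "d1 > 0" "\<And>v. norm (v - u) < d1 \<Longrightarrow> norm (\<phi> v - \<phi> u - A (v - u)) \<le> e1 * norm (v - u)"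
      using dA e1(1) unfolding has_derivative_at_alt by blast
    have "continuous_on (\<phi> ` U) \<psi>" using assms(3) by (simp add: homeomorphism_def)
    then obtain d where d: "d > 0" "\<And>y. y \<in> \<phi> ` U \<Longrightarrow> dist y (\<phi> u) < d \<Longrightarrow> dist (\<psi> y) (\<psi> (\<phi> u)) < d1"
      using assms(2) d1(1) unfolding continuous_on_iff by (meson imageI)
    show "\<exists>d>0. \<forall>y\<in>\<phi> ` U. norm (y - \<phi> u) < d \<longrightarrow> norm (\<psi> y - \<psi> (\<phi> u) - L (y - \<phi> u)) \<le> e * norm (y - \<phi> u)"
    proof (intro exI[of _ d] conjI d(1) ballI impI)
      fix y assume y: "y \<in> \<phi> ` U" "norm (y - \<phi> u) < d"
      then obtain v where v: "v \<in> U" "y = \<phi> v" by blast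
      have "norm (v - u) < d1" using d(2)[OF y(1)] y(2) v assms(2) by (simp add: dist_norm inv)
      note r = d1(2)[OF this]
      have "c * norm (v - u) \<le> norm (A (v - u))" by (rule c(2))
      also have "\<dots> \<le> norm (\<phi> v - \<phi> u) + norm (\<phi> v - \<phi> u - A (v - u))"
        using norm_triangle_ineq4[of "\<phi> v - \<phi> u" "\<phi> v - \<phi> u - A (v - u)"] by simp
      also have "\<dots> \<le> norm (\<phi> v - \<phi> u) + c / 2 * norm (v - u)"
        using r e1(2) mult_right_mono[OF e1(2), of "norm (v - u)"] by simp
      finally have low: "c / 2 * norm (v - u) \<le> norm (\<phi> v - \<phi> u)" by simp
      have "L (A (v - u)) = v - u" using L(2) by (metis comp_apply id_apply)
      then have "\<psi> y - \<psi> (\<phi> u) - L (y - \<phi> u) = - L (\<phi> v - \<phi> u - A (v - u))"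
        using v assms(2) by (simp add: inv linear_diff[OF L(1)])
      then have "norm (\<psi> y - \<psi> (\<phi> u) - L (y - \<phi> u)) \<le> norm (\<phi> v - \<phi> u - A (v - u)) * K"
        using K(2) by simp
      also have "\<dots> \<le> e1 * norm (v - u) * K" using r K(1) by (intro mult_right_mono) auto
      also have "\<dots> \<le> e * c / 2 * norm (v - u)"
        using mult_right_mono[OF e1(3), of "norm (v - u)"] by (simp add: mult_ac)
      also have "\<dots> \<le> e * norm (y - \<phi> u)" using mult_left_mono[OF low, of e] e v by (simp add: mult_ac)
      finally show "norm (\<psi> y - \<psi> (\<phi> u) - L (y - \<phi> u)) \<le> e * norm (y - \<phi> u)" .
    qed
  qed
  moreover have "at (\<phi> u) within (\<phi> ` U) = at (\<phi> u) within M"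
  proof -
    obtain T where T: "open T" "\<phi> ` U = M \<inter> T"
      using assms(1) unfolding local_param_def openin_open by blast
    show ?thesis unfolding T(2) by (rule at_within_nhd[of _ T]) (use T assms(2) in auto)
  qed
  ultimately show ?thesis by auto
qed

locale chart =
  fixes M :: "(real^3) set" and n :: "real^3 \<Rightarrow> real^3" and U :: "(real^2) set" and \<phi> :: "real^2 \<Rightarrow> real^3"
  assumes lp: "local_param M U \<phi>" and ori: "orientation M n" and conn: "connected U"
begin

definition N :: "real^2 \<Rightarrow> real^3" where "N u = n (\<phi> u)"
definition D :: "real^2 \<Rightarrow> real" where "D u = cross3 (pd 1 \<phi> u) (pd 2 \<phi> u) \<bullet> N u"

lemma smooth_\<phi>: "smooth_on U \<phi>" by (rule local_param_smooth[OF lp])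
lemma open_U: "open U" by (rule smooth_on_open[OF smooth_\<phi>])

lemmas deriv_\<phi> = local_param_deriv[OF lp]

lemma tangent_deriv:
  assumes "u \<in> U" shows "frechet_derivative \<phi> (at u) h \<in> tangent_space M (\<phi> u)"
proof -
  have L: "bounded_linear (\<lambda>t::real. t *\<^sub>R h)" by (rule bounded_linear_scaleR_left)
  obtain e where e: "e > 0" "(\<lambda>t. u + t *\<^sub>R h) ` {-e<..<e} \<subseteq> U"
  proof -
    have "open ((\<lambda>t::real. u + t *\<^sub>R h) -` U)"
      by (rule continuous_open_vimage[OF open_U]) (intro continuous_intros)
    moreover have "0 \<in> (\<lambda>t::real. u + t *\<^sub>R h) -` U" using assms by simp
    ultimately obtain e where "e > 0" "ball 0 e \<subseteq> (\<lambda>t::real. u + t *\<^sub>R h) -` U" using openE by metis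
    moreover have "{-e<..<e} = ball 0 e" by (auto simp: dist_real_def)
    ultimately show ?thesis using that by blast
  qed
  define \<gamma> where "\<gamma> t = \<phi> (u + t *\<^sub>R h)" for t :: real
  have "smooth_on {-e<..<e} \<gamma>"
    unfolding \<gamma>_def by (rule smooth_on_affine_compose[OF smooth_\<phi> L _ e(2)]) simp
  moreover have "\<gamma> ` {-e<..<e} \<subseteq> M" using e(2) local_param_in[OF lp] unfolding \<gamma>_def by blast
  moreover have "(\<gamma> has_vector_derivative frechet_derivative \<phi> (at u) h) (at 0)"
  proof -
    have 1: "((\<lambda>t::real. u + t *\<^sub>R h) has_derivative (\<lambda>t. t *\<^sub>R h)) (at 0)"
      by (auto intro!: derivative_eq_intros)
    have 2: "(\<phi> has_derivative frechet_derivative \<phi> (at u)) (at (u + 0 *\<^sub>R h))"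
      using smooth_on_has_derivative[OF smooth_\<phi> assms] by simp
    have "linear (frechet_derivative \<phi> (at u))"
      by (rule linear_frechet_derivative[OF smooth_on_differentiable[OF smooth_\<phi> assms]])
    then show ?thesis
      using has_derivative_compose[OF 1 2] unfolding \<gamma>_def has_vector_derivative_def
      by (simp add: linear_cmul)
  qed
  moreover have "\<gamma> 0 = \<phi> u" by (simp add: \<gamma>_def)
  ultimately show ?thesis unfolding tangent_space_def using e(1) by blast
qed

lemma tangent_pd: "u \<in> U \<Longrightarrow> pd j \<phi> u \<in> tangent_space M (\<phi> u)"
  unfolding pd_def by (rule tangent_deriv)

lemma tangent_orthogonal: "u \<in> U \<Longrightarrow> X \<in> tangent_space M (\<phi> u) \<Longrightarrow> X \<bullet> N u = 0"
  using ori local_param_in[OF lp] unfolding orientation_def N_def by (simp add: inner_commute)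

lemma norm_N: "u \<in> U \<Longrightarrow> N u \<bullet> N u = 1"
  using ori local_param_in[OF lp] unfolding orientation_def N_def by (simp add: dot_square_norm)

lemma pd_N_orth: "u \<in> U \<Longrightarrow> pd j \<phi> u \<bullet> N u = 0"
  by (rule tangent_orthogonal[OF _ tangent_pd])

lemma cross_pd_parallel:
  assumes "u \<in> U" shows "cross3 (pd 1 \<phi> u) (pd 2 \<phi> u) = D u *\<^sub>R N u"
proof -
  let ?c = "cross3 (pd 1 \<phi> u) (pd 2 \<phi> u)"
  have "cross3 (N u) ?c = 0"
    using pd_N_orth[OF assms] by (simp add: cross3_double inner_commute[of "N u" "pd _ \<phi> u"])
  then have "cross3 (N u) (cross3 (N u) ?c) = 0" by simp
  then have "(N u \<bullet> ?c) *\<^sub>R N u - ?c = 0" by (simp add: cross3_double[of "N u" "N u"] norm_N[OF assms])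
  then show ?thesis by (simp add: D_def inner_commute)
qed

lemmas cross_pd_nonzero = local_param_cross_nonzero[OF lp]

lemma D_nonzero: "u \<in> U \<Longrightarrow> D u \<noteq> 0"
  using cross_pd_parallel cross_pd_nonzero by force

lemma frame_at: "u \<in> U \<Longrightarrow> frame (pd 1 \<phi> u) (pd 2 \<phi> u) (N u) (D u)"
  using norm_N pd_N_orth cross_pd_parallel D_nonzero by unfold_locales

lemma tangent_iff: "u \<in> U \<Longrightarrow> X \<in> tangent_space M (\<phi> u) \<longleftrightarrow> X \<bullet> N u = 0"
proof
  assume u: "u \<in> U" and "X \<bullet> N u = 0"
  then obtain a b where "X = a *\<^sub>R pd 1 \<phi> u + b *\<^sub>R pd 2 \<phi> u"
    using frame.tangentE[OF frame_at[OF u]] by blast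
  then have "X = frechet_derivative \<phi> (at u) (vector [a, b])" by (simp add: deriv_\<phi>[OF u])
  then show "X \<in> tangent_space M (\<phi> u)" using tangent_deriv[OF u] by metis
qed (rule tangent_orthogonal)

lemma smooth_N: "smooth_on U N"
proof -
  let ?c = "\<lambda>u. cross3 (pd 1 \<phi> u) (pd 2 \<phi> u)"
  have sc: "smooth_on U ?c" by (intro smooth_intros smooth_\<phi>)
  have cN: "continuous_on U N"
  proof -
    have "continuous_on M n" using ori by (simp add: orientation_def)
    then show ?thesis unfolding N_def[abs_def]
      by (rule continuous_on_compose2[OF _ smooth_on_continuous_on[OF smooth_\<phi>]]) (use local_param_in[OF lp] in blast)
  qed
  have cD: "continuous_on U D"
    unfolding D_def[abs_def] by (intro continuous_on_inner cN smooth_on_continuous_on[OF sc])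
  have norm_c: "norm (?c u) = \<bar>D u\<bar>" if "u \<in> U" for u
    using norm_N[OF that] by (simp add: cross_pd_parallel[OF that] norm_eq_sqrt_inner)
  have "\<exists>\<sigma>. \<forall>u\<in>U. \<bar>D u\<bar> = \<sigma> * D u"
  proof (cases "\<exists>u\<in>U. D u > 0")
    case True
    then obtain u where u: "u \<in> U" "D u > 0" by blast
    have "D v > 0" if "v \<in> U" for v
    proof (rule ccontr)
      assume "\<not> D v > 0"
      then have "D v \<le> 0" "0 \<le> D u" using u by simp_all
      moreover have "connected (D ` U)" by (rule connected_continuous_image[OF cD conn])
      ultimately have "0 \<in> D ` U" using that u connectedD_interval[of "D ` U" "D v" "D u" 0] by blast
      then show False using D_nonzero by auto
    qed
    then show ?thesis by (intro exI[of _ 1]) (simp add: less_imp_le)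
  next
    case False
    then show ?thesis by (intro exI[of _ "-1"]) (auto simp: not_less)
  qed
  then obtain \<sigma> where \<sigma>: "\<And>u. u \<in> U \<Longrightarrow> \<bar>D u\<bar> = \<sigma> * D u" by blast
  have s2: "smooth_on U (\<lambda>u. (\<sigma> / sqrt (?c u \<bullet> ?c u)) *\<^sub>R ?c u)"
  proof (intro smooth_on_scaleR smooth_on_divide smooth_on_const open_U smooth_on_sqrt smooth_on_inner sc)
    show "?c u \<bullet> ?c u > 0" if "u \<in> U" for u using cross_pd_nonzero[OF that] by simp
    show "sqrt (?c u \<bullet> ?c u) \<noteq> 0" if "u \<in> U" for u using cross_pd_nonzero[OF that] by simp
  qed
  show ?thesis
  proof (rule smooth_on_cong[OF s2])
    fix u assume u: "u \<in> U"
    have "sqrt (?c u \<bullet> ?c u) = \<sigma> * D u" using norm_c[OF u] \<sigma>[OF u] by (simp add: norm_eq_sqrt_inner)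
    moreover have "\<sigma> * D u \<noteq> 0" using D_nonzero[OF u] \<sigma>[OF u] by (metis abs_eq_0_iff)
    ultimately show "(\<sigma> / sqrt (?c u \<bullet> ?c u)) *\<^sub>R ?c u = N u"
      by (simp add: cross_pd_parallel[OF u])
  qed
qed

lemma smooth_D: "smooth_on U D"
  unfolding D_def[abs_def] by (intro smooth_intros smooth_\<phi> smooth_N)

lemma diff_on_chart:
  assumes u: "u \<in> U" and f: "(\<lambda>v. f (\<phi> v)) differentiable (at u)"
  shows "diff_on M f (\<phi> u) (a *\<^sub>R pd 1 \<phi> u + b *\<^sub>R pd 2 \<phi> u) =
    a *\<^sub>R pd 1 (\<lambda>v. f (\<phi> v)) u + b *\<^sub>R pd 2 (\<lambda>v. f (\<phi> v)) u"
proof -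
  obtain \<psi> where \<psi>: "homeomorphism U (\<phi> ` U) \<phi> \<psi>" using lp unfolding local_param_def by blast
  obtain L where L: "(\<psi> has_derivative L) (at (\<phi> u) within M)"
    using local_param_inverse_derivative[OF lp u \<psi>] by blast
  have inv: "\<psi> (\<phi> v) = v" if "v \<in> U" for v using homeomorphism_apply1[OF \<psi> that] .
  let ?F = "frechet_derivative (\<lambda>v. f (\<phi> v)) (at u)"
  have "((\<lambda>v. f (\<phi> v)) has_derivative ?F) (at u)" using f frechet_derivative_works by blast
  then have dF': "((\<lambda>v. f (\<phi> v)) has_derivative ?F) (at (\<psi> (\<phi> u)) within \<psi> ` M)"
    using inv[OF u] has_derivative_at_withinI by simp
  have "((\<lambda>y. f (\<phi> (\<psi> y))) has_derivative (\<lambda>h. ?F (L h))) (at (\<phi> u) within M)"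
    by (rule has_derivative_in_compose[OF L dF'])
  moreover obtain T where T: "open T" "\<phi> ` U = M \<inter> T"
    using lp unfolding local_param_def openin_open by blast
  ultimately have "(f has_derivative (\<lambda>h. ?F (L h))) (at (\<phi> u) within M)"
  proof -
    assume d: "((\<lambda>y. f (\<phi> (\<psi> y))) has_derivative (\<lambda>h. ?F (L h))) (at (\<phi> u) within M)"
    have e: "\<phi> (\<psi> y) = y" if "y \<in> M \<inter> T" for y using homeomorphism_apply2[OF \<psi>] that T(2) by blast
    have uT: "\<phi> u \<in> M" "\<phi> u \<in> T" using u T(2) by auto
    obtain r where r: "r > 0" "ball (\<phi> u) r \<subseteq> T" using openE[OF T(1) uT(2)] by blast
    show ?thesis
      by (rule has_derivative_transform_within[OF d r(1) uT(1)])
        (use e r(2) in \<open>auto simp: dist_commute subset_iff\<close>)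
  qed
  then have "f differentiable (at (\<phi> u) within M)" using differentiable_def by blast
  then have "(f has_derivative diff_on M f (\<phi> u)) (at (\<phi> u) within M)"
    unfolding diff_on_def[abs_def] frechet_derivative_works .
  then have G: "(f has_derivative diff_on M f (\<phi> u)) (at (\<phi> u) within \<phi> ` U)"
    by (rule has_derivative_subset) (use local_param_in[OF lp] in blast)
  have d\<phi>: "(\<phi> has_derivative frechet_derivative \<phi> (at u)) (at u within U)"
    by (rule has_derivative_at_withinI[OF smooth_on_has_derivative[OF smooth_\<phi> u]])
  have "((\<lambda>v. f (\<phi> v)) has_derivative (\<lambda>h. diff_on M f (\<phi> u) (frechet_derivative \<phi> (at u) h))) (at u within U)"
    by (rule has_derivative_in_compose[OF d\<phi> G])
  then have "((\<lambda>v. f (\<phi> v)) has_derivative (\<lambda>h. diff_on M f (\<phi> u) (frechet_derivative \<phi> (at u) h))) (at u)"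
    using at_within_open[OF u open_U] by simp
  then have "?F = (\<lambda>h. diff_on M f (\<phi> u) (frechet_derivative \<phi> (at u) h))"
    using frechet_derivative_at by metis
  from fun_cong[OF this, of "vector [a, b]"] show ?thesis
    by (simp add: deriv_\<phi>[OF u] frechet_eq_sum_pd[OF f] sum_2)
qed

lemma tan_proj_chart:
  assumes u: "u \<in> U" shows "tan_proj M (\<phi> u) v = v - (v \<bullet> N u) *\<^sub>R N u"
  unfolding tan_proj_def
proof (rule the_equality)
  have "(v - (v - (v \<bullet> N u) *\<^sub>R N u)) \<bullet> t = 0" if "t \<in> tangent_space M (\<phi> u)" for t
    using tangent_orthogonal[OF u that] by (simp add: inner_commute[of "N u" t])
  moreover have "v - (v \<bullet> N u) *\<^sub>R N u \<in> tangent_space M (\<phi> u)"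
    using norm_N[OF u] by (simp add: tangent_iff[OF u] inner_diff_left)
  ultimately show "v - (v \<bullet> N u) *\<^sub>R N u \<in> tangent_space M (\<phi> u) \<and>
      (\<forall>t\<in>tangent_space M (\<phi> u). (v - (v - (v \<bullet> N u) *\<^sub>R N u)) \<bullet> t = 0)" by blast
  fix w assume w: "w \<in> tangent_space M (\<phi> u) \<and> (\<forall>t\<in>tangent_space M (\<phi> u). (v - w) \<bullet> t = 0)"
  let ?x = "v - (v \<bullet> N u) *\<^sub>R N u - w"
  have t: "?x \<bullet> N u = 0" using w norm_N[OF u] by (simp add: tangent_iff[OF u] inner_diff_left)
  then have "(v - w) \<bullet> ?x = 0" using w by (simp add: tangent_iff[OF u])
  moreover have "(v - w) \<bullet> ?x = ?x \<bullet> ?x + (v \<bullet> N u) * (N u \<bullet> ?x)" by (simp add: inner_diff_left algebra_simps)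
  ultimately have "?x \<bullet> ?x = 0" using t by (simp add: inner_commute)
  then show "w = v - (v \<bullet> N u) *\<^sub>R N u" by simp
qed

definition Grad :: "(real^2 \<Rightarrow> real) \<Rightarrow> real^2 \<Rightarrow> real^3" where
  "Grad F u = (1 / D u) *\<^sub>R cross3 (pd 1 F u *\<^sub>R pd 2 \<phi> u - pd 2 F u *\<^sub>R pd 1 \<phi> u) (N u)"

lemma smooth_Grad: "smooth_on U F \<Longrightarrow> smooth_on U (Grad F)"
  unfolding Grad_def[abs_def]
  by (intro smooth_intros smooth_\<phi> smooth_N smooth_D open_U D_nonzero)

lemma Grad_inner:
  assumes "u \<in> U"
  shows "Grad F u \<bullet> pd 1 \<phi> u = pd 1 F u" "Grad F u \<bullet> pd 2 \<phi> u = pd 2 F u" "Grad F u \<bullet> N u = 0"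
proof -
  interpret f: frame "pd 1 \<phi> u" "pd 2 \<phi> u" "N u" "D u" by (rule frame_at[OF assms])
  show "Grad F u \<bullet> pd 1 \<phi> u = pd 1 F u" "Grad F u \<bullet> pd 2 \<phi> u = pd 2 F u" "Grad F u \<bullet> N u = 0"
    unfolding Grad_def cross_skew[of _ "N u"] using f.D
    by (simp_all add: cross3_linear f.rot_simps inner_diff_left)
qed

lemma surf_grad_chart:
  assumes u: "u \<in> U" and f: "(\<lambda>v. f (\<phi> v)) differentiable (at u)"
  shows "surf_grad M f (\<phi> u) = Grad (\<lambda>v. f (\<phi> v)) u"
  unfolding surf_grad_def
proof (rule the_equality)
  interpret f: frame "pd 1 \<phi> u" "pd 2 \<phi> u" "N u" "D u" by (rule frame_at[OF u])
  have d: "diff_on M f (\<phi> u) v = Grad (\<lambda>v. f (\<phi> v)) u \<bullet> v" if v: "v \<bullet> N u = 0" for v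
  proof -
    obtain a b where v: "v = a *\<^sub>R pd 1 \<phi> u + b *\<^sub>R pd 2 \<phi> u" using f.tangentE[OF v] .
    show ?thesis unfolding v diff_on_chart[OF u f] by (simp add: inner_add_right Grad_inner[OF u])
  qed
  show "Grad (\<lambda>v. f (\<phi> v)) u \<in> tangent_space M (\<phi> u) \<and>
      (\<forall>v\<in>tangent_space M (\<phi> u). Grad (\<lambda>v. f (\<phi> v)) u \<bullet> v = diff_on M f (\<phi> u) v)"
    by (simp add: tangent_iff[OF u] Grad_inner[OF u] d)
  fix w assume w: "w \<in> tangent_space M (\<phi> u) \<and> (\<forall>v\<in>tangent_space M (\<phi> u). w \<bullet> v = diff_on M f (\<phi> u) v)"
  show "w = Grad (\<lambda>v. f (\<phi> v)) u"
    by (rule f.tangent_eqI) (use w in \<open>simp_all add: tangent_iff[OF u] Grad_inner(3)[OF u] pd_N_orth[OF u] d\<close>)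
qed

lemma surf_hess_chart:
  assumes f: "smooth_on U (\<lambda>v. f (\<phi> v))" and u: "u \<in> U" and X: "X \<bullet> N u = 0"
  shows "surf_hess M f (\<phi> u) X (a *\<^sub>R pd 1 \<phi> u + b *\<^sub>R pd 2 \<phi> u) =
    (a *\<^sub>R pd 1 (Grad (\<lambda>v. f (\<phi> v))) u + b *\<^sub>R pd 2 (Grad (\<lambda>v. f (\<phi> v))) u) \<bullet> X"
proof -
  let ?G = "Grad (\<lambda>v. f (\<phi> v))" and ?g = "\<lambda>v. surf_grad M f (\<phi> v)"
  have eq: "?g v = ?G v" if "v \<in> U" for v
    by (rule surf_grad_chart[OF that smooth_on_differentiable[OF f that]])
  have dg: "?g differentiable (at u)"
    by (rule smooth_on_differentiable[OF smooth_on_cong[OF smooth_Grad[OF f]] u]) (simp add: eq)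
  have pdg: "pd j ?g u = pd j ?G u" for j
    by (rule pd_cong[OF open_U u eq dg])
  show ?thesis
    unfolding surf_hess_def cov_deriv_def diff_on_chart[OF u dg] tan_proj_chart[OF u] pdg
    using X by (simp add: inner_diff_left inner_commute[of "N u" X])
qed

lemma tangent_onb_exists:
  assumes u: "u \<in> U" shows "\<exists>e1 e2. onb M (\<phi> u) e1 e2 \<and> cross3 e1 e2 = N u"
  using frame_exI[OF frame_at[OF u]] unfolding onb_def tangent_iff[OF u] by blast

text \<open>
  The trace of a linear map A of the tangent plane equals \<open>(A X \<times> Y + X \<times> A Y) \<bullet> N\<close> for every
  positive orthonormal basis X, Y. This expression is alternating and bilinear in X, Y, so for the basis of
  coordinate vectors it is D times the trace.
\<close>

definition Lap :: "(real^2 \<Rightarrow> real) \<Rightarrow> real^2 \<Rightarrow> real" where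
  "Lap F u = (cross3 (pd 1 (Grad F) u) (pd 2 \<phi> u) + cross3 (pd 1 \<phi> u) (pd 2 (Grad F) u)) \<bullet> N u / D u"

lemma smooth_Lap: "smooth_on U F \<Longrightarrow> smooth_on U (Lap F)"
  unfolding Lap_def[abs_def]
  by (intro smooth_intros smooth_\<phi> smooth_N smooth_D smooth_Grad D_nonzero)

end

lemma onb_cross_sign:
  fixes N :: "real^3"
  assumes "N \<bullet> N = 1" "e1 \<bullet> N = 0" "e2 \<bullet> N = 0" "norm e1 = 1" "norm e2 = 1" "e1 \<bullet> e2 = 0"
  shows "\<exists>s. s * s = 1 \<and> cross3 e2 N = s *\<^sub>R e1 \<and> cross3 N e1 = s *\<^sub>R e2 \<and> cross3 e1 e2 = s *\<^sub>R N"
proof -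
  define s where "s = cross3 e1 e2 \<bullet> N"
  have e: "e1 \<bullet> e1 = 1" "e2 \<bullet> e2 = 1" using assms(4,5) by (simp_all add: dot_square_norm)
  have "cross3 N (cross3 e1 e2) = 0" using assms(2,3) by (simp add: cross3_double inner_commute)
  then have "cross3 N (cross3 N (cross3 e1 e2)) = 0" by simp
  then have c: "cross3 e1 e2 = s *\<^sub>R N" by (simp add: cross3_double[of N N] assms(1) s_def inner_commute)
  have "cross3 e1 e2 \<bullet> cross3 e1 e2 = 1" using e assms(6) by (simp add: cross3_binet inner_commute)
  then have s: "s * s = 1" using assms(1) by (simp add: c)
  have "cross3 e2 (cross3 e1 e2) = e1" "cross3 (cross3 e1 e2) e1 = e2"
    using e assms(6) by (simp_all add: cross3_double cross_skew[of "cross3 e1 e2"] inner_commute)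
  then have "s *\<^sub>R cross3 e2 N = e1" "s *\<^sub>R cross3 N e1 = e2" by (simp_all add: c cross3_linear)
  then have "s *\<^sub>R e1 = (s * s) *\<^sub>R cross3 e2 N" "s *\<^sub>R e2 = (s * s) *\<^sub>R cross3 N e1" by (metis scaleR_scaleR)+
  then show ?thesis using s c by (intro exI[of _ s]) simp
qed

context chart
begin

lemma surf_lap_chart:
  assumes f: "smooth_on U (\<lambda>v. f (\<phi> v))" and u: "u \<in> U"
  shows "surf_lap M f (\<phi> u) = Lap (\<lambda>v. f (\<phi> v)) u"
proof -
  interpret f: frame "pd 1 \<phi> u" "pd 2 \<phi> u" "N u" "D u" by (rule frame_at[OF u])
  let ?G = "Grad (\<lambda>v. f (\<phi> v))"
  have key: "Lap (\<lambda>v. f (\<phi> v)) u = surf_hess M f (\<phi> u) e1 e1 + surf_hess M f (\<phi> u) e2 e2"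
    if o: "onb M (\<phi> u) e1 e2" for e1 e2
  proof -
    have t: "e1 \<bullet> N u = 0" "e2 \<bullet> N u = 0" and nn: "norm e1 = 1" "norm e2 = 1" "e1 \<bullet> e2 = 0"
      using o unfolding onb_def tangent_iff[OF u] by auto
    obtain s where s: "s * s = 1" "cross3 e2 (N u) = s *\<^sub>R e1" "cross3 (N u) e1 = s *\<^sub>R e2" "cross3 e1 e2 = s *\<^sub>R N u"
      using onb_cross_sign[OF f.NN t nn] by blast
    obtain a b where e1: "e1 = a *\<^sub>R pd 1 \<phi> u + b *\<^sub>R pd 2 \<phi> u" using f.tangentE[OF t(1)] .
    obtain c d where e2: "e2 = c *\<^sub>R pd 1 \<phi> u + d *\<^sub>R pd 2 \<phi> u" using f.tangentE[OF t(2)] .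
    define A1 where "A1 = a *\<^sub>R pd 1 ?G u + b *\<^sub>R pd 2 ?G u"
    define A2 where "A2 = c *\<^sub>R pd 1 ?G u + d *\<^sub>R pd 2 ?G u"
    have h1: "surf_hess M f (\<phi> u) e1 e1 = A1 \<bullet> e1"
      using surf_hess_chart[OF f u t(1), of a b] unfolding e1[symmetric] A1_def .
    have h2: "surf_hess M f (\<phi> u) e2 e2 = A2 \<bullet> e2"
      using surf_hess_chart[OF f u t(2), of c d] unfolding e2[symmetric] A2_def .
    have sD: "s = (a * d - b * c) * D u"
    proof -
      have "s = cross3 e1 e2 \<bullet> N u" by (simp add: s(4) f.NN)
      also have "\<dots> = (a * d - b * c) * D u"
        unfolding e1 e2 using f.D_eq cross_skew[of "pd 2 \<phi> u" "pd 1 \<phi> u"]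
        by (simp add: cross3_linear inner_add_left algebra_simps)
      finally show ?thesis .
    qed
    have "s * (A1 \<bullet> e1 + A2 \<bullet> e2) = A1 \<bullet> cross3 e2 (N u) + A2 \<bullet> cross3 (N u) e1"
      by (simp add: s distrib_left)
    also have "\<dots> = (cross3 A1 e2 + cross3 e1 A2) \<bullet> N u"
      using cross3_triple_cyclic(2)[of A1 e2 "N u"] cross3_triple_cyclic(1)[of e1 A2 "N u"] cross3_triple_cyclic(2)[of A2 "N u" e1]
      by (simp add: inner_add_left)
    also have "\<dots> = (a * d - b * c) * ((cross3 (pd 1 ?G u) (pd 2 \<phi> u) + cross3 (pd 1 \<phi> u) (pd 2 ?G u)) \<bullet> N u)"
      unfolding A1_def A2_def e1 e2
      using cross_skew[of "pd 2 \<phi> u"] cross_skew[of "pd 2 ?G u" "pd 1 \<phi> u"] cross_skew[of "pd 1 ?G u" "pd 1 \<phi> u"] cross_skew[of "pd 2 ?G u" "pd 2 \<phi> u"]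
      by (simp add: cross3_linear inner_add_left algebra_simps)
    also have "\<dots> = s * Lap (\<lambda>v. f (\<phi> v)) u"
      unfolding Lap_def sD using f.D by simp
    finally show ?thesis using s(1) h1 h2 by (metis mult_cancel_left mult_zero_left zero_neq_one)
  qed
  obtain e1 e2 where "onb M (\<phi> u) e1 e2" using tangent_onb_exists[OF u] by blast
  then show ?thesis unfolding surf_lap_def using key by (intro the_equality) auto
qed

definition K :: "real^2 \<Rightarrow> real" where
  "K u = (cross3 (pd 1 N u) (pd 2 N u) \<bullet> N u) / D u"

lemma smooth_K: "smooth_on U K"
  unfolding K_def[abs_def] by (intro smooth_intros smooth_N smooth_D D_nonzero)

lemma pd_N_tangent: "u \<in> U \<Longrightarrow> pd j N u \<bullet> N u = 0"
proof -
  assume u: "u \<in> U"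
  note d = smooth_on_differentiable[OF smooth_N u]
  have "pd j (\<lambda>v. N v \<bullet> N v) u = pd j (\<lambda>v. 1::real) u"
    by (rule pd_cong[OF open_U u]) (simp_all add: norm_N d)
  then show ?thesis using pd_inner[OF d d, of j] by (simp add: inner_commute)
qed

lemma cross_pd_N: "u \<in> U \<Longrightarrow> cross3 (pd 1 N u) (pd 2 N u) = (K u * D u) *\<^sub>R N u"
  using frame.cross_tangent[OF frame_at pd_N_tangent pd_N_tangent, of u 1 2] D_nonzero[of u]
  by (simp add: K_def)

lemma gauss_curv_chart:
  assumes u: "u \<in> U" shows "gauss_curv M n (\<phi> u) = K u"
proof -
  interpret f: frame "pd 1 \<phi> u" "pd 2 \<phi> u" "N u" "D u" by (rule frame_at[OF u])
  have dn: "(\<lambda>v. n (\<phi> v)) differentiable (at u)"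
    using smooth_on_differentiable[OF smooth_N u] by (simp add: N_def[abs_def])
  have pdn: "pd j (\<lambda>v. n (\<phi> v)) u = pd j N u" for j by (simp add: N_def[abs_def])
  have key: "K u = (diff_on M n (\<phi> u) e1 \<bullet> e1) * (diff_on M n (\<phi> u) e2 \<bullet> e2)
          - (diff_on M n (\<phi> u) e1 \<bullet> e2) * (diff_on M n (\<phi> u) e2 \<bullet> e1)"
    if o: "onb M (\<phi> u) e1 e2" for e1 e2
  proof -
    have t: "e1 \<bullet> N u = 0" "e2 \<bullet> N u = 0" and nn: "norm e1 = 1" "norm e2 = 1" "e1 \<bullet> e2 = 0"
      using o unfolding onb_def tangent_iff[OF u] by auto
    obtain s where s: "s * s = 1" "cross3 e1 e2 = s *\<^sub>R N u"
      using onb_cross_sign[OF f.NN t nn] by blast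
    obtain a b where e1: "e1 = a *\<^sub>R pd 1 \<phi> u + b *\<^sub>R pd 2 \<phi> u" using f.tangentE[OF t(1)] .
    obtain c d where e2: "e2 = c *\<^sub>R pd 1 \<phi> u + d *\<^sub>R pd 2 \<phi> u" using f.tangentE[OF t(2)] .
    have sD: "s = (a * d - b * c) * D u"
    proof -
      have "s = cross3 e1 e2 \<bullet> N u" by (simp add: s f.NN)
      also have "\<dots> = (a * d - b * c) * D u"
        unfolding e1 e2 using f.D_eq cross_skew[of "pd 2 \<phi> u" "pd 1 \<phi> u"]
        by (simp add: cross3_linear inner_add_left algebra_simps)
      finally show ?thesis .
    qed
    have "cross3 (diff_on M n (\<phi> u) e1) (diff_on M n (\<phi> u) e2) = (a * d - b * c) *\<^sub>R cross3 (pd 1 N u) (pd 2 N u)"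
      unfolding e1 e2 diff_on_chart[OF u dn] pdn using cross_skew[of "pd 2 N u" "pd 1 N u"]
      by (simp add: cross3_linear algebra_simps)
    then have "cross3 (diff_on M n (\<phi> u) e1) (diff_on M n (\<phi> u) e2) \<bullet> cross3 e1 e2 = (a * d - b * c) * D u * s * K u"
      by (simp add: cross_pd_N[OF u] s f.NN)
    also have "\<dots> = K u" using s(1) by (simp add: sD[symmetric])
    finally show ?thesis by (simp add: cross3_binet)
  qed
  obtain e1 e2 where "onb M (\<phi> u) e1 e2" using tangent_onb_exists[OF u] by blast
  then show ?thesis unfolding gauss_curv_def using key by (intro the_equality) auto
qed

lemma Q_rot_chart:
  assumes u: "u \<in> U" and X: "X \<bullet> N u = 0" shows "Q_rot M n (\<phi> u) X = cross3 X (N u)"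
proof -
  have key: "cross3 X (N u) = (X \<bullet> e2) *\<^sub>R e1 - (X \<bullet> e1) *\<^sub>R e2" if "pos_onb M n (\<phi> u) e1 e2" for e1 e2
    using that unfolding pos_onb_def N_def by (simp add: cross3_double[symmetric])
  obtain e1 e2 where "pos_onb M n (\<phi> u) e1 e2"
    using tangent_onb_exists[OF u] unfolding pos_onb_def N_def by blast
  then show ?thesis unfolding Q_rot_def using key by (intro the_equality) metis+
qed

end

section \<open>Null sets of the area measure\<close>

lemma sets_param_measure [simp]: "sets (param_measure U \<phi>) = sets borel"
  by (simp add: param_measure_def)

lemma param_measure_null_iff:
  assumes lp: "local_param M U \<phi>" and X: "X \<in> sets borel"
  shows "emeasure (param_measure U \<phi>) X = 0 \<longleftrightarrow> (AE u in lborel. u \<in> U \<longrightarrow> \<phi> u \<notin> X)"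
proof -
  let ?R = "restrict_space (lborel :: (real^2) measure) U"
  let ?w = "\<lambda>u. ennreal (norm (cross3 (pd 1 \<phi> u) (pd 2 \<phi> u)))"
  note sm = local_param_smooth[OF lp]
  have U: "open U" by (rule smooth_on_open[OF sm])
  have sR: "sets ?R = sets (restrict_space borel U)" by (simp add: sets_restrict_space)
  have "continuous_on U (\<lambda>u. norm (cross3 (pd 1 \<phi> u) (pd 2 \<phi> u)))"
    by (intro continuous_on_norm smooth_on_continuous_on smooth_intros sm)
  then have "(\<lambda>u. norm (cross3 (pd 1 \<phi> u) (pd 2 \<phi> u))) \<in> borel_measurable (restrict_space borel U)"
    by (rule borel_measurable_continuous_on_restrict)
  then have w[measurable]: "?w \<in> borel_measurable ?R"
    using measurable_cong_sets[OF sR refl] by (auto intro: measurable_compose[OF _ measurable_ennreal])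
  have "\<phi> \<in> borel_measurable (restrict_space borel U)"
    by (rule borel_measurable_continuous_on_restrict[OF smooth_on_continuous_on[OF sm]])
  then have \<phi>[measurable]: "\<phi> \<in> borel_measurable ?R" using measurable_cong_sets[OF sR refl] by blast
  have \<phi>d: "\<phi> \<in> measurable (density ?R ?w) borel" using \<phi> by simp
  have P: "\<phi> -` X \<inter> space ?R \<in> sets ?R" by (rule measurable_sets[OF \<phi> X])
  have "emeasure (param_measure U \<phi>) X = emeasure (density ?R ?w) (\<phi> -` X \<inter> space (density ?R ?w))"
    unfolding param_measure_def by (rule emeasure_distr[OF \<phi>d X])
  also have "\<dots> = (\<integral>\<^sup>+ u. ?w u * indicator (\<phi> -` X \<inter> space ?R) u \<partial>?R)"
    by (subst emeasure_density[OF w]) (use P in auto)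
  finally have "emeasure (param_measure U \<phi>) X = 0 \<longleftrightarrow> (AE u in ?R. ?w u * indicator (\<phi> -` X \<inter> space ?R) u = 0)"
    using P by (subst nn_integral_0_iff_AE[symmetric]) auto
  also have "\<dots> \<longleftrightarrow> (AE u in ?R. \<phi> u \<notin> X)"
  proof (rule AE_cong)
    fix u assume "u \<in> space ?R"
    then have u: "u \<in> U" by (simp add: space_restrict_space)
    then show "?w u * indicator (\<phi> -` X \<inter> space ?R) u = 0 \<longleftrightarrow> \<phi> u \<notin> X"
      using local_param_cross_nonzero[OF lp u] by (simp add: indicator_def space_restrict_space)
  qed
  also have "\<dots> \<longleftrightarrow> (AE u in lborel. u \<in> U \<longrightarrow> \<phi> u \<notin> X)"
    using U by (intro AE_restrict_space_iff) simp
  finally show ?thesis .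
qed

lemma local_param_exists: "local_param M {} (\<lambda>u. 0)"
  unfolding local_param_def by (auto simp: smooth_on_const homeomorphism_def)

lemma sets_area_measure [simp]: "sets (area_measure M) = sets borel"
  unfolding area_measure_def
  by (rule sets_SUP) (use local_param_exists in auto)

lemma space_area_measure [simp]: "space (area_measure M) = UNIV"
  using sets_eq_imp_space_eq[OF sets_area_measure] by simp

lemma param_le_area:
  assumes "local_param M U \<phi>"
  shows "emeasure (param_measure U \<phi>) X \<le> emeasure (area_measure M) X"
proof -
  have "param_measure U \<phi> \<le> area_measure M"
    unfolding area_measure_def using assms by (intro SUP_upper2[of "(U, \<phi>)"]) auto
  then show ?thesis by (rule le_measureD3) simp
qed

lemma AE_area_imp_AE_chart:
  assumes lp: "local_param M U \<phi>" and "AE x in area_measure M. P x"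
  shows "AE u in lborel. u \<in> U \<longrightarrow> P (\<phi> u)"
proof -
  obtain X where X: "{x \<in> space (area_measure M). \<not> P x} \<subseteq> X" "emeasure (area_measure M) X = 0" "X \<in> sets (area_measure M)"
    using AE_E[OF assms(2)] by blast
  have "emeasure (param_measure U \<phi>) X = 0" using param_le_area[OF lp, of X] X(2) by simp
  then have "AE u in lborel. u \<in> U \<longrightarrow> \<phi> u \<notin> X" using param_measure_null_iff[OF lp] X(3) by simp
  then show ?thesis by eventually_elim (use X(1) in auto)
qed

text \<open>
  The area measure is the least upper bound of the measures of the charts; so if X is a null set of all of
  them, the area measure is at most its own restriction to the complement of X.
\<close>

lemma area_measure_null:
  assumes X: "X \<in> sets borel" and null: "\<And>U \<phi>. local_param M U \<phi> \<Longrightarrow> emeasure (param_measure U \<phi>) X = 0"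
  shows "X \<in> null_sets (area_measure M)"
proof -
  let ?a = "area_measure M"
  define \<nu> where "\<nu> = density ?a (indicator (- X))"
  have s\<nu>: "sets \<nu> = sets borel" by (simp add: \<nu>_def)
  have em: "emeasure \<nu> A = emeasure ?a (A - X)" if "A \<in> sets borel" for A
  proof -
    have "emeasure \<nu> A = (\<integral>\<^sup>+ x. indicator (- X) x * indicator A x \<partial>?a)"
      unfolding \<nu>_def using X that by (intro emeasure_density borel_measurable_indicator) (auto simp: borel_comp)
    also have "\<dots> = (\<integral>\<^sup>+ x. indicator (A - X) x \<partial>?a)"
      by (intro nn_integral_cong) (auto simp: indicator_def)
    finally show ?thesis using X that by simp
  qed
  have "?a \<le> \<nu>"
    unfolding area_measure_def
  proof (rule SUP_least)
    fix i assume "i \<in> {(U, \<phi>). local_param M U \<phi>}"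
    then obtain U \<phi> where i: "i = (U, \<phi>)" and lp: "local_param M U \<phi>" by auto
    have "emeasure (param_measure U \<phi>) A \<le> emeasure \<nu> A" if A: "A \<in> sets borel" for A
    proof -
      have "emeasure (param_measure U \<phi>) A \<le> emeasure (param_measure U \<phi>) ((A - X) \<union> X)"
        by (rule emeasure_mono) (use A X in auto)
      also have "\<dots> \<le> emeasure (param_measure U \<phi>) (A - X) + emeasure (param_measure U \<phi>) X"
        by (rule emeasure_subadditive) (use A X in auto)
      also have "\<dots> \<le> emeasure \<nu> A" using null[OF lp] param_le_area[OF lp] by (simp add: em[OF A])
      finally show ?thesis .
    qed
    then have "param_measure U \<phi> \<le> \<nu>" using s\<nu> by (subst le_measure) auto
    then show "(case i of (U, \<phi>) \<Rightarrow> param_measure U \<phi>) \<le> \<nu>" by (simp add: i)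
  qed
  then have "emeasure ?a X \<le> emeasure \<nu> X" by (rule le_measureD3) (simp add: s\<nu>)
  also have "\<dots> = 0" by (simp add: em[OF X])
  finally show ?thesis using X by (auto intro: null_setsI)
qed

lemma negligible_AE_lborel:
  assumes "AE u in lborel. u \<notin> A" shows "negligible (A :: 'a::euclidean_space set)"
proof -
  obtain N where N: "{u \<in> space lborel. \<not> u \<notin> A} \<subseteq> N" "emeasure lborel N = 0" "N \<in> sets lborel"
    using AE_E[OF assms] by blast
  then have "N \<in> null_sets lebesgue" by (intro null_sets_completionI) auto
  then have "negligible N" by (simp add: negligible_iff_null_sets)
  then show ?thesis by (rule negligible_subset) (use N(1) in auto)
qed

text \<open>Coordinate changes are differentiable and hence preserve null sets.\<close>

lemma null_set_area_of_chart:
  assumes lp: "local_param M U \<phi>" and X: "X \<in> sets borel" "X \<subseteq> \<phi> ` U"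
    and null: "AE u in lborel. u \<in> U \<longrightarrow> \<phi> u \<notin> X"
  shows "X \<in> null_sets (area_measure M)"
proof (rule area_measure_null[OF X(1)])
  fix V \<theta> assume lp': "local_param M V \<theta>"
  obtain \<psi> where \<psi>: "homeomorphism V (\<theta> ` V) \<theta> \<psi>" using lp' unfolding local_param_def by blast
  define A where "A = {u \<in> U. \<phi> u \<in> X \<inter> \<theta> ` V}"
  have "negligible A"
    by (rule negligible_AE_lborel) (use null in \<open>auto simp: A_def elim!: eventually_mono\<close>)
  moreover have "(\<lambda>u. \<psi> (\<phi> u)) differentiable_on A"
    unfolding differentiable_on_def
  proof
    fix u assume u: "u \<in> A"
    then obtain v where v: "v \<in> V" "\<phi> u = \<theta> v" "u \<in> U" by (auto simp: A_def)
    obtain L where "(\<psi> has_derivative L) (at (\<theta> v) within M)"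
      using local_param_inverse_derivative[OF lp' v(1) \<psi>] by blast
    then have L: "(\<psi> has_derivative L) (at (\<phi> u) within \<phi> ` U)"
      unfolding v(2) by (rule has_derivative_subset) (use local_param_in[OF lp] in blast)
    have "(\<phi> has_derivative frechet_derivative \<phi> (at u)) (at u within U)"
      by (rule has_derivative_at_withinI[OF smooth_on_has_derivative[OF local_param_smooth[OF lp] v(3)]])
    from has_derivative_in_compose[OF this L] have "(\<lambda>u. \<psi> (\<phi> u)) differentiable (at u within U)"
      using differentiable_def by blast
    then show "(\<lambda>u. \<psi> (\<phi> u)) differentiable (at u within A)"
      by (rule differentiable_within_subset) (auto simp: A_def)
  qed
  ultimately have neg: "negligible ((\<lambda>u. \<psi> (\<phi> u)) ` A)"
    by (intro negligible_differentiable_image_negligible) auto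
  have "v \<in> (\<lambda>u. \<psi> (\<phi> u)) ` A" if v: "v \<in> V" "\<theta> v \<in> X" for v
  proof -
    obtain u where u: "u \<in> U" "\<theta> v = \<phi> u" using v(2) X(2) by blast
    have "\<psi> (\<phi> u) = v" using homeomorphism_apply1[OF \<psi> v(1)] u(2) by simp
    moreover have "u \<in> A" using u v by (auto simp: A_def) (metis imageI)
    ultimately show ?thesis by (metis imageI)
  qed
  then have "AE v in lborel. v \<in> V \<longrightarrow> \<theta> v \<notin> X"
    using AE_lborel_negligible[OF neg] by (auto elim!: eventually_mono)
  then show "emeasure (param_measure V \<theta>) X = 0"
    using param_measure_null_iff[OF lp' X(1)] by simp
qed

lemma borel_chart_image:
  assumes lp: "local_param M U \<phi>" shows "\<phi> ` U \<in> sets borel"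
proof -
  note sm = local_param_smooth[OF lp]
  obtain F where F: "countable F" "F \<subseteq> Pow U" "\<And>X. X \<in> F \<Longrightarrow> \<exists>a b. X = cbox a b" "\<Union>F = U"
    using open_countable_Union_open_cbox[OF smooth_on_open[OF sm]] by metis
  have "\<phi> ` X \<in> sets borel" if "X \<in> F" for X
  proof -
    have "compact X" using F(3)[OF that] compact_cbox by blast
    moreover have "continuous_on X \<phi>"
      using continuous_on_subset[OF smooth_on_continuous_on[OF sm]] F(2) that by blast
    ultimately show ?thesis using compact_continuous_image borel_compact by blast
  qed
  then have "(\<Union>X\<in>F. \<phi> ` X) \<in> sets borel" using F(1) by (intro sets.countable_UN'') auto
  moreover have "(\<Union>X\<in>F. \<phi> ` X) = \<phi> ` U" using F(4) by blast
  ultimately show ?thesis by simp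
qed

lemma chart_inside:
  assumes M: "smooth_surface M" and \<Omega>: "openin (top_of_set M) \<Omega>" and p: "p \<in> \<Omega>"
  obtains U \<phi> u where "local_param M U \<phi>" "\<phi> ` U \<subseteq> \<Omega>" "connected U" "u \<in> U" "\<phi> u = p"
proof -
  obtain T where T: "open T" "\<Omega> = M \<inter> T" using \<Omega> unfolding openin_open by blast
  obtain U \<phi> where lp: "local_param M U \<phi>" "p \<in> \<phi> ` U"
    using M p T(2) unfolding smooth_surface_def by blast
  then obtain u where u: "u \<in> U" "\<phi> u = p" by blast
  note sm = local_param_smooth[OF lp(1)]
  have "open (U \<inter> \<phi> -` T)"
    by (rule continuous_open_preimage[OF smooth_on_continuous_on[OF sm] smooth_on_open[OF sm] T(1)])
  moreover have "u \<in> U \<inter> \<phi> -` T" using u p T(2) by auto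
  ultimately obtain r where r: "r > 0" "ball u r \<subseteq> U \<inter> \<phi> -` T" using openE by metis
  show thesis
  proof (rule that[of "ball u r" \<phi> u])
    show "local_param M (ball u r) \<phi>" using local_param_subset[OF lp(1) open_ball] r(2) by blast
    show "\<phi> ` ball u r \<subseteq> \<Omega>" using r(2) local_param_in[OF lp(1)] T(2) by blast
  qed (use r u in auto)
qed

lemma borel_openin_surface:
  assumes M: "smooth_surface M" and \<Omega>: "openin (top_of_set M) \<Omega>"
  shows "\<Omega> \<in> sets borel"
proof -
  define F where "F = {\<phi> ` U | U \<phi>. local_param M U \<phi> \<and> \<phi> ` U \<subseteq> \<Omega>}"
  have "openin (top_of_set M) S" if "S \<in> F" for S using that unfolding F_def local_param_def by blast
  then obtain F' where F': "F' \<subseteq> F" "countable F'" "\<Union>F' = \<Union>F" by (rule Lindelof_openin) blast+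
  have "\<Union>F = \<Omega>"
  proof
    show "\<Union>F \<subseteq> \<Omega>" by (auto simp: F_def)
    show "\<Omega> \<subseteq> \<Union>F"
    proof
      fix p assume "p \<in> \<Omega>"
      then obtain U \<phi> u where "local_param M U \<phi>" "\<phi> ` U \<subseteq> \<Omega>" "u \<in> U" "\<phi> u = p" by (rule chart_inside[OF M \<Omega>])
      then show "p \<in> \<Union>F" unfolding F_def by blast
    qed
  qed
  moreover have "\<Union>F' \<in> sets borel"
    using F'(1,2) borel_chart_image by (intro sets.countable_Union) (auto simp: F_def)
  ultimately show ?thesis using F'(3) by simp
qed

lemma null_sets_area_local:
  assumes "\<And>p. p \<in> \<Omega> \<Longrightarrow> \<exists>S. openin (top_of_set M) S \<and> p \<in> S \<and> S \<inter> X \<in> null_sets (area_measure M)"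
    and "X \<subseteq> \<Omega>"
  shows "X \<in> null_sets (area_measure M)"
proof -
  define F where "F = {S. openin (top_of_set M) S \<and> S \<inter> X \<in> null_sets (area_measure M)}"
  obtain F' where F': "F' \<subseteq> F" "countable F'" "\<Union>F' = \<Union>F"
    by (rule Lindelof_openin[of F M]) (auto simp: F_def)
  have "(\<Union>S\<in>F'. S \<inter> X) \<in> null_sets (area_measure M)"
    by (rule null_sets_UN'[OF F'(2)]) (use F'(1) in \<open>auto simp: F_def\<close>)
  moreover have "X \<subseteq> \<Union>F" using assms unfolding F_def by blast
  then have "(\<Union>S\<in>F'. S \<inter> X) = X" using F'(3) by blast
  ultimately show ?thesis by simp
qed

section \<open>Killing fields in a chart\<close>

text \<open>
  If \<open>[a, g] = 0\<close> and \<open>div a = 0\<close> for a divergence with density \<open>exp l\<close>, where \<open>l1, l2\<close> are the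
  partial derivatives of l, then \<open>div g\<close> is constant along a.
\<close>

lemma divergence_invariant:
  fixes a1 a2 g1 g2 l1 l2 L :: "real^2 \<Rightarrow> real"
  assumes B: "open B" and u: "u \<in> B"
    and sm: "smooth_on B a1" "smooth_on B a2" "smooth_on B g1" "smooth_on B g2" "smooth_on B l1" "smooth_on B l2"
    and br1: "\<And>v. v \<in> B \<Longrightarrow> a1 v * pd 1 g1 v + a2 v * pd 2 g1 v = g1 v * pd 1 a1 v + g2 v * pd 2 a1 v"
    and br2: "\<And>v. v \<in> B \<Longrightarrow> a1 v * pd 1 g2 v + a2 v * pd 2 g2 v = g1 v * pd 1 a2 v + g2 v * pd 2 a2 v"
    and div: "\<And>v. v \<in> B \<Longrightarrow> pd 1 a1 v + pd 2 a2 v + (a1 v * l1 v + a2 v * l2 v) = 0"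
    and l: "pd 1 l2 u = pd 2 l1 u"
    and L: "\<And>v. v \<in> B \<Longrightarrow> L v = pd 1 g1 v + pd 2 g2 v + (g1 v * l1 v + g2 v * l2 v)"
  shows "a1 u * pd 1 L u + a2 u * pd 2 L u = 0"
proof -
  note d = smooth_on_differentiable[OF _ u]
  note D = d[OF sm(1)] d[OF sm(2)] d[OF sm(3)] d[OF sm(4)] d[OF sm(5)] d[OF sm(6)]
  note s = smooth_on_pd[OF sm(1)] smooth_on_pd[OF sm(2)] smooth_on_pd[OF sm(3)] smooth_on_pd[OF sm(4)]
  note DD = d[OF s(1)] d[OF s(2)] d[OF s(3)] d[OF s(4)]
  note dr = differentiable_add differentiable_mult D DD
  note rules = pd_add pd_mult dr
  have comm: "pd 2 (pd 1 a1) u = pd 1 (pd 2 a1) u" "pd 2 (pd 1 a2) u = pd 1 (pd 2 a2) u"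
    "pd 2 (pd 1 g1) u = pd 1 (pd 2 g1) u" "pd 2 (pd 1 g2) u = pd 1 (pd 2 g2) u"
    by (rule pd_commute[OF _ u]; rule sm)+
  have e1: "pd 1 (\<lambda>v. a1 v * pd 1 g1 v + a2 v * pd 2 g1 v) u = pd 1 (\<lambda>v. g1 v * pd 1 a1 v + g2 v * pd 2 a1 v) u"
    by (rule pd_cong[OF B u br1], assumption, intro dr)
  have e2: "pd 2 (\<lambda>v. a1 v * pd 1 g2 v + a2 v * pd 2 g2 v) u = pd 2 (\<lambda>v. g1 v * pd 1 a2 v + g2 v * pd 2 a2 v) u"
    by (rule pd_cong[OF B u br2], assumption, intro dr)
  have e3: "pd j (\<lambda>v. pd 1 a1 v + pd 2 a2 v + (a1 v * l1 v + a2 v * l2 v)) u = pd j (\<lambda>v. 0) u" for j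
    by (rule pd_cong[OF B u div], assumption, intro dr)
  have e4: "pd j (\<lambda>v. pd 1 g1 v + pd 2 g2 v + (g1 v * l1 v + g2 v * l2 v)) u = pd j L u" for j
    by (rule pd_cong[OF B u L[symmetric]], assumption, intro dr)
  note e1' = e1[simplified rules comm] and e2' = e2[simplified rules comm]
  note e31 = e3[of 1, simplified rules comm] and e32 = e3[of 2, simplified rules comm]
  note e41 = e4[of 1, simplified rules comm] and e42 = e4[of 2, simplified rules comm]
  note b1 = br1[OF u] and b2 = br2[OF u]
  have "a1 u * pd 1 L u + a2 u * pd 2 L u =
      (a1 u * pd 1 (pd 1 g1) u + a1 u * pd 1 (pd 2 g2) u + a2 u * pd 1 (pd 2 g1) u + a2 u * pd 2 (pd 2 g2) u)
      + l1 u * (a1 u * pd 1 g1 u + a2 u * pd 2 g1 u) + l2 u * (a1 u * pd 1 g2 u + a2 u * pd 2 g2 u)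
      + (a1 u * g1 u * pd 1 l1 u + a1 u * g2 u * pd 1 l2 u + a2 u * g1 u * pd 2 l1 u + a2 u * g2 u * pd 2 l2 u)"
    unfolding e41[symmetric] e42[symmetric] by (simp add: algebra_simps)
  also have "(a1 u * pd 1 (pd 1 g1) u + a1 u * pd 1 (pd 2 g2) u + a2 u * pd 1 (pd 2 g1) u + a2 u * pd 2 (pd 2 g2) u)
      = (g1 u * pd 1 (pd 1 a1) u + g1 u * pd 1 (pd 2 a2) u + g2 u * pd 1 (pd 2 a1) u + g2 u * pd 2 (pd 2 a2) u)"
    using e1' e2' by (simp add: algebra_simps)
  also have "(g1 u * pd 1 (pd 1 a1) u + g1 u * pd 1 (pd 2 a2) u + g2 u * pd 1 (pd 2 a1) u + g2 u * pd 2 (pd 2 a2) u)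
      + l1 u * (a1 u * pd 1 g1 u + a2 u * pd 2 g1 u) + l2 u * (a1 u * pd 1 g2 u + a2 u * pd 2 g2 u)
      + (a1 u * g1 u * pd 1 l1 u + a1 u * g2 u * pd 1 l2 u + a2 u * g1 u * pd 2 l1 u + a2 u * g2 u * pd 2 l2 u)
    = g1 u * (pd 1 (pd 1 a1) u + pd 1 (pd 2 a2) u + (pd 1 a1 u * l1 u + a1 u * pd 1 l1 u + (pd 1 a2 u * l2 u + a2 u * pd 1 l2 u)))
    + g2 u * (pd 1 (pd 2 a1) u + pd 2 (pd 2 a2) u + (pd 2 a1 u * l1 u + a1 u * pd 2 l1 u + (pd 2 a2 u * l2 u + a2 u * pd 2 l2 u)))"
    unfolding b1 b2 l by (simp add: algebra_simps)
  also have "\<dots> = 0" using e31 e32 by simp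
  finally show ?thesis .
qed

lemma frame_parallel:
  assumes "frame p q N D" and X: "X \<bullet> N = 0" "X \<bullet> G = 0" and w: "w \<bullet> N = 0" "w \<bullet> G = 0" "w \<noteq> 0"
    and G: "G \<bullet> N = 0" "G \<noteq> 0"
  shows "\<exists>c. X = c *\<^sub>R w"
proof -
  interpret frame p q N D by (rule assms(1))
  define x where "x = cross3 X w \<bullet> N"
  have c: "cross3 X w = x *\<^sub>R N" unfolding x_def by (rule cross_tangent[OF X(1) w(1)])
  have "cross3 G (cross3 X w) = 0" using X w by (simp add: cross3_double inner_commute)
  then have "x *\<^sub>R cross3 G N = 0" by (simp add: c cross3_linear)
  moreover have "cross3 G N \<noteq> 0"
  proof
    assume "cross3 G N = 0"
    then have "cross3 N (cross3 G N) = 0" by simp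
    then show False using G NN by (simp add: cross3_double inner_commute)
  qed
  ultimately have "cross3 w (cross3 X w) = 0" by (simp add: c)
  then have "(w \<bullet> w) *\<^sub>R X = (w \<bullet> X) *\<^sub>R w" by (simp add: cross3_double)
  then have "(1 / (w \<bullet> w)) *\<^sub>R ((w \<bullet> w) *\<^sub>R X) = (1 / (w \<bullet> w)) *\<^sub>R ((w \<bullet> X) *\<^sub>R w)" by (simp only:)
  then show ?thesis using w(3) by auto
qed

locale killing_chart = chart +
  fixes B :: "(real^2) set" and w :: "real^2 \<Rightarrow> real^3" and \<tau> :: "real^2 \<Rightarrow> real"
  assumes B: "open B" "B \<subseteq> U" and sw: "smooth_on B w" and s\<tau>: "smooth_on B \<tau>"
    and wN: "\<And>u. u \<in> B \<Longrightarrow> w u \<bullet> N u = 0"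
    and pd_w: "\<And>u j. u \<in> B \<Longrightarrow>
      pd j w u = \<tau> u *\<^sub>R cross3 (N u) (pd j \<phi> u) - (w u \<bullet> pd j N u) *\<^sub>R N u"
begin

lemma in_U: "u \<in> B \<Longrightarrow> u \<in> U" using B by blast

lemma s\<phi>B: "smooth_on B \<phi>" by (rule smooth_on_subset[OF smooth_\<phi> B])
lemma sNB: "smooth_on B N" by (rule smooth_on_subset[OF smooth_N B])
lemma sDB: "smooth_on B D" by (rule smooth_on_subset[OF smooth_D B])
lemma sKB: "smooth_on B K" by (rule smooth_on_subset[OF smooth_K B])

lemmas dB = smooth_on_differentiable[OF sw] smooth_on_differentiable[OF s\<tau>] smooth_on_differentiable[OF s\<phi>B]
  smooth_on_differentiable[OF sNB] smooth_on_differentiable[OF sDB] smooth_on_differentiable[OF sKB]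
  smooth_on_differentiable[OF smooth_on_pd[OF s\<phi>B]] smooth_on_differentiable[OF smooth_on_pd[OF sNB]]

lemma phi_comm: "u \<in> B \<Longrightarrow> pd 2 (pd 1 \<phi>) u = pd 1 (pd 2 \<phi>) u"
  by (rule pd_commute[OF s\<phi>B])

lemma cross_normal_zero:
  assumes "u \<in> B" "X \<bullet> N u = 0" "Y \<bullet> N u = 0" "Z \<bullet> N u = 0" shows "cross3 X Y \<bullet> Z = 0"
  using frame.cross_tangent[OF frame_at[OF in_U[OF assms(1)]] assms(2,3)] assms(4)
  by (metis inner_commute inner_scaleR_left mult_zero_right)

lemma pd_tau:
  assumes u: "u \<in> B"
  shows "pd j \<tau> u = - K u * (w u \<bullet> cross3 (N u) (pd j \<phi> u))"
proof -
  interpret f: frame "pd 1 \<phi> u" "pd 2 \<phi> u" "N u" "D u" by (rule frame_at[OF in_U[OF u]])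
  let ?p = "pd 1 \<phi> u" and ?q = "pd 2 \<phi> u" and ?N = "N u" and ?N1 = "pd 1 N u" and ?N2 = "pd 2 N u"
  let ?m = "pd 1 (pd 2 \<phi>) u"
  have NN1: "?N1 \<bullet> ?N = 0" "?N2 \<bullet> ?N = 0" by (rule pd_N_tangent[OF in_U[OF u]])+
  have expand: "pd i (pd j w) u = (pd i \<tau> u *\<^sub>R cross3 ?N (pd j \<phi> u) +
      \<tau> u *\<^sub>R (cross3 (pd i N u) (pd j \<phi> u) + cross3 ?N (pd i (pd j \<phi>) u))) -
      (pd i (\<lambda>v. w v \<bullet> pd j N v) u *\<^sub>R ?N + (w u \<bullet> pd j N u) *\<^sub>R pd i N u)" for i j
  proof -
    have 1: "(\<lambda>v. cross3 (N v) (pd j \<phi> v)) differentiable (at u)"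
      by (rule smooth_on_differentiable[OF _ u]) (intro smooth_intros sNB s\<phi>B)
    have 2: "(\<lambda>v. w v \<bullet> pd j N v) differentiable (at u)"
      by (rule smooth_on_differentiable[OF _ u]) (intro smooth_intros sNB sw)
    have 3: "(\<lambda>v. \<tau> v *\<^sub>R cross3 (N v) (pd j \<phi> v)) differentiable (at u)"
      "(\<lambda>v. (w v \<bullet> pd j N v) *\<^sub>R N v) differentiable (at u)"
      by (rule smooth_on_differentiable[OF _ u]; intro smooth_intros sNB sw s\<tau> s\<phi>B)+
    have "pd i (pd j w) u = pd i (\<lambda>v. \<tau> v *\<^sub>R cross3 (N v) (pd j \<phi> v) - (w v \<bullet> pd j N v) *\<^sub>R N v) u"
      by (rule pd_cong[OF B(1) u pd_w]) (auto intro: smooth_on_differentiable[OF smooth_on_pd[OF sw] u])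
    then show ?thesis
      by (simp add: pd_diff[OF 3] pd_scaleR[OF dB(2)[OF u] 1] pd_scaleR[OF 2 dB(4)[OF u]]
          pd_cross3[OF dB(4)[OF u] dB(7)[OF u]])
  qed
  have eq: "pd 2 (pd 1 w) u = pd 1 (pd 2 w) u" by (rule pd_commute[OF sw u])
  have c0: "cross3 ?N2 ?p \<bullet> ?p = 0" "cross3 ?N2 ?p \<bullet> ?q = 0" "cross3 ?N1 ?q \<bullet> ?p = 0" "cross3 ?N1 ?q \<bullet> ?q = 0"
    by (rule cross_normal_zero[OF u]; intro NN1 f.pN f.qN)+
  have Np: "?N \<bullet> ?p = 0" "?N \<bullet> ?q = 0" using f.pN f.qN by (simp_all add: inner_commute)
  have e: "pd 2 (pd 1 w) u \<bullet> X = pd 1 (pd 2 w) u \<bullet> X" for X using eq by simp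
  have bin: "(w u \<bullet> ?N1) * (?N2 \<bullet> X) - (w u \<bullet> ?N2) * (?N1 \<bullet> X) = K u * D u * (?N \<bullet> cross3 (w u) X)" for X
    using cross3_binet[of ?N1 ?N2 "w u" X] cross_pd_N[OF in_U[OF u]] by (simp add: inner_commute mult.commute)
  have rot: "?N \<bullet> cross3 (w u) X = - (w u \<bullet> cross3 ?N X)" for X
    using cross3_triple_cyclic[of ?N X "w u"] cross3_triple_cyclic[of "w u" X ?N] cross_skew[of X "w u"]
    by (simp add: inner_commute)
  note E = e[unfolded expand phi_comm[OF u]]
  note simps = inner_diff_left inner_add_left inner_scaleR_left f.rot_simps c0 Np
  have "pd 1 \<tau> u * D u = K u * D u * (?N \<bullet> cross3 (w u) ?p)"
    using E[of ?p, simplified simps] bin[of ?p] by linarith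
  moreover have "pd 2 \<tau> u * D u = K u * D u * (?N \<bullet> cross3 (w u) ?q)"
    using E[of ?q, simplified simps] bin[of ?q] by linarith
  ultimately have "pd 1 \<tau> u = K u * (?N \<bullet> cross3 (w u) ?p)" "pd 2 \<tau> u = K u * (?N \<bullet> cross3 (w u) ?q)"
    using f.D by (simp_all add: mult.commute mult.left_commute)
  then have "pd 1 \<tau> u = - K u * (w u \<bullet> cross3 ?N ?p)" "pd 2 \<tau> u = - K u * (w u \<bullet> cross3 ?N ?q)"
    by (simp_all add: rot)
  then show ?thesis using exhaust_2[of j] by auto
qed

lemma killing_skew:
  assumes u: "u \<in> B" shows "pd i w u \<bullet> pd j \<phi> u = - (pd j w u \<bullet> pd i \<phi> u)"
proof -
  have "N u \<bullet> pd k \<phi> u = 0" for k using pd_N_orth[OF in_U[OF u]] by (simp add: inner_commute)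
  then show ?thesis
    using cross3_triple_cyclic(2)[of "N u" "pd i \<phi> u" "pd j \<phi> u"] cross3_triple_cyclic(2)[of "N u" "pd j \<phi> u" "pd i \<phi> u"]
      cross_skew[of "pd i \<phi> u" "pd j \<phi> u"]
    by (simp add: pd_w[OF u] inner_diff_left)
qed

lemma pd_cross_w:
  assumes u: "u \<in> B"
  shows "pd i (\<lambda>v. cross3 (w v) (pd j \<phi> v) \<bullet> N v) u =
    - \<tau> u * (cross3 (N u) (pd i \<phi> u) \<bullet> cross3 (N u) (pd j \<phi> u)) + cross3 (w u) (pd i (pd j \<phi>) u) \<bullet> N u"
proof -
  have d: "(\<lambda>v. cross3 (w v) (pd j \<phi> v)) differentiable (at u)"
    by (rule smooth_on_differentiable[OF _ u]) (intro smooth_intros sw s\<phi>B)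
  have z: "cross3 (w u) (pd j \<phi> u) \<bullet> pd i N u = 0"
    by (rule cross_normal_zero[OF u wN[OF u] pd_N_orth[OF in_U[OF u]] pd_N_tangent[OF in_U[OF u]]])
  have t: "cross3 (cross3 (N u) (pd i \<phi> u)) (pd j \<phi> u) \<bullet> N u = - (cross3 (N u) (pd i \<phi> u) \<bullet> cross3 (N u) (pd j \<phi> u))"
    using cross3_triple_cyclic(2)[of "cross3 (N u) (pd i \<phi> u)" "pd j \<phi> u" "N u"] cross_skew[of "pd j \<phi> u" "N u"] by simp
  have t2: "cross3 (N u) (pd j \<phi> u) \<bullet> N u = 0" by (simp add: dot_cross_self)
  show ?thesis
    unfolding pd_inner[OF d dB(4)[OF u]] pd_cross3[OF dB(1)[OF u] dB(7)[OF u]] pd_w[OF u]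
    by (simp add: cross3_linear inner_add_left inner_diff_left t t2 z)
qed

lemma w_Grad:
  assumes u: "u \<in> B"
  shows "w u \<bullet> Grad F u = (pd 1 F u * (cross3 (w u) (pd 2 \<phi> u) \<bullet> N u) - pd 2 F u * (cross3 (w u) (pd 1 \<phi> u) \<bullet> N u)) / D u"
  unfolding Grad_def using cross3_triple_cyclic(2)[of "w u" "pd 2 \<phi> u" "N u"] cross3_triple_cyclic(2)[of "w u" "pd 1 \<phi> u" "N u"]
  by (simp add: cross3_linear inner_diff_right)

lemma w_Grad_K:
  assumes u: "u \<in> B" shows "w u \<bullet> Grad K u = 0"
proof -
  have eq: "w v \<bullet> cross3 (N v) (pd j \<phi> v) = - (cross3 (w v) (pd j \<phi> v) \<bullet> N v)" for v j
    using cross3_triple_cyclic(2)[of "w v" "pd j \<phi> v" "N v"] cross_skew[of "pd j \<phi> v" "N v"] by simp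
  have t: "pd j \<tau> v = K v * (cross3 (w v) (pd j \<phi> v) \<bullet> N v)" if "v \<in> B" for v j
    unfolding pd_tau[OF that] eq by simp
  have d: "(\<lambda>v. cross3 (w v) (pd j \<phi> v) \<bullet> N v) differentiable (at u)" for j
    by (rule smooth_on_differentiable[OF _ u]) (intro smooth_intros sw s\<phi>B sNB)
  have e: "pd i (pd j \<tau>) u = pd i K u * (cross3 (w u) (pd j \<phi> u) \<bullet> N u) + K u * pd i (\<lambda>v. cross3 (w v) (pd j \<phi> v) \<bullet> N v) u" for i j
  proof -
    have "pd i (pd j \<tau>) u = pd i (\<lambda>v. K v * (cross3 (w v) (pd j \<phi> v) \<bullet> N v)) u"
      by (rule pd_cong[OF B(1) u t]) (auto intro: smooth_on_differentiable[OF smooth_on_pd[OF s\<tau>] u])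
    then show ?thesis by (simp add: pd_mult[OF dB(6)[OF u] d])
  qed
  have "pd 2 (pd 1 \<tau>) u = pd 1 (pd 2 \<tau>) u" by (rule pd_commute[OF s\<tau> u])
  then have "pd 2 K u * (cross3 (w u) (pd 1 \<phi> u) \<bullet> N u) = pd 1 K u * (cross3 (w u) (pd 2 \<phi> u) \<bullet> N u)"
    unfolding e pd_cross_w[OF u] phi_comm[OF u] by (simp add: inner_commute)
  then show ?thesis by (simp add: w_Grad[OF u])
qed

definition "comp1 X v = (cross3 (X v) (pd 2 \<phi> v) \<bullet> N v) / D v" for X :: "real^2 \<Rightarrow> real^3"
definition "comp2 X v = (cross3 (pd 1 \<phi> v) (X v) \<bullet> N v) / D v" for X :: "real^2 \<Rightarrow> real^3"

lemma smooth_comp: assumes "smooth_on B X" shows "smooth_on B (comp1 X)" "smooth_on B (comp2 X)"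
  unfolding comp1_def[abs_def] comp2_def[abs_def]
  by (intro smooth_intros assms s\<phi>B sNB sDB D_nonzero in_U; assumption)+

lemma comp_expansion:
  assumes "v \<in> B" "X v \<bullet> N v = 0" shows "X v = comp1 X v *\<^sub>R pd 1 \<phi> v + comp2 X v *\<^sub>R pd 2 \<phi> v"
  unfolding comp1_def comp2_def by (rule frame.tangent_expansion[OF frame_at[OF in_U[OF assms(1)]] assms(2)])

lemma pd_comp_expansion:
  assumes X: "smooth_on B X" "\<And>v. v \<in> B \<Longrightarrow> X v \<bullet> N v = 0" and u: "u \<in> B"
  shows "pd i X u = pd i (comp1 X) u *\<^sub>R pd 1 \<phi> u + pd i (comp2 X) u *\<^sub>R pd 2 \<phi> u +
    (comp1 X u *\<^sub>R pd i (pd 1 \<phi>) u + comp2 X u *\<^sub>R pd i (pd 2 \<phi>) u)"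
proof -
  note d = smooth_on_differentiable[OF smooth_comp(1)[OF X(1)] u] smooth_on_differentiable[OF smooth_comp(2)[OF X(1)] u]
  have d2: "(\<lambda>v. comp1 X v *\<^sub>R pd 1 \<phi> v) differentiable (at u)" "(\<lambda>v. comp2 X v *\<^sub>R pd 2 \<phi> v) differentiable (at u)"
    by (rule smooth_on_differentiable[OF _ u]; intro smooth_intros smooth_comp[OF X(1)] s\<phi>B)+
  have "pd i X u = pd i (\<lambda>v. comp1 X v *\<^sub>R pd 1 \<phi> v + comp2 X v *\<^sub>R pd 2 \<phi> v) u"
    by (rule pd_cong[OF B(1) u]) (auto intro: comp_expansion X smooth_on_differentiable[OF X(1) u])
  then show ?thesis
    by (simp add: pd_add[OF d2] pd_scaleR[OF d(1) dB(7)[OF u]] pd_scaleR[OF d(2) dB(7)[OF u]] algebra_simps)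
qed

lemma pd_D_comp:
  assumes X: "smooth_on B X" "\<And>v. v \<in> B \<Longrightarrow> X v \<bullet> N v = 0" and u: "u \<in> B"
  shows "(cross3 (pd 1 X u) (pd 2 \<phi> u) + cross3 (pd 1 \<phi> u) (pd 2 X u)) \<bullet> N u / D u =
    pd 1 (comp1 X) u + pd 2 (comp2 X) u + (comp1 X u * (pd 1 D u / D u) + comp2 X u * (pd 2 D u / D u))"
proof -
  interpret f: frame "pd 1 \<phi> u" "pd 2 \<phi> u" "N u" "D u" by (rule frame_at[OF in_U[OF u]])
  have pdD: "pd i D u = (cross3 (pd i (pd 1 \<phi>) u) (pd 2 \<phi> u) + cross3 (pd 1 \<phi> u) (pd i (pd 2 \<phi>) u)) \<bullet> N u" for i
  proof -
    have d: "(\<lambda>v. cross3 (pd 1 \<phi> v) (pd 2 \<phi> v)) differentiable (at u)"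
      by (rule smooth_on_differentiable[OF _ u]) (intro smooth_intros s\<phi>B)
    have "cross3 (pd 1 \<phi> u) (pd 2 \<phi> u) \<bullet> pd i N u = 0"
      by (rule cross_normal_zero[OF u f.pN f.qN pd_N_tangent[OF in_U[OF u]]])
    then show ?thesis
      unfolding D_def[abs_def] by (simp add: pd_inner[OF d dB(4)[OF u]] pd_cross3[OF dB(7)[OF u] dB(7)[OF u]])
  qed
  have ex: "pd i X u = pd i (comp1 X) u *\<^sub>R pd 1 \<phi> u + pd i (comp2 X) u *\<^sub>R pd 2 \<phi> u +
      (comp1 X u *\<^sub>R pd i (pd 1 \<phi>) u + comp2 X u *\<^sub>R pd i (pd 2 \<phi>) u)" for i
    by (rule pd_comp_expansion[OF X u])
  have "(cross3 (pd 1 X u) (pd 2 \<phi> u) + cross3 (pd 1 \<phi> u) (pd 2 X u)) \<bullet> N u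
     = D u * pd 1 (comp1 X) u + D u * pd 2 (comp2 X) u + comp1 X u * pd 1 D u + comp2 X u * pd 2 D u"
    unfolding ex[of 1] ex[of 2] pdD phi_comm[OF u] f.D_eq[symmetric]
    by (simp add: cross3_linear inner_add_left algebra_simps)
  then show ?thesis using f.D by (simp add: field_simps)
qed

context
  fixes F assumes F: "smooth_on U F" and inv: "\<And>u. u \<in> B \<Longrightarrow> w u \<bullet> Grad F u = 0"
begin

lemma sFB: "smooth_on B F" by (rule smooth_on_subset[OF F B])
lemma sGB: "smooth_on B (Grad F)" by (rule smooth_on_subset[OF smooth_Grad[OF F] B])
lemma dG: "u \<in> B \<Longrightarrow> Grad F differentiable (at u)" by (rule smooth_on_differentiable[OF sGB])

lemma Grad_pd: "u \<in> U \<Longrightarrow> Grad F u \<bullet> pd j \<phi> u = pd j F u"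
  using Grad_inner(1,2)[of u F] exhaust_2[of j] by auto

lemma hess_sym:
  assumes u: "u \<in> B" shows "pd i (Grad F) u \<bullet> pd j \<phi> u = pd j (Grad F) u \<bullet> pd i \<phi> u"
proof -
  have e: "pd i (Grad F) u \<bullet> pd j \<phi> u + Grad F u \<bullet> pd i (pd j \<phi>) u = pd i (pd j F) u" for i j
  proof -
    have "pd i (\<lambda>v. Grad F v \<bullet> pd j \<phi> v) u = pd i (pd j F) u"
      by (rule pd_cong[OF B(1) u])
        (auto intro!: Grad_pd[OF in_U] smooth_on_differentiable[OF _ u] smooth_intros sGB s\<phi>B)
    then show ?thesis by (simp add: pd_inner[OF dG[OF u] dB(7)[OF u]])
  qed
  have "pd i (pd j \<phi>) u = pd j (pd i \<phi>) u" by (rule pd_commute[OF s\<phi>B u])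
  moreover have "pd i (pd j F) u = pd j (pd i F) u" by (rule pd_commute[OF sFB u])
  ultimately show ?thesis using e[of i j] e[of j i] by simp
qed

lemma inv_deriv:
  assumes u: "u \<in> B" shows "pd j w u \<bullet> Grad F u + w u \<bullet> pd j (Grad F) u = 0"
proof -
  have "pd j (\<lambda>v. w v \<bullet> Grad F v) u = pd j (\<lambda>v. 0) u"
    by (rule pd_cong[OF B(1) u inv]) (auto intro!: smooth_on_differentiable[OF _ u] smooth_intros sGB sw)
  then show ?thesis by (simp add: pd_inner[OF dB(1)[OF u] dG[OF u]])
qed

lemma tau_zero:
  assumes u: "u \<in> B" and "w u = 0" "Grad F u \<noteq> 0" shows "\<tau> u = 0"
proof (rule ccontr)
  interpret f: frame "pd 1 \<phi> u" "pd 2 \<phi> u" "N u" "D u" by (rule frame_at[OF in_U[OF u]])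
  assume "\<tau> u \<noteq> 0"
  then have 0: "cross3 (N u) (pd j \<phi> u) \<bullet> Grad F u = 0" for j
    using inv_deriv[OF u, of j] assms(2) by (simp add: pd_w[OF u])
  have "cross3 (Grad F u) (N u) \<bullet> pd j \<phi> u = 0" for j
    using 0[of j] cross3_triple_cyclic[of "N u" "pd j \<phi> u" "Grad F u"] cross3_triple_cyclic[of "Grad F u" "N u" "pd j \<phi> u"]
    by (simp add: inner_commute)
  then have "cross3 (Grad F u) (N u) = 0" by (intro f.tangent_zero) (simp_all add: dot_cross_self)
  then have "cross3 (N u) (cross3 (Grad F u) (N u)) = 0" by simp
  then show False using assms(3) Grad_inner(3)[OF in_U[OF u], of F] f.NN by (simp add: cross3_double inner_commute)
qed

lemma hess_w_Grad:
  assumes u: "u \<in> B" and w: "w u = a *\<^sub>R pd 1 \<phi> u + b *\<^sub>R pd 2 \<phi> u"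
  shows "(a *\<^sub>R pd 1 (Grad F) u + b *\<^sub>R pd 2 (Grad F) u) \<bullet> Grad F u = 0"
proof -
  interpret f: frame "pd 1 \<phi> u" "pd 2 \<phi> u" "N u" "D u" by (rule frame_at[OF in_U[OF u]])
  obtain c d where G: "Grad F u = c *\<^sub>R pd 1 \<phi> u + d *\<^sub>R pd 2 \<phi> u"
    using f.tangentE[OF Grad_inner(3)[OF in_U[OF u]]] .
  have Gk: "pd j w u \<bullet> Grad F u = \<tau> u * (cross3 (N u) (pd j \<phi> u) \<bullet> Grad F u)" for j
    using Grad_inner(3)[OF in_U[OF u], of F] by (simp add: pd_w[OF u] inner_diff_left inner_commute[of "N u" "Grad F u"])
  have "(a *\<^sub>R pd 1 (Grad F) u + b *\<^sub>R pd 2 (Grad F) u) \<bullet> Grad F u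
      = c * (w u \<bullet> pd 1 (Grad F) u) + d * (w u \<bullet> pd 2 (Grad F) u)"
    unfolding w G using hess_sym[OF u, of 1 2]
    by (simp add: inner_add_left inner_add_right inner_commute algebra_simps)
  also have "\<dots> = - (c * (pd 1 w u \<bullet> Grad F u) + d * (pd 2 w u \<bullet> Grad F u))"
    using inv_deriv[OF u, of 1] inv_deriv[OF u, of 2] by (simp add: add_eq_0_iff)
  also have "\<dots> = - \<tau> u * (cross3 (N u) (c *\<^sub>R pd 1 \<phi> u + d *\<^sub>R pd 2 \<phi> u) \<bullet> Grad F u)"
    unfolding Gk by (simp add: cross3_linear inner_add_left algebra_simps)
  also have "\<dots> = 0" unfolding G[symmetric] by (simp add: dot_cross_self)
  finally show ?thesis .
qed

lemma bracket_zero: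
  assumes u: "u \<in> B"
  shows "comp1 w u * pd 1 (comp1 (Grad F)) u + comp2 w u * pd 2 (comp1 (Grad F)) u
       = comp1 (Grad F) u * pd 1 (comp1 w) u + comp2 (Grad F) u * pd 2 (comp1 w) u"
    and "comp1 w u * pd 1 (comp2 (Grad F)) u + comp2 w u * pd 2 (comp2 (Grad F)) u
       = comp1 (Grad F) u * pd 1 (comp2 w) u + comp2 (Grad F) u * pd 2 (comp2 w) u"
proof -
  interpret f: frame "pd 1 \<phi> u" "pd 2 \<phi> u" "N u" "D u" by (rule frame_at[OF in_U[OF u]])
  have GN: "\<And>v. v \<in> B \<Longrightarrow> Grad F v \<bullet> N v = 0" by (rule Grad_inner(3)[OF in_U])
  define a1 a2 g1 g2 where "a1 = comp1 w u" "a2 = comp2 w u" "g1 = comp1 (Grad F) u" "g2 = comp2 (Grad F) u"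
  note defs = a1_a2_g1_g2_def
  have wE: "w u = a1 *\<^sub>R pd 1 \<phi> u + a2 *\<^sub>R pd 2 \<phi> u" unfolding defs by (rule comp_expansion[where X = w, OF u wN[OF u]])
  have GE: "Grad F u = g1 *\<^sub>R pd 1 \<phi> u + g2 *\<^sub>R pd 2 \<phi> u" unfolding defs by (rule comp_expansion[where X = "Grad F", OF u GN[OF u]])
  define c1 c2 where "c1 = a1 * pd 1 (comp1 (Grad F)) u + a2 * pd 2 (comp1 (Grad F)) u - (g1 * pd 1 (comp1 w) u + g2 * pd 2 (comp1 w) u)"
    "c2 = a1 * pd 1 (comp2 (Grad F)) u + a2 * pd 2 (comp2 (Grad F)) u - (g1 * pd 1 (comp2 w) u + g2 * pd 2 (comp2 w) u)"
  note cdefs = c1_c2_def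
  define V where "V = c1 *\<^sub>R pd 1 \<phi> u + c2 *\<^sub>R pd 2 \<phi> u"
  have exG: "pd i (Grad F) u = pd i (comp1 (Grad F)) u *\<^sub>R pd 1 \<phi> u + pd i (comp2 (Grad F)) u *\<^sub>R pd 2 \<phi> u +
      (comp1 (Grad F) u *\<^sub>R pd i (pd 1 \<phi>) u + comp2 (Grad F) u *\<^sub>R pd i (pd 2 \<phi>) u)" for i
    by (rule pd_comp_expansion[OF sGB GN u])
  have exw: "pd i w u = pd i (comp1 w) u *\<^sub>R pd 1 \<phi> u + pd i (comp2 w) u *\<^sub>R pd 2 \<phi> u +
      (comp1 w u *\<^sub>R pd i (pd 1 \<phi>) u + comp2 w u *\<^sub>R pd i (pd 2 \<phi>) u)" for i
    by (rule pd_comp_expansion[OF sw wN u])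
  have V: "V = (a1 *\<^sub>R pd 1 (Grad F) u + a2 *\<^sub>R pd 2 (Grad F) u) - (g1 *\<^sub>R pd 1 w u + g2 *\<^sub>R pd 2 w u)"
    unfolding V_def cdefs exG[of 1] exG[of 2] exw[of 1] exw[of 2] phi_comm[OF u] defs[symmetric]
    by (simp add: algebra_simps)
  have Vk: "V \<bullet> pd k \<phi> u = 0" for k
  proof -
    have 1: "(a1 *\<^sub>R pd 1 (Grad F) u + a2 *\<^sub>R pd 2 (Grad F) u) \<bullet> pd k \<phi> u = w u \<bullet> pd k (Grad F) u"
      unfolding wE inner_add_left inner_scaleR_left hess_sym[OF u, of 1 k] hess_sym[OF u, of 2 k]
      by (simp add: inner_commute)
    have 2: "(g1 *\<^sub>R pd 1 w u + g2 *\<^sub>R pd 2 w u) \<bullet> pd k \<phi> u = - (pd k w u \<bullet> Grad F u)"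
      unfolding GE by (simp add: inner_add_left inner_add_right killing_skew[OF u, of _ k])
    show ?thesis unfolding V inner_diff_left 1 2 using inv_deriv[OF u, of k] by simp
  qed
  have "V \<bullet> N u = 0" unfolding V_def using f.pN f.qN by (simp add: inner_add_left)
  then have "V = 0" using Vk by (intro f.tangent_zero)
  then have "cross3 V (pd 2 \<phi> u) \<bullet> N u = 0" "cross3 (pd 1 \<phi> u) V \<bullet> N u = 0" by simp_all
  then have "c1 * D u = 0" "c2 * D u = 0"
    unfolding V_def by (simp_all add: cross3_linear f.D_eq)
  then have c: "c1 = 0" "c2 = 0" using f.D by simp_all
  show "comp1 w u * pd 1 (comp1 (Grad F)) u + comp2 w u * pd 2 (comp1 (Grad F)) u
       = comp1 (Grad F) u * pd 1 (comp1 w) u + comp2 (Grad F) u * pd 2 (comp1 w) u"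
    using c(1) unfolding cdefs defs by simp
  show "comp1 w u * pd 1 (comp2 (Grad F)) u + comp2 w u * pd 2 (comp2 (Grad F)) u
       = comp1 (Grad F) u * pd 1 (comp2 w) u + comp2 (Grad F) u * pd 2 (comp2 w) u"
    using c(2) unfolding cdefs defs by simp
qed

lemma w_Grad_Lap:
  assumes u: "u \<in> B" shows "w u \<bullet> Grad (Lap F) u = 0"
proof -
  have GN: "\<And>v. v \<in> B \<Longrightarrow> Grad F v \<bullet> N v = 0" by (rule Grad_inner(3)[OF in_U])
  have "comp1 w u * pd 1 (Lap F) u + comp2 w u * pd 2 (Lap F) u = 0"
  proof (rule divergence_invariant[OF B(1) u smooth_comp(1)[OF sw] smooth_comp(2)[OF sw] smooth_comp(1)[OF sGB] smooth_comp(2)[OF sGB]])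
    show "smooth_on B (\<lambda>v. pd 1 D v / D v)" "smooth_on B (\<lambda>v. pd 2 D v / D v)"
      by (intro smooth_intros sDB D_nonzero in_U; assumption)+
    show "Lap F v = pd 1 (comp1 (Grad F)) v + pd 2 (comp2 (Grad F)) v +
        (comp1 (Grad F) v * (pd 1 D v / D v) + comp2 (Grad F) v * (pd 2 D v / D v))" if "v \<in> B" for v
      unfolding Lap_def by (rule pd_D_comp[where X = "Grad F", OF sGB GN that])
    show "pd 1 (comp1 w) v + pd 2 (comp2 w) v + (comp1 w v * (pd 1 D v / D v) + comp2 w v * (pd 2 D v / D v)) = 0"
      if v: "v \<in> B" for v
    proof -
      interpret f: frame "pd 1 \<phi> v" "pd 2 \<phi> v" "N v" "D v" by (rule frame_at[OF in_U[OF v]])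
      let ?p = "pd 1 \<phi> v" and ?q = "pd 2 \<phi> v"
      have "cross3 (pd 1 w v) ?q \<bullet> N v = - \<tau> v * (cross3 (N v) ?p \<bullet> cross3 (N v) ?q)"
        using cross3_triple_cyclic(2)[of "cross3 (N v) ?p" ?q "N v"] cross_skew[of ?q "N v"]
        by (simp add: pd_w[OF v] cross3_linear inner_diff_left dot_cross_self)
      moreover have "cross3 ?p (N v) \<bullet> N v = 0" by (simp add: dot_cross_self)
      then have "cross3 ?p (pd 2 w v) \<bullet> N v = \<tau> v * (cross3 (N v) ?p \<bullet> cross3 (N v) ?q)"
        using cross3_triple_cyclic[of "N v" ?p "cross3 (N v) ?q"]
        by (simp add: pd_w[OF v] cross3_linear inner_diff_left inner_commute[of "cross3 (N v) (pd 2 \<phi> v)"])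
      ultimately have "(cross3 (pd 1 w v) ?q + cross3 ?p (pd 2 w v)) \<bullet> N v / D v = 0"
        by (simp add: inner_add_left)
      moreover have "(cross3 (pd 1 w v) ?q + cross3 ?p (pd 2 w v)) \<bullet> N v / D v =
          pd 1 (comp1 w) v + pd 2 (comp2 w) v + (comp1 w v * (pd 1 D v / D v) + comp2 w v * (pd 2 D v / D v))"
        by (rule pd_D_comp[OF sw wN v])
      ultimately show ?thesis by linarith
    qed
    show "pd 1 (\<lambda>v. pd 2 D v / D v) u = pd 2 (\<lambda>v. pd 1 D v / D v) u"
    proof -
      have i: "(\<lambda>v. inverse (D v)) differentiable (at u)"
        by (rule smooth_on_differentiable[OF smooth_on_inverse[OF sDB] u]) (rule D_nonzero[OF in_U])
      have dd: "pd j D differentiable (at u)" for j by (rule smooth_on_differentiable[OF smooth_on_pd[OF sDB] u])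
      have inv: "pd j (\<lambda>v. inverse (D v)) u = - (inverse (D u) * pd j D u * inverse (D u))" for j
        using pd_unique[OF Deriv.has_derivative_inverse[OF D_nonzero[OF in_U[OF u]] smooth_on_has_derivative[OF sDB u]], of j]
        by (simp add: pd_def)
      have "pd 1 (pd 2 D) u = pd 2 (pd 1 D) u" by (rule pd_commute[OF sDB u])
      then show ?thesis unfolding divide_inverse pd_mult[OF dd i] inv by simp
    qed
  qed (rule bracket_zero; assumption)+
  moreover have "w u \<bullet> Grad (Lap F) u = comp1 w u * pd 1 (Lap F) u + comp2 w u * pd 2 (Lap F) u"
    by (subst comp_expansion[where X = w, OF u wN[OF u]])
      (simp add: inner_add_left inner_commute[of "pd _ \<phi> u" "Grad _ u"] Grad_inner[OF in_U[OF u]])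
  ultimately show ?thesis by simp
qed

end

end

context killing_chart
begin

lemma vanishing_on_convex:
  assumes cB: "convex B" and u0: "u0 \<in> B" "w u0 = 0" "\<tau> u0 = 0" and u: "u \<in> B"
  shows "w u = 0"
proof -
  define E where "E v = w v \<bullet> w v + \<tau> v * \<tau> v" for v
  have sE: "smooth_on B E" unfolding E_def[abs_def] by (intro smooth_intros sw s\<tau>)
  define h where "h = u - u0"
  define r where "r t = u0 + t *\<^sub>R h" for t :: real
  have rB: "r t \<in> B" if "t \<in> {0..1}" for t
  proof -
    have "r t = (1 - t) *\<^sub>R u0 + t *\<^sub>R u" by (simp add: r_def h_def algebra_simps)
    then show ?thesis using convexD_alt[OF cB u0(1) u, of t] that by simp
  qed
  define P where "P v = h $ 1 *\<^sub>R pd 1 \<phi> v + h $ 2 *\<^sub>R pd 2 \<phi> v" for v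
  define c where "c v = norm (cross3 (N v) (P v)) * \<bar>1 - K v\<bar>" for v
  have pdE: "pd j E v = 2 * \<tau> v * (w v \<bullet> cross3 (N v) (pd j \<phi> v)) * (1 - K v)" if v: "v \<in> B" for v j
  proof -
    have d: "(\<lambda>v. w v \<bullet> w v) differentiable (at v)" "(\<lambda>v. \<tau> v * \<tau> v) differentiable (at v)"
      by (rule smooth_on_differentiable[OF _ v]; intro smooth_intros sw s\<tau>)+
    have Nw: "N v \<bullet> w v = 0" using wN[OF v] by (simp add: inner_commute)
    have "pd j E v = 2 * (pd j w v \<bullet> w v) + 2 * \<tau> v * pd j \<tau> v"
      unfolding E_def[abs_def] pd_add[OF d] pd_inner[OF dB(1)[OF v] dB(1)[OF v]] pd_mult[OF dB(2)[OF v] dB(2)[OF v]]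
      by (simp add: inner_commute)
    also have "pd j w v \<bullet> w v = \<tau> v * (w v \<bullet> cross3 (N v) (pd j \<phi> v))"
      unfolding pd_w[OF v] by (simp add: inner_diff_left Nw inner_commute[of "w v"])
    finally show ?thesis unfolding pd_tau[OF v] by (simp add: algebra_simps)
  qed
  have dr: "((\<lambda>t. E (r t)) has_real_derivative 2 * \<tau> (r t) * (w (r t) \<bullet> cross3 (N (r t)) (P (r t))) * (1 - K (r t))) (at t)"
    if "t \<in> {0..1}" for t
  proof -
    have 1: "(r has_derivative (\<lambda>s. s *\<^sub>R h)) (at t)"
      unfolding r_def[abs_def] by (auto intro!: derivative_eq_intros)
    have "((\<lambda>t. E (r t)) has_derivative (\<lambda>s. \<Sum>j\<in>UNIV. (s *\<^sub>R h) $ j *\<^sub>R pd j E (r t))) (at t)"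
      by (rule has_derivative_compose[OF 1 has_derivative_sum_pd[OF smooth_on_differentiable[OF sE rB[OF that]]]])
    then show ?thesis
      unfolding has_field_derivative_def sum_2 pdE[OF rB[OF that]] P_def
      by (rule has_derivative_eq_rhs) (simp add: fun_eq_iff cross3_linear inner_add_right algebra_simps)
  qed
  have "continuous_on {0..1} (\<lambda>t. c (r t))"
  proof (rule continuous_on_compose2[of B c])
    show "continuous_on B c"
      unfolding c_def[abs_def] P_def
      by (intro continuous_on_mult continuous_on_norm continuous_on_rabs smooth_on_continuous_on smooth_intros sNB s\<phi>B sKB B)
    show "continuous_on {0..1} r" unfolding r_def[abs_def] by (intro continuous_intros)
  qed (use rB in blast)
  then have "compact ((\<lambda>t. c (r t)) ` {0..1})" by (rule compact_continuous_image) simp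
  then have "bounded ((\<lambda>t. c (r t)) ` {0..1})" by (rule compact_imp_bounded)
  then obtain C where C': "\<forall>x\<in>(\<lambda>t. c (r t)) ` {0..1}. norm x \<le> C" unfolding bounded_iff by (elim exE)
  have C: "c (r t) \<le> C" if "t \<in> {0..1}" for t
    using bspec[OF C' imageI[OF that]] by simp
  let ?f = "\<lambda>t. E (r t) * exp (- C * t)"
  have "?f 1 \<le> ?f 0"
  proof (rule DERIV_nonpos_imp_nonincreasing[where f = ?f])
    fix t :: real assume t: "0 \<le> t" "t \<le> 1"
    then have ti: "t \<in> {0..1}" by simp
    let ?d = "2 * \<tau> (r t) * (w (r t) \<bullet> cross3 (N (r t)) (P (r t))) * (1 - K (r t))"
    have "\<bar>w (r t) \<bullet> cross3 (N (r t)) (P (r t))\<bar> \<le> norm (w (r t)) * norm (cross3 (N (r t)) (P (r t)))"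
      by (rule Cauchy_Schwarz_ineq2)
    then have "2 * \<bar>\<tau> (r t)\<bar> * \<bar>w (r t) \<bullet> cross3 (N (r t)) (P (r t))\<bar> * \<bar>1 - K (r t)\<bar> \<le>
        2 * \<bar>\<tau> (r t)\<bar> * (norm (w (r t)) * norm (cross3 (N (r t)) (P (r t)))) * \<bar>1 - K (r t)\<bar>"
      by (intro mult_right_mono mult_left_mono) auto
    then have "\<bar>?d\<bar> \<le> 2 * \<bar>\<tau> (r t)\<bar> * (norm (w (r t)) * norm (cross3 (N (r t)) (P (r t)))) * \<bar>1 - K (r t)\<bar>"
      by (simp only: abs_mult abs_numeral)
    also have "\<dots> = (2 * \<bar>\<tau> (r t)\<bar> * norm (w (r t))) * c (r t)" by (simp add: c_def)
    also have "\<dots> \<le> E (r t) * C"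
    proof (rule mult_mono)
      have "0 \<le> (\<bar>\<tau> (r t)\<bar> - norm (w (r t)))\<^sup>2" by simp
      also have "\<dots> = E (r t) - 2 * \<bar>\<tau> (r t)\<bar> * norm (w (r t))"
        by (simp add: E_def power2_diff power2_norm_eq_inner) (simp add: power2_eq_square)
      finally show "2 * \<bar>\<tau> (r t)\<bar> * norm (w (r t)) \<le> E (r t)" by simp
    qed (use C[OF ti] in \<open>auto simp: E_def c_def\<close>)
    finally have le: "?d \<le> E (r t) * C" by linarith
    have "(?f has_real_derivative (?d * exp (- C * t) + E (r t) * (exp (- C * t) * (- C)))) (at t)"
      by (rule DERIV_mult'[THEN DERIV_cong, OF dr[OF ti]]) (auto intro!: derivative_eq_intros)
    moreover have "?d * exp (- C * t) + E (r t) * (exp (- C * t) * (- C)) = (?d - E (r t) * C) * exp (- C * t)"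
      by (simp add: algebra_simps)
    moreover have "(?d - E (r t) * C) * exp (- C * t) \<le> 0"
      using le by (intro mult_nonpos_nonneg) auto
    ultimately show "\<exists>y. (?f has_real_derivative y) (at t) \<and> y \<le> 0" by metis
  qed simp
  moreover have "r 0 = u0" "r 1 = u" by (simp_all add: r_def h_def)
  ultimately have "E u * exp (- C) \<le> 0" using u0 by (simp add: E_def)
  then have "E u \<le> 0" by (simp add: mult_le_0_iff)
  then have "w u \<bullet> w u \<le> 0" unfolding E_def using zero_le_square[of "\<tau> u"] by linarith
  then have "w u \<bullet> w u = 0" using inner_ge_zero[of "w u"] by linarith
  then show ?thesis by simp
qed

lemma vanishing_tau:
  assumes V: "open V" "V \<subseteq> B" "\<And>v. v \<in> V \<Longrightarrow> w v = 0" and u: "u \<in> V" shows "\<tau> u = 0"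
proof -
  have uB: "u \<in> B" using u V(2) by blast
  interpret f: frame "pd 1 \<phi> u" "pd 2 \<phi> u" "N u" "D u" by (rule frame_at[OF in_U[OF uB]])
  have "pd 1 w u = pd 1 (\<lambda>v. 0) u" by (rule pd_cong[OF V(1) u V(3) dB(1)[OF uB]])
  then have "\<tau> u *\<^sub>R cross3 (N u) (pd 1 \<phi> u) = 0" using V(3)[OF u] by (simp add: pd_w[OF uB])
  moreover have "cross3 (N u) (pd 1 \<phi> u) \<noteq> 0" using f.rot_simps(1) f.D by force
  ultimately show ?thesis by simp
qed

end

lemma killing_chart_lincomb:
  assumes "killing_chart M n U \<phi> B w \<tau>" "killing_chart M n U \<phi> B w' \<tau>'"
  shows "killing_chart M n U \<phi> B (\<lambda>u. c *\<^sub>R w u + c' *\<^sub>R w' u) (\<lambda>u. c * \<tau> u + c' * \<tau>' u)"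
proof -
  interpret k: killing_chart M n U \<phi> B w \<tau> by (rule assms(1))
  interpret k': killing_chart M n U \<phi> B w' \<tau>' by (rule assms(2))
  note oB = k.B(1)
  show ?thesis
  proof unfold_locales
    show "smooth_on B (\<lambda>u. c *\<^sub>R w u + c' *\<^sub>R w' u)" "smooth_on B (\<lambda>u. c * \<tau> u + c' * \<tau>' u)"
      by (intro smooth_intros k.sw k'.sw k.s\<tau> k'.s\<tau> oB)+
    fix u assume u: "u \<in> B"
    show "(c *\<^sub>R w u + c' *\<^sub>R w' u) \<bullet> k.N u = 0"
      using k.wN[OF u] k'.wN[OF u] by (simp add: inner_add_left)
    have "pd j (\<lambda>u. c *\<^sub>R w u + c' *\<^sub>R w' u) u = c *\<^sub>R pd j w u + c' *\<^sub>R pd j w' u" for j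
    proof -
      have "pd j (\<lambda>u. c *\<^sub>R w u) u = c *\<^sub>R pd j w u" "pd j (\<lambda>u. c' *\<^sub>R w' u) u = c' *\<^sub>R pd j w' u"
        by (intro pd_bounded_linear[OF bounded_linear_scaleR_right] k.dB(1)[OF u] k'.dB(1)[OF u])+
      moreover have "(\<lambda>u. c *\<^sub>R w u) differentiable (at u)" "(\<lambda>u. c' *\<^sub>R w' u) differentiable (at u)"
        by (rule smooth_on_differentiable[OF _ u]; intro smooth_intros k.sw k'.sw oB)+
      ultimately show ?thesis by (simp add: pd_add)
    qed
    then show "pd j (\<lambda>u. c *\<^sub>R w u + c' *\<^sub>R w' u) u = (c * \<tau> u + c' * \<tau>' u) *\<^sub>R cross3 (k.N u) (pd j \<phi> u) -
        ((c *\<^sub>R w u + c' *\<^sub>R w' u) \<bullet> pd j k.N u) *\<^sub>R k.N u" for j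
      by (simp add: k.pd_w[OF u] k'.pd_w[OF u] inner_add_left algebra_simps)
  qed (use k.B in auto)
qed

section \<open>Weak Killing fields are smooth\<close>

lemma locint_cong: "locint U f \<Longrightarrow> (\<And>u. u \<in> U \<Longrightarrow> f u = g u) \<Longrightarrow> locint U g"
  unfolding locint_def set_integrable_def
proof (intro allI impI)
  fix K assume f: "\<forall>K. compact K \<and> K \<subseteq> U \<longrightarrow> integrable lborel (\<lambda>x. indicat_real K x *\<^sub>R f x)"
    and eq: "\<And>u. u \<in> U \<Longrightarrow> f u = g u" and K: "compact K \<and> K \<subseteq> U"
  have "(\<lambda>x. indicat_real K x *\<^sub>R f x) = (\<lambda>x. indicat_real K x *\<^sub>R g x)"
  proof
    show "indicat_real K x *\<^sub>R f x = indicat_real K x *\<^sub>R g x" for x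
      using eq[of x] K by (cases "x \<in> K") auto
  qed
  then show "integrable lborel (\<lambda>x. indicat_real K x *\<^sub>R g x)" using f K by metis
qed

lemma wk_cong:
  assumes "wk U j f g" "\<And>u. u \<in> U \<Longrightarrow> f u = f' u" "\<And>u. u \<in> U \<Longrightarrow> g u = g' u"
  shows "wk U j f' g'"
  by (rule wk_cong_AE[OF assms(1) locint_cong[OF wkD(1)[OF assms(1)] assms(2)] locint_cong[OF wkD(2)[OF assms(1)] assms(3)]])
    (simp_all add: assms)

lemma weak_pd_component:
  assumes "weak_pd U j f g"
  shows "wk U j (\<lambda>u. f u $ i) (\<lambda>u. g u $ i)"
proof -
  have loc: "locint U (\<lambda>u. h u $ i)" if "loc_integrable U h" for h :: "real^2 \<Rightarrow> real^3" and i
    unfolding locint_def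
  proof (intro allI impI)
    fix K assume "compact K \<and> K \<subseteq> U"
    then have "integrable lborel (\<lambda>u. indicator K u *\<^sub>R h u)"
      using that unfolding loc_integrable_def set_integrable_def by blast
    then have "integrable lborel (\<lambda>u. (indicator K u *\<^sub>R h u) $ i)"
      by (rule integrable_bounded_linear[OF bounded_linear_vec_nth])
    then show "set_integrable lborel K (\<lambda>u. h u $ i)" by (simp add: set_integrable_def)
  qed
  have comp: "(LINT u:U|lborel. \<theta> u *\<^sub>R h u) $ i = (LINT u|lborel. \<theta> u * h u $ i)"
    if t: "test_function U \<theta>" and h: "loc_integrable U h" for h :: "real^2 \<Rightarrow> real^3" and \<theta>
  proof -
    obtain K where K: "compact K" "K \<subseteq> U" "\<And>u. u \<notin> K \<Longrightarrow> \<theta> u = 0" by (rule test_functionE[OF t]) blast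
    have eq: "(\<lambda>u. indicator U u *\<^sub>R (\<theta> u *\<^sub>R h u)) = (\<lambda>u. \<Sum>k\<in>UNIV. (\<theta> u * h u $ k) *\<^sub>R axis k 1)"
    proof
      fix u
      have "indicator U u *\<^sub>R (\<theta> u *\<^sub>R h u) = \<theta> u *\<^sub>R h u" using K(2,3) by (cases "u \<in> K") (auto simp: indicator_def)
      also have "\<dots> = (\<Sum>k\<in>UNIV. (\<theta> u *\<^sub>R h u) $ k *s axis k 1)" by (rule basis_expansion[symmetric])
      finally show "indicator U u *\<^sub>R (\<theta> u *\<^sub>R h u) = (\<Sum>k\<in>UNIV. (\<theta> u * h u $ k) *\<^sub>R axis k 1)"
        by (simp add: scalar_mult_eq_scaleR)
    qed
    have "integrable lborel (\<lambda>u. \<Sum>k\<in>UNIV. (\<theta> u * h u $ k) *\<^sub>R (axis k 1 :: real^3))"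
      by (intro Bochner_Integration.integrable_sum integrable_scaleR_left test_integrable[OF t loc[OF h]])
    then have "integrable lborel (\<lambda>u. indicator U u *\<^sub>R (\<theta> u *\<^sub>R h u))" unfolding eq .
    from integral_bounded_linear[OF bounded_linear_vec_nth this, of i]
    have "(LINT u:U|lborel. \<theta> u *\<^sub>R h u) $ i = (LINT u|lborel. (indicator U u *\<^sub>R (\<theta> u *\<^sub>R h u)) $ i)"
      by (simp add: set_lebesgue_integral_def)
    also have "\<dots> = (LINT u|lborel. \<theta> u * h u $ i)"
    proof (rule Bochner_Integration.integral_cong[OF refl])
      show "(indicator U u *\<^sub>R (\<theta> u *\<^sub>R h u)) $ i = \<theta> u * h u $ i" for u
        using K(2,3) by (cases "u \<in> K") (auto simp: indicator_def)
    qed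
    finally show ?thesis .
  qed
  have w: "loc_integrable U f" "loc_integrable U g"
    and i: "\<And>\<psi>. test_function U \<psi> \<Longrightarrow> (LINT u:U|lborel. pd j \<psi> u *\<^sub>R f u) = - (LINT u:U|lborel. \<psi> u *\<^sub>R g u)"
    using assms unfolding weak_pd_def by blast+
  show ?thesis
    unfolding wk_def
  proof (intro conjI loc w allI impI)
    fix \<psi> assume t: "test_function U \<psi>"
    show "(LINT u|lborel. pd j \<psi> u * f u $ i) = - (LINT u|lborel. \<psi> u * g u $ i)"
      unfolding comp[OF test_pd[OF t] w(1), symmetric] comp[OF t w(2), symmetric] i[OF t] by simp
  qed
qed

lemma locint_inner:
  fixes f :: "real^2 \<Rightarrow> real^3"
  assumes "continuous_on U T" "\<And>i. locint U (\<lambda>u. f u $ i)"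
  shows "locint U (\<lambda>u. T u \<bullet> f u)"
proof -
  have "locint U (\<lambda>u. \<Sum>i\<in>UNIV. T u $ i * f u $ i)"
    using assms by (intro locint_sum locint_mult continuous_intros)
  then show ?thesis by (simp add: inner_vec_def)
qed

lemma wk_inner:
  fixes f g :: "real^2 \<Rightarrow> real^3"
  assumes "\<And>i. wk U j (\<lambda>u. f u $ i) (\<lambda>u. g u $ i)" "smooth_on U T"
  shows "wk U j (\<lambda>u. T u \<bullet> f u) (\<lambda>u. T u \<bullet> g u + pd j T u \<bullet> f u)"
proof -
  have "wk U j (\<lambda>u. \<Sum>i\<in>UNIV. T u $ i * f u $ i)
      (\<lambda>u. \<Sum>i\<in>UNIV. T u $ i * g u $ i + pd j (\<lambda>u. T u $ i) u * f u $ i)"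
    by (intro wk_sum wk_mult_smooth assms smooth_on_vec_nth)
  then show ?thesis
    by (rule wk_cong)
      (simp_all add: inner_vec_def pd_vec_nth[OF smooth_on_differentiable[OF assms(2)]] sum.distrib)
qed

text \<open>Both weak derivatives of f are tested with the mixed second derivative of \<open>\<psi> T\<close>, which is symmetric.\<close>

lemma wk_curl:
  fixes f g1 g2 T :: "real^2 \<Rightarrow> real^3"
  assumes f1: "\<And>i. wk U 1 (\<lambda>u. f u $ i) (\<lambda>u. g1 u $ i)" and f2: "\<And>i. wk U 2 (\<lambda>u. f u $ i) (\<lambda>u. g2 u $ i)"
    and T: "smooth_on U T" and t: "test_function U \<psi>"
  shows "(LINT u|lborel. pd 2 \<psi> u * (T u \<bullet> g1 u)) - (LINT u|lborel. pd 1 \<psi> u * (T u \<bullet> g2 u)) =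
    - (LINT u|lborel. \<psi> u * (pd 2 T u \<bullet> g1 u - pd 1 T u \<bullet> g2 u))"
proof -
  note cT = smooth_on_continuous_on
  note sT = smooth_on_pd[OF T, of 1] smooth_on_pd[OF T, of 2]
  have lf: "locint U (\<lambda>u. S u \<bullet> f u)" "locint U (\<lambda>u. S u \<bullet> g1 u)" "locint U (\<lambda>u. S u \<bullet> g2 u)" if "smooth_on U S" for S
    using wkD[OF f1] wkD[OF f2] by (intro locint_inner cT[OF that]; blast)+
  have int: "integrable lborel (\<lambda>u. \<theta> u * (S u \<bullet> f u))" "integrable lborel (\<lambda>u. \<theta> u * (S u \<bullet> g1 u))"
    "integrable lborel (\<lambda>u. \<theta> u * (S u \<bullet> g2 u))" if "test_function U \<theta>" "smooth_on U S" for \<theta> S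
    by (intro test_integrable[OF that(1)] lf[OF that(2)])+
  have comm: "pd 1 (pd 2 \<psi>) u = pd 2 (pd 1 \<psi>) u" for u
    by (rule pd_commute[OF test_smooth[OF t] UNIV_I])
  have "(LINT u|lborel. pd 1 (pd 2 \<psi>) u * (T u \<bullet> f u)) = - (LINT u|lborel. pd 2 \<psi> u * (T u \<bullet> g1 u + pd 1 T u \<bullet> f u))"
    by (rule wkD(3)[OF wk_inner[OF f1 T] test_pd[OF t]])
  moreover have "(LINT u|lborel. pd 2 (pd 1 \<psi>) u * (T u \<bullet> f u)) = - (LINT u|lborel. pd 1 \<psi> u * (T u \<bullet> g2 u + pd 2 T u \<bullet> f u))"
    by (rule wkD(3)[OF wk_inner[OF f2 T] test_pd[OF t]])
  ultimately have A: "(LINT u|lborel. pd 2 \<psi> u * (T u \<bullet> g1 u)) + (LINT u|lborel. pd 2 \<psi> u * (pd 1 T u \<bullet> f u)) =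
      (LINT u|lborel. pd 1 \<psi> u * (T u \<bullet> g2 u)) + (LINT u|lborel. pd 1 \<psi> u * (pd 2 T u \<bullet> f u))"
    unfolding comm using int[OF test_pd[OF t] T] int[OF test_pd[OF t] sT(1)] int[OF test_pd[OF t] sT(2)]
    by (simp add: distrib_left)
  have B1: "(LINT u|lborel. pd 2 \<psi> u * (pd 1 T u \<bullet> f u)) = - (LINT u|lborel. \<psi> u * (pd 1 T u \<bullet> g2 u + pd 2 (pd 1 T) u \<bullet> f u))"
    by (rule wkD(3)[OF wk_inner[OF f2 sT(1)] t])
  have B2: "(LINT u|lborel. pd 1 \<psi> u * (pd 2 T u \<bullet> f u)) = - (LINT u|lborel. \<psi> u * (pd 2 T u \<bullet> g1 u + pd 1 (pd 2 T) u \<bullet> f u))"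
    by (rule wkD(3)[OF wk_inner[OF f1 sT(2)] t])
  have c: "(LINT u|lborel. \<psi> u * (pd 2 (pd 1 T) u \<bullet> f u)) = (LINT u|lborel. \<psi> u * (pd 1 (pd 2 T) u \<bullet> f u))"
  proof (rule Bochner_Integration.integral_cong[OF refl])
    obtain K where K: "compact K" "K \<subseteq> U" "\<And>u. u \<notin> K \<Longrightarrow> \<psi> u = 0" by (rule test_functionE[OF t]) blast
    show "\<psi> u * (pd 2 (pd 1 T) u \<bullet> f u) = \<psi> u * (pd 1 (pd 2 T) u \<bullet> f u)" for u
      using pd_commute[OF T, of u 2 1] K(2,3) by (cases "u \<in> K") auto
  qed
  show ?thesis
    using A B1 B2 c int[OF t sT(1)] int[OF t sT(2)] int[OF t smooth_on_pd[OF sT(1)]] int[OF t smooth_on_pd[OF sT(2)]]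
    by (simp add: distrib_left right_diff_distrib)
qed

lemma sum_UNIV_option:
  fixes f :: "'a::finite option \<Rightarrow> 'b::comm_monoid_add"
  shows "(\<Sum>q\<in>UNIV. f q) = f None + (\<Sum>k\<in>UNIV. f (Some k))"
proof -
  have "(\<Sum>q\<in>UNIV. f q) = f None + (\<Sum>q\<in>range Some. f q)"
    unfolding UNIV_option_conv by (rule sum.insert) auto
  also have "(\<Sum>q\<in>range Some. f q) = (\<Sum>k\<in>UNIV. f (Some k))" by (simp add: sum.reindex)
  finally show ?thesis .
qed

context chart
begin

lemma kf_weak_equations:
  assumes W: "W \<in> H1_kf M \<Omega>" and \<Omega>: "\<phi> ` U \<subseteq> \<Omega>"
  shows "\<exists>V1 V2. weak_pd U 1 (\<lambda>u. W (\<phi> u)) V1 \<and> weak_pd U 2 (\<lambda>u. W (\<phi> u)) V2 \<and>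
    (AE u in lborel. u \<in> U \<longrightarrow>
      V1 u = ((pd 2 \<phi> u \<bullet> V1 u) / D u) *\<^sub>R cross3 (N u) (pd 1 \<phi> u) - (W (\<phi> u) \<bullet> pd 1 N u) *\<^sub>R N u \<and>
      V2 u = ((pd 2 \<phi> u \<bullet> V1 u) / D u) *\<^sub>R cross3 (N u) (pd 2 \<phi> u) - (W (\<phi> u) \<bullet> pd 2 N u) *\<^sub>R N u)"
proof -
  have WH: "W \<in> H1 M \<Omega>" using W by (simp add: H1_kf_def)
  have Wt: "W (\<phi> u) \<bullet> N u = 0" if "u \<in> U" for u
    using WH \<Omega> that tangent_orthogonal[OF that] unfolding H1_def L2_fields_def by blast
  obtain A where A: "H1_deriv M \<Omega> W A"
    "AE x in area_measure M. x \<in> \<Omega> \<longrightarrow> (\<forall>X\<in>tangent_space M x. \<forall>Y\<in>tangent_space M x. A x Y \<bullet> X + A x X \<bullet> Y = 0)"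
    using W unfolding H1_kf_def by blast
  have wc: "weak_cov_deriv M \<Omega> W A" using A(1) by (simp add: H1_deriv_def)
  have "\<forall>j. \<exists>V. weak_pd U j (W \<circ> \<phi>) V \<and>
           (AE u in lborel. u \<in> U \<longrightarrow> A (\<phi> u) (pd j \<phi> u) = tan_proj M (\<phi> u) (V u))"
    using wc lp \<Omega> unfolding weak_cov_deriv_def by blast
  from choice[OF this] obtain V where V': "\<forall>j. weak_pd U j (W \<circ> \<phi>) (V j) \<and>
           (AE u in lborel. u \<in> U \<longrightarrow> A (\<phi> u) (pd j \<phi> u) = tan_proj M (\<phi> u) (V j u))" by (elim exE)
  have V: "weak_pd U j (\<lambda>u. W (\<phi> u)) (V j)"
    "AE u in lborel. u \<in> U \<longrightarrow> A (\<phi> u) (pd j \<phi> u) = tan_proj M (\<phi> u) (V j u)" for j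
    using spec[OF V', of j] unfolding comp_def by simp_all
  have normal: "AE u in lborel. u \<in> U \<longrightarrow> N u \<bullet> V j u + pd j N u \<bullet> W (\<phi> u) = 0" for j
  proof (rule AE_zero_of_bump_integrals[OF open_U])
    have wk: "wk U j (\<lambda>u. N u \<bullet> W (\<phi> u)) (\<lambda>u. N u \<bullet> V j u + pd j N u \<bullet> W (\<phi> u))"
      by (rule wk_inner[OF weak_pd_component[OF V(1)] smooth_N])
    then show "locint U (\<lambda>u. N u \<bullet> V j u + pd j N u \<bullet> W (\<phi> u))" by (rule wkD(2))
    fix m :: real and a b assume "m > 0" "cbox a b \<subseteq> U"
    then have t: "test_function U (bump2 m a b)" by (rule test_bump2)
    obtain K where K: "compact K" "K \<subseteq> U" "\<And>u. u \<notin> K \<Longrightarrow> bump2 m a b u = 0" by (rule test_functionE[OF t]) blast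
    have z: "pd j (bump2 m a b) u * (N u \<bullet> W (\<phi> u)) = 0" for u
      using Wt[of u] pd_zero_outside[OF K(1,3), where u = u and j = j] K(2)
      by (cases "u \<in> K") (auto simp: inner_commute)
    then show "(LINT u|lborel. bump2 m a b u * (N u \<bullet> V j u + pd j N u \<bullet> W (\<phi> u))) = 0"
      using wkD(3)[OF wk t] unfolding z Bochner_Integration.integral_zero by linarith
  qed
  have kill: "AE u in lborel. u \<in> U \<longrightarrow> (\<phi> u \<in> \<Omega> \<longrightarrow>
      (\<forall>X\<in>tangent_space M (\<phi> u). \<forall>Y\<in>tangent_space M (\<phi> u). A (\<phi> u) Y \<bullet> X + A (\<phi> u) X \<bullet> Y = 0))"
    by (rule AE_area_imp_AE_chart[OF lp A(2)])
  have "AE u in lborel. u \<in> U \<longrightarrow>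
      V 1 u = ((pd 2 \<phi> u \<bullet> V 1 u) / D u) *\<^sub>R cross3 (N u) (pd 1 \<phi> u) - (W (\<phi> u) \<bullet> pd 1 N u) *\<^sub>R N u \<and>
      V 2 u = ((pd 2 \<phi> u \<bullet> V 1 u) / D u) *\<^sub>R cross3 (N u) (pd 2 \<phi> u) - (W (\<phi> u) \<bullet> pd 2 N u) *\<^sub>R N u"
    using kill V(2)[of 1] V(2)[of 2] normal[of 1] normal[of 2]
  proof eventually_elim
    case (elim u)
    show ?case
    proof
      assume u: "u \<in> U"
      interpret f: frame "pd 1 \<phi> u" "pd 2 \<phi> u" "N u" "D u" by (rule frame_at[OF u])
      define B where "B j = A (\<phi> u) (pd j \<phi> u)" for j
      have \<phi>\<Omega>: "\<phi> u \<in> \<Omega>" using u \<Omega> by blast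
      have Bt: "B j \<bullet> N u = 0" for j
      proof -
        have "B j \<in> tangent_space M (\<phi> u)"
          using wc \<phi>\<Omega> tangent_pd[OF u] unfolding weak_cov_deriv_def B_def by blast
        then show ?thesis by (rule tangent_orthogonal[OF u])
      qed
      have sk: "B i \<bullet> pd j \<phi> u + B j \<bullet> pd i \<phi> u = 0" for i j
        using elim(1) u \<phi>\<Omega> tangent_pd[OF u] unfolding B_def by blast
      have BV: "B 1 = V 1 u - (V 1 u \<bullet> N u) *\<^sub>R N u" "B 2 = V 2 u - (V 2 u \<bullet> N u) *\<^sub>R N u"
        using elim(2,3) u unfolding B_def tan_proj_chart[OF u] by blast+
      have VN: "V 1 u \<bullet> N u = - (W (\<phi> u) \<bullet> pd 1 N u)" "V 2 u \<bullet> N u = - (W (\<phi> u) \<bullet> pd 2 N u)"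
        using elim(4,5) u by (simp_all add: inner_commute add_eq_0_iff)
      define t where "t = (pd 2 \<phi> u \<bullet> V 1 u) / D u"
      have Nq: "N u \<bullet> pd 2 \<phi> u = 0" using f.qN by (simp add: inner_commute)
      have tD: "t * D u = B 1 \<bullet> pd 2 \<phi> u"
        using f.D by (simp add: t_def BV inner_diff_left Nq inner_commute[of "pd 2 \<phi> u" "V 1 u"])
      have B1: "B 1 = t *\<^sub>R cross3 (N u) (pd 1 \<phi> u)"
        by (rule f.tangent_eqI) (use sk[of 1 1] tD in \<open>simp_all add: Bt f.rot_simps\<close>)
      have B2: "B 2 = t *\<^sub>R cross3 (N u) (pd 2 \<phi> u)"
        by (rule f.tangent_eqI) (use sk[of 2 2] sk[of 1 2] tD in \<open>simp_all add: Bt f.rot_simps\<close>)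
      have "V 1 u = B 1 + (V 1 u \<bullet> N u) *\<^sub>R N u" "V 2 u = B 2 + (V 2 u \<bullet> N u) *\<^sub>R N u"
        using BV by simp_all
      then have "V 1 u = t *\<^sub>R cross3 (N u) (pd 1 \<phi> u) - (W (\<phi> u) \<bullet> pd 1 N u) *\<^sub>R N u \<and>
          V 2 u = t *\<^sub>R cross3 (N u) (pd 2 \<phi> u) - (W (\<phi> u) \<bullet> pd 2 N u) *\<^sub>R N u"
        unfolding VN B1 B2 by simp
      then show "V 1 u = ((pd 2 \<phi> u \<bullet> V 1 u) / D u) *\<^sub>R cross3 (N u) (pd 1 \<phi> u) - (W (\<phi> u) \<bullet> pd 1 N u) *\<^sub>R N u \<and>
          V 2 u = ((pd 2 \<phi> u \<bullet> V 1 u) / D u) *\<^sub>R cross3 (N u) (pd 2 \<phi> u) - (W (\<phi> u) \<bullet> pd 2 N u) *\<^sub>R N u"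
        unfolding t_def .
    qed
  qed
  then show ?thesis using V(1) by blast
qed

theorem kf_smooth_representative:
  assumes W: "W \<in> H1_kf M \<Omega>" and \<Omega>: "\<phi> ` U \<subseteq> \<Omega>" and ab: "cbox a b \<subseteq> U"
  shows "\<exists>w \<tau>. killing_chart M n U \<phi> (box a b) w \<tau> \<and> (AE u in lborel. u \<in> box a b \<longrightarrow> W (\<phi> u) = w u)"
proof -
  obtain V1 V2 where V1: "weak_pd U 1 (\<lambda>u. W (\<phi> u)) V1" and V2: "weak_pd U 2 (\<lambda>u. W (\<phi> u)) V2" and
    eqs: "AE u in lborel. u \<in> U \<longrightarrow>
      V1 u = ((pd 2 \<phi> u \<bullet> V1 u) / D u) *\<^sub>R cross3 (N u) (pd 1 \<phi> u) - (W (\<phi> u) \<bullet> pd 1 N u) *\<^sub>R N u \<and>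
      V2 u = ((pd 2 \<phi> u \<bullet> V1 u) / D u) *\<^sub>R cross3 (N u) (pd 2 \<phi> u) - (W (\<phi> u) \<bullet> pd 2 N u) *\<^sub>R N u"
    using kf_weak_equations[OF W \<Omega>] by blast
  define t where "t u = (pd 2 \<phi> u \<bullet> V1 u) / D u" for u
  note w1 = weak_pd_component[OF V1] and w2 = weak_pd_component[OF V2]
  define T where "T j u = (1 / D u) *\<^sub>R pd j \<phi> u" for j u
  have sT: "smooth_on U (T j)" for j
    unfolding T_def[abs_def] by (intro smooth_intros smooth_D smooth_\<phi> open_U D_nonzero)
  note spT = smooth_on_pd[OF sT]
  have loc: "locint U (\<lambda>u. S u \<bullet> W (\<phi> u))" "locint U (\<lambda>u. S u \<bullet> V1 u)" "locint U (\<lambda>u. S u \<bullet> V2 u)" if "smooth_on U S" for S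
    using wkD[OF w1] wkD[OF w2] by (intro locint_inner smooth_on_continuous_on[OF that]; blast)+
  have t_T: "t u = T 2 u \<bullet> V1 u" for u by (simp add: t_def T_def)
  have loct: "locint U t" unfolding t_T[abs_def] by (rule loc[OF sT])
  have frame_dots: "T 1 u \<bullet> V1 u = 0 \<and> T 2 u \<bullet> V2 u = 0 \<and> T 1 u \<bullet> V2 u = - t u"
    if u: "u \<in> U" and e1: "V1 u = t u *\<^sub>R cross3 (N u) (pd 1 \<phi> u) - (W (\<phi> u) \<bullet> pd 1 N u) *\<^sub>R N u"
      and e2: "V2 u = t u *\<^sub>R cross3 (N u) (pd 2 \<phi> u) - (W (\<phi> u) \<bullet> pd 2 N u) *\<^sub>R N u" for u
  proof -
    interpret f: frame "pd 1 \<phi> u" "pd 2 \<phi> u" "N u" "D u" by (rule frame_at[OF u])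
    have r: "pd 1 \<phi> u \<bullet> cross3 (N u) (pd 1 \<phi> u) = 0" "pd 2 \<phi> u \<bullet> cross3 (N u) (pd 2 \<phi> u) = 0"
      "pd 1 \<phi> u \<bullet> cross3 (N u) (pd 2 \<phi> u) = - D u"
      using f.rot_simps by (simp_all add: inner_commute)
    show ?thesis
      unfolding T_def e1 e2 inner_scaleR_left inner_diff_right inner_scaleR_right r f.pN f.qN using f.D by simp
  qed
  define h where "h j u = pd 2 (T j) u \<bullet> V1 u - pd 1 (T j) u \<bullet> V2 u" for j u
  have loch: "locint U (h j)" for j
  proof -
    have "locint U (\<lambda>u. pd 2 (T j) u \<bullet> V1 u + - 1 * (pd 1 (T j) u \<bullet> V2 u))"
      by (intro locint_add locint_mult[OF continuous_on_const] loc spT)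
    then show ?thesis by (simp add: h_def[abs_def])
  qed
  have wkt: "wk U j t (h j)" for j
    unfolding wk_def
  proof (intro conjI loct loch allI impI)
    fix \<psi> assume ts: "test_function U \<psi>"
    have curl: "(LINT u|lborel. pd 2 \<psi> u * (T j u \<bullet> V1 u)) - (LINT u|lborel. pd 1 \<psi> u * (T j u \<bullet> V2 u)) =
      - (LINT u|lborel. \<psi> u * h j u)" for j
      unfolding h_def by (rule wk_curl[OF w1 w2 sT ts])
    have ae0: "(LINT u|lborel. pd i \<psi> u * p u) = (LINT u|lborel. pd i \<psi> u * q u)"
      if "locint U p" "locint U q" "AE u in lborel. u \<in> U \<longrightarrow> p u = q u" for p q i
    proof (rule integral_cong_AE)
      obtain K where K: "compact K" "K \<subseteq> U" "\<And>u. u \<notin> K \<Longrightarrow> pd i \<psi> u = 0" by (rule test_functionE[OF test_pd[OF ts]]) blast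
      show "AE u in lborel. pd i \<psi> u * p u = pd i \<psi> u * q u"
        using that(3) by eventually_elim (use K in force)
      show "(\<lambda>u. pd i \<psi> u * p u) \<in> borel_measurable lborel" "(\<lambda>u. pd i \<psi> u * q u) \<in> borel_measurable lborel"
        by (rule borel_measurable_integrable[OF test_integrable[OF test_pd[OF ts]]]; rule that)+
    qed
    have ae: "AE u in lborel. u \<in> U \<longrightarrow> T 1 u \<bullet> V1 u = 0 \<and> T 2 u \<bullet> V2 u = 0 \<and> T 1 u \<bullet> V2 u = - t u"
      using eqs by eventually_elim (use frame_dots in \<open>auto simp: t_def\<close>)
    have "(LINT u|lborel. pd 2 \<psi> u * (T 1 u \<bullet> V1 u)) = (LINT u|lborel. pd 2 \<psi> u * 0)"
      by (rule ae0[OF loc(2)[OF sT] locint_zero]) (use ae in \<open>auto elim!: eventually_mono\<close>)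
    moreover have "(LINT u|lborel. pd 1 \<psi> u * (T 2 u \<bullet> V2 u)) = (LINT u|lborel. pd 1 \<psi> u * 0)"
      by (rule ae0[OF loc(3)[OF sT] locint_zero]) (use ae in \<open>auto elim!: eventually_mono\<close>)
    moreover have "(LINT u|lborel. pd 1 \<psi> u * (T 1 u \<bullet> V2 u)) = (LINT u|lborel. pd 1 \<psi> u * (- 1 * t u))"
      by (rule ae0[OF loc(3)[OF sT] locint_mult[OF continuous_on_const loct]]) (use ae in \<open>auto elim!: eventually_mono\<close>)
    ultimately show "(LINT u|lborel. pd j \<psi> u * t u) = - (LINT u|lborel. \<psi> u * h j u)"
      using curl[of 1] curl[of 2] exhaust_2[of j] by (auto simp: t_T[symmetric])
  qed
  define y :: "3 option \<Rightarrow> real^2 \<Rightarrow> real" where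
    "y p u = (case p of None \<Rightarrow> t u | Some i \<Rightarrow> W (\<phi> u) $ i)" for p u
  define A :: "2 \<Rightarrow> 3 option \<Rightarrow> 3 option \<Rightarrow> real^2 \<Rightarrow> real" where
    "A j p q u = (case p of
        None \<Rightarrow> (case q of
            None \<Rightarrow> pd 2 (T j) u \<bullet> cross3 (N u) (pd 1 \<phi> u) - pd 1 (T j) u \<bullet> cross3 (N u) (pd 2 \<phi> u)
          | Some k \<Rightarrow> (pd 1 (T j) u \<bullet> N u) * pd 2 N u $ k - (pd 2 (T j) u \<bullet> N u) * pd 1 N u $ k)
      | Some i \<Rightarrow> (case q of
            None \<Rightarrow> cross3 (N u) (pd j \<phi> u) $ i
          | Some k \<Rightarrow> - (pd j N u $ k * N u $ i)))" for j p q u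
  have sA: "smooth_on U (A j p q)" for j p q
    unfolding A_def[abs_def]
    by (cases p; cases q) (auto intro!: smooth_intros sT smooth_N smooth_\<phi>)
  have locy: "locint U (y p)" for p
    using loct wkD(1)[OF w1] by (cases p) (auto simp: y_def[abs_def])
  have locA: "locint U (\<lambda>u. \<Sum>q\<in>UNIV. A j p q u * y q u)" for j p
    by (intro locint_sum locint_mult smooth_on_continuous_on sA locy)
  have Asum: "(\<Sum>q\<in>UNIV. A j (Some i) q u * y q u) =
      (t u *\<^sub>R cross3 (N u) (pd j \<phi> u) - (W (\<phi> u) \<bullet> pd j N u) *\<^sub>R N u) $ i" for j i u
    by (simp add: sum_UNIV_option A_def y_def inner_vec_def sum_distrib_left sum_distrib_right sum_negf algebra_simps)
  have AsumN: "(\<Sum>q\<in>UNIV. A j None q u * y q u) =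
      pd 2 (T j) u \<bullet> (t u *\<^sub>R cross3 (N u) (pd 1 \<phi> u) - (W (\<phi> u) \<bullet> pd 1 N u) *\<^sub>R N u)
      - pd 1 (T j) u \<bullet> (t u *\<^sub>R cross3 (N u) (pd 2 \<phi> u) - (W (\<phi> u) \<bullet> pd 2 N u) *\<^sub>R N u)" for j u
  proof -
    have "(\<Sum>k\<in>UNIV. A j None (Some k) u * y (Some k) u) =
        (pd 1 (T j) u \<bullet> N u) * (W (\<phi> u) \<bullet> pd 2 N u) - (pd 2 (T j) u \<bullet> N u) * (W (\<phi> u) \<bullet> pd 1 N u)"
      unfolding inner_vec_def[of "W (\<phi> u)"]
      by (simp add: A_def y_def sum_distrib_left sum_subtractf[symmetric] algebra_simps)
    then show ?thesis
      by (simp add: sum_UNIV_option inner_diff_right) (simp add: A_def y_def algebra_simps)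
  qed
  have wky: "wk U j (y p) (\<lambda>u. \<Sum>q\<in>UNIV. A j p q u * y q u)" for j p
  proof (cases p)
    case None
    show ?thesis
      unfolding None
    proof (rule wk_cong_AE[OF wkt locy locA])
      show "AE u in lborel. u \<in> U \<longrightarrow> t u = y None u" by (simp add: y_def)
      show "AE u in lborel. u \<in> U \<longrightarrow> h j u = (\<Sum>q\<in>UNIV. A j None q u * y q u)"
        using eqs unfolding AsumN by eventually_elim (metis h_def t_def)
    qed
  next
    case (Some i)
    have ij: "wk U j (\<lambda>u. W (\<phi> u) $ i) (\<lambda>u. (if j = 1 then V1 u else V2 u) $ i)"
      using w1 w2 exhaust_2[of j] by auto
    show ?thesis
      unfolding Some
    proof (rule wk_cong_AE[OF ij locy locA])
      show "AE u in lborel. u \<in> U \<longrightarrow> W (\<phi> u) $ i = y (Some i) u" by (simp add: y_def)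
      show "AE u in lborel. u \<in> U \<longrightarrow> (if j = 1 then V1 u else V2 u) $ i = (\<Sum>q\<in>UNIV. A j (Some i) q u * y q u)"
        using eqs unfolding Asum
      proof eventually_elim
        case (elim u)
        then show ?case using exhaust_2[of j] unfolding t_def[symmetric] by fastforce
      qed
    qed
  qed
  obtain z where z: "\<And>p. smooth_on (box a b) (z p)" "\<And>p. AE u in lborel. u \<in> box a b \<longrightarrow> y p u = z p u"
    "\<And>p u j. u \<in> box a b \<Longrightarrow> pd j (z p) u = (\<Sum>q\<in>UNIV. A j p q u * z q u)"
    using wk_system_smooth[OF ab sA wky] by blast
  have BU: "box a b \<subseteq> U" using ab box_subset_cbox by blast
  define w :: "real^2 \<Rightarrow> real^3" where "w u = (\<chi> i. z (Some i) u)" for u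
  define \<tau> where "\<tau> = z None"
  have w_sum: "w = (\<lambda>u. \<Sum>i\<in>UNIV. z (Some i) u *\<^sub>R axis i 1)"
    by (auto simp: fun_eq_iff w_def vec_eq_iff axis_def if_distrib[of "\<lambda>x. _ * x"] cong: if_cong)
  have sw: "smooth_on (box a b) w"
    unfolding w_sum by (intro smooth_on_sum smooth_intros z open_box)
  have "AE u in lborel. \<forall>i\<in>UNIV. u \<in> box a b \<longrightarrow> y (Some i) u = z (Some i) u"
    by (rule AE_ball_countable'[OF z(2)]) (simp add: countable_finite)
  then have Ww: "AE u in lborel. u \<in> box a b \<longrightarrow> W (\<phi> u) = w u"
    by eventually_elim (auto simp: w_def y_def vec_eq_iff)
  have "killing_chart M n U \<phi> (box a b) w \<tau>"
  proof unfold_locales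
    show "open (box a b)" "box a b \<subseteq> U" "smooth_on (box a b) w" "smooth_on (box a b) \<tau>"
      using open_box BU sw z(1) by (simp_all add: \<tau>_def)
    show "pd j w u = \<tau> u *\<^sub>R cross3 (N u) (pd j \<phi> u) - (w u \<bullet> pd j N u) *\<^sub>R N u" if u: "u \<in> box a b" for u j
    proof -
      have "pd j w u $ i = (\<tau> u *\<^sub>R cross3 (N u) (pd j \<phi> u) - (w u \<bullet> pd j N u) *\<^sub>R N u) $ i" for i
      proof -
        have "pd j w u $ i = pd j (\<lambda>u. w u $ i) u"
          by (rule pd_vec_nth[symmetric, OF smooth_on_differentiable[OF sw u]])
        also have "(\<lambda>u. w u $ i) = z (Some i)" by (simp add: w_def)
        also have "pd j (z (Some i)) u = (\<Sum>q\<in>UNIV. A j (Some i) q u * z q u)" by (rule z(3)[OF u])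
        also have "\<dots> = (\<tau> u *\<^sub>R cross3 (N u) (pd j \<phi> u) - (w u \<bullet> pd j N u) *\<^sub>R N u) $ i"
          by (simp add: sum_UNIV_option A_def w_def \<tau>_def inner_vec_def sum_distrib_left sum_distrib_right sum_negf algebra_simps)
        finally show ?thesis .
      qed
      then show ?thesis by (simp add: vec_eq_iff)
    qed
    show "w u \<bullet> N u = 0" if u: "u \<in> box a b" for u
    proof (rule ccontr)
      assume ne: "w u \<bullet> N u \<noteq> 0"
      have c: "continuous_on (box a b) (\<lambda>u. w u \<bullet> N u)"
        by (intro smooth_on_continuous_on smooth_intros sw smooth_on_subset[OF smooth_N open_box BU])
      define S where "S = box a b \<inter> (\<lambda>u. w u \<bullet> N u) -` (- {0})"
      have oS: "open S" unfolding S_def by (rule continuous_open_preimage[OF c open_box]) (simp add: open_Compl)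
      have WN: "W (\<phi> v) \<bullet> N v = 0" if "v \<in> box a b" for v
      proof -
        have v: "v \<in> U" using that BU by blast
        have "W \<in> L2_fields M \<Omega>" using W by (simp add: H1_kf_def H1_def)
        then show ?thesis using tangent_orthogonal[OF v] \<Omega> v unfolding L2_fields_def by blast
      qed
      have "AE v in lborel. v \<notin> S"
      proof (rule eventually_mono[OF Ww])
        fix v assume "v \<in> box a b \<longrightarrow> W (\<phi> v) = w v"
        then show "v \<notin> S" using WN[of v] by (cases "v \<in> box a b") (simp_all add: S_def)
      qed
      then have "negligible S" by (rule negligible_AE_lborel)
      moreover have "u \<in> S" using u ne by (simp add: S_def)
      ultimately show False using open_not_negligible[OF oS] by blast
    qed
  qed
  then show ?thesis using Ww by blast
qed

end

section \<open>Unique continuation\<close>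

lemma continuous_AE_zero:
  fixes w :: "'a::euclidean_space \<Rightarrow> 'b::real_normed_vector"
  assumes S: "open S" and w: "continuous_on S w" and ae: "AE u in lborel. u \<in> S \<longrightarrow> w u = 0" and u: "u \<in> S"
  shows "w u = 0"
proof (rule ccontr)
  assume ne: "w u \<noteq> 0"
  have "open (S \<inter> w -` (- {0}))"
    by (rule continuous_open_preimage[OF w S]) (simp add: open_Compl)
  moreover have "negligible (S \<inter> w -` (- {0}))"
    by (rule negligible_AE_lborel) (use ae in \<open>auto elim!: eventually_mono\<close>)
  ultimately show False using open_not_negligible[of "S \<inter> w -` (- {0})"] u ne by blast
qed

definition kf_represented where
  "kf_represented M n \<Omega> W \<longleftrightarrow> (\<forall>U \<phi> a b. chart M n U \<phi> \<and> \<phi> ` U \<subseteq> \<Omega> \<and> cbox a b \<subseteq> U \<longrightarrow>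
     (\<exists>w \<tau>. killing_chart M n U \<phi> (box a b) w \<tau> \<and> (AE u in lborel. u \<in> box a b \<longrightarrow> W (\<phi> u) = w u)))"

lemma kf_represented_H1_kf: "W \<in> H1_kf M \<Omega> \<Longrightarrow> kf_represented M n \<Omega> W"
  unfolding kf_represented_def by (intro allI impI, elim conjE, rule chart.kf_smooth_representative)

lemma kf_representedD:
  assumes "kf_represented M n \<Omega> W" "chart M n U \<phi>" "\<phi> ` U \<subseteq> \<Omega>" "cbox a b \<subseteq> U"
  shows "\<exists>w \<tau>. killing_chart M n U \<phi> (box a b) w \<tau> \<and> (AE u in lborel. u \<in> box a b \<longrightarrow> W (\<phi> u) = w u)"
  using assms(1)[unfolded kf_represented_def, THEN spec, THEN spec, THEN spec, THEN spec, THEN mp,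
      OF conjI[OF assms(2) conjI[OF assms(3,4)]]] .

lemma kf_represented_lincomb:
  assumes "kf_represented M n \<Omega> W" "kf_represented M n \<Omega> W'"
  shows "kf_represented M n \<Omega> (\<lambda>x. c *\<^sub>R W x + c' *\<^sub>R W' x)"
  unfolding kf_represented_def
proof (intro allI impI)
  fix U \<phi> a b assume "chart M n U \<phi> \<and> \<phi> ` U \<subseteq> \<Omega> \<and> cbox a b \<subseteq> U"
  then have c: "chart M n U \<phi>" "\<phi> ` U \<subseteq> \<Omega>" "cbox a b \<subseteq> U" by simp_all
  from kf_representedD[OF assms(1) c] obtain w \<tau> where 1: "killing_chart M n U \<phi> (box a b) w \<tau>" "AE u in lborel. u \<in> box a b \<longrightarrow> W (\<phi> u) = w u"
    by (elim exE conjE)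
  from kf_representedD[OF assms(2) c] obtain w' \<tau>' where 2: "killing_chart M n U \<phi> (box a b) w' \<tau>'" "AE u in lborel. u \<in> box a b \<longrightarrow> W' (\<phi> u) = w' u"
    by (elim exE conjE)
  have "AE u in lborel. u \<in> box a b \<longrightarrow> c *\<^sub>R W (\<phi> u) + c' *\<^sub>R W' (\<phi> u) = c *\<^sub>R w u + c' *\<^sub>R w' u"
    using 1(2) 2(2) by eventually_elim simp
  with killing_chart_lincomb[OF 1(1) 2(1), of c c']
  show "\<exists>w \<tau>. killing_chart M n U \<phi> (box a b) w \<tau> \<and>
      (AE u in lborel. u \<in> box a b \<longrightarrow> c *\<^sub>R W (\<phi> u) + c' *\<^sub>R W' (\<phi> u) = w u)"
    by (intro exI conjI)
qed

lemma chart_box: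
  assumes M: "smooth_surface M" "orientation M n" and \<Omega>: "openin (top_of_set M) \<Omega>" and p: "p \<in> \<Omega>"
  shows "\<exists>U \<phi> u a b. chart M n U \<phi> \<and> \<phi> ` U \<subseteq> \<Omega> \<and> cbox a b \<subseteq> U \<and> u \<in> box a b \<and> \<phi> u = p"
proof -
  obtain U \<phi> u where U: "local_param M U \<phi>" "\<phi> ` U \<subseteq> \<Omega>" "connected U" "u \<in> U" "\<phi> u = p"
    by (rule chart_inside[OF M(1) \<Omega> p])
  obtain a b where ab: "cbox a b \<subseteq> U" "u \<in> box a b"
    by (rule open_contains_cbox[OF smooth_on_open[OF local_param_smooth[OF U(1)]] U(4)]) blast
  have "chart M n U \<phi>" using U M(2) by unfold_locales
  then show ?thesis
    using U ab by (intro exI[of _ U] exI[of _ \<phi>] exI[of _ u] exI[of _ a] exI[of _ b]) simp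
qed

lemma null_set_on_box:
  assumes lp: "local_param M U \<phi>" and ab: "cbox a b \<subseteq> U"
    and X: "X \<in> sets borel" "\<And>u. u \<in> U \<Longrightarrow> \<phi> u \<in> X \<longleftrightarrow> W (\<phi> u) \<noteq> 0"
    and w: "AE u in lborel. u \<in> box a b \<longrightarrow> W (\<phi> u) = w u" "\<And>u. u \<in> box a b \<Longrightarrow> w u = 0"
  shows "\<phi> ` box a b \<inter> X \<in> null_sets (area_measure M)"
proof -
  have BU: "box a b \<subseteq> U" using ab box_subset_cbox by blast
  note lp' = local_param_subset[OF lp open_box BU]
  show ?thesis
  proof (rule null_set_area_of_chart[OF lp'])
    show "\<phi> ` box a b \<inter> X \<in> sets borel" using borel_chart_image[OF lp'] X(1) by blast
    show "AE u in lborel. u \<in> box a b \<longrightarrow> \<phi> u \<notin> \<phi> ` box a b \<inter> X"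
      using w(1)
    proof eventually_elim
      case (elim u)
      then show ?case using w(2)[of u] X(2)[of u] BU by auto
    qed
  qed simp
qed

theorem kf_unique_continuation:
  assumes M: "smooth_surface M" "orientation M n" and \<Omega>: "openin (top_of_set M) \<Omega>" "connected \<Omega>"
    and W: "kf_represented M n \<Omega> W" "W \<in> borel_measurable (restrict_space borel \<Omega>)"
    and c: "chart M n U \<phi>" "\<phi> ` U \<subseteq> \<Omega>" "cbox a b \<subseteq> U" and k: "killing_chart M n U \<phi> (box a b) w \<tau>"
    and ae: "AE u in lborel. u \<in> box a b \<longrightarrow> W (\<phi> u) = w u"
    and u: "u \<in> box a b" "w u = 0" "\<tau> u = 0"
  shows "AE x in area_measure M. x \<in> \<Omega> \<longrightarrow> W x = 0"
proof -
  define X where "X = {x \<in> \<Omega>. W x \<noteq> 0}"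
  have b\<Omega>: "\<Omega> \<in> sets borel" by (rule borel_openin_surface[OF M(1) \<Omega>(1)])
  have "W -` (- {0}) \<inter> space (restrict_space borel \<Omega>) \<in> sets (restrict_space borel \<Omega>)"
    by (rule measurable_sets[OF W(2)]) (simp add: borel_open open_Compl)
  moreover have "W -` (- {0}) \<inter> space (restrict_space borel \<Omega>) = X"
    by (auto simp: X_def space_restrict_space)
  ultimately have bX: "X \<in> sets borel" using b\<Omega> by (simp add: sets_restrict_space_iff)
  define P where "P q \<longleftrightarrow> (\<exists>S. openin (top_of_set M) S \<and> q \<in> S \<and> S \<inter> X \<in> null_sets (area_measure M))" for q
  have Xiff: "\<phi> v \<in> X \<longleftrightarrow> W (\<phi> v) \<noteq> 0" if "\<phi> ` U \<subseteq> \<Omega>" "v \<in> U" for U v and \<phi> :: "real^2 \<Rightarrow> real^3"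
    using that by (auto simp: X_def)
  have Pbox: "P (\<phi> v)"
    if "chart M n U \<phi>" "\<phi> ` U \<subseteq> \<Omega>" "cbox a b \<subseteq> U" and v: "v \<in> box a b"
      and "AE u in lborel. u \<in> box a b \<longrightarrow> W (\<phi> u) = w u" "\<And>u. u \<in> box a b \<Longrightarrow> w u = 0" for U \<phi> a b v w
  proof -
    have lp: "local_param M U \<phi>" using that(1) by (simp add: chart_def)
    have "\<phi> ` box a b \<inter> X \<in> null_sets (area_measure M)"
      by (rule null_set_on_box[OF lp that(3) bX Xiff[OF that(2)] that(5,6)])
    moreover have "openin (top_of_set M) (\<phi> ` box a b)"
      using local_param_subset[OF lp open_box, of a b] that(3) box_subset_cbox[of a b] unfolding local_param_def by blast
    ultimately show ?thesis unfolding P_def using v by blast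
  qed
  have start: "P (\<phi> u)"
    by (rule Pbox[OF c u(1) ae]) (rule killing_chart.vanishing_on_convex[OF k convex_box(2) u])
  have "P q" if q: "q \<in> \<Omega>" for q
  proof (rule connected_induction_simple[where P = P, OF \<Omega>(2) _ q start])
    show "\<phi> u \<in> \<Omega>" using c(2,3) u(1) box_subset_cbox[of a b] by blast
    fix p assume "p \<in> \<Omega>"
    from chart_box[OF M \<Omega>(1) this]
    obtain U' \<phi>' u' a' b' where c': "chart M n U' \<phi>'" "\<phi>' ` U' \<subseteq> \<Omega>" "cbox a' b' \<subseteq> U'" "u' \<in> box a' b'" "\<phi>' u' = p"
      by (elim exE conjE)
    have lp: "local_param M U' \<phi>'" using c'(1) by (simp add: chart_def)
    have BU: "box a' b' \<subseteq> U'" using c'(3) box_subset_cbox by blast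
    have op: "openin (top_of_set M) (\<phi>' ` box a' b')"
      using local_param_subset[OF lp open_box BU] unfolding local_param_def by blast
    from kf_representedD[OF W(1) c'(1-3)] obtain w' \<tau>' where k': "killing_chart M n U' \<phi>' (box a' b') w' \<tau>'"
      and ae': "AE u in lborel. u \<in> box a' b' \<longrightarrow> W (\<phi>' u) = w' u"
      by (elim exE conjE)
    interpret k': killing_chart M n U' \<phi>' "box a' b'" w' \<tau>' by (rule k')
    have step: "P y" if x: "x \<in> \<phi>' ` box a' b'" and y: "y \<in> \<phi>' ` box a' b'" and Px: "P x" for x y
    proof -
      obtain S where S: "openin (top_of_set M) S" "x \<in> S" "S \<inter> X \<in> null_sets (area_measure M)"
        using Px unfolding P_def by blast
      obtain T where T: "open T" "S = M \<inter> T" using S(1) unfolding openin_open by blast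
      obtain v where v: "v \<in> box a' b'" "x = \<phi>' v" using x by blast
      define V where "V = box a' b' \<inter> \<phi>' -` T"
      have oV: "open V"
        unfolding V_def by (rule continuous_open_preimage[OF smooth_on_continuous_on[OF k'.s\<phi>B] open_box T(1)])
      have vV: "v \<in> V" using v S(2) T(2) by (simp add: V_def)
      have "AE u in lborel. u \<in> U' \<longrightarrow> \<phi>' u \<notin> S \<inter> X"
        by (rule AE_area_imp_AE_chart[OF lp AE_not_in[OF S(3)]])
      then have aeV: "AE u in lborel. u \<in> V \<longrightarrow> w' u = 0"
        using ae'
      proof eventually_elim
        case (elim u)
        show ?case
        proof
          assume u: "u \<in> V"
          then have uU: "u \<in> U'" "u \<in> box a' b'" using BU by (auto simp: V_def)
          have "\<phi>' u \<in> S" using u local_param_in[OF lp uU(1)] T(2) by (simp add: V_def)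
          then have "\<phi>' u \<notin> X" using elim(1) uU(1) by blast
          then show "w' u = 0" using elim(2) uU Xiff[OF c'(2) uU(1)] by simp
        qed
      qed
      have "continuous_on V w'"
        by (rule continuous_on_subset[OF smooth_on_continuous_on[OF k'.sw]]) (auto simp: V_def)
      then have wV: "w' s = 0" if "s \<in> V" for s
        by (rule continuous_AE_zero[OF oV _ aeV that])
      have "\<tau>' v = 0" by (rule k'.vanishing_tau[OF oV _ wV vV]) (simp add: V_def)
      then have "w' s = 0" if "s \<in> box a' b'" for s
        using k'.vanishing_on_convex[OF convex_box(2) v(1) wV[OF vV] _ that] by blast
      moreover obtain s where "s \<in> box a' b'" "y = \<phi>' s" using y by blast
      ultimately show ?thesis using Pbox[OF c'(1-3) _ ae', of s] by blast
    qed
    have "openin (top_of_set \<Omega>) (\<phi>' ` box a' b')"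
    proof (rule openin_subset_trans[OF op])
      show "\<phi>' ` box a' b' \<subseteq> \<Omega>" using c'(2) BU by blast
      show "\<Omega> \<subseteq> M" using \<Omega>(1) openin_imp_subset by blast
    qed
    moreover have "p \<in> \<phi>' ` box a' b'" using c'(4,5) by blast
    ultimately show "\<exists>T. openin (top_of_set \<Omega>) T \<and> p \<in> T \<and> (\<forall>x\<in>T. \<forall>y\<in>T. P x \<longrightarrow> P y)"
      using step by blast
  qed
  then have "X \<in> null_sets (area_measure M)"
    by (intro null_sets_area_local[of \<Omega>]) (auto simp: P_def X_def)
  then have "AE x in area_measure M. x \<notin> X" by (rule AE_not_in)
  then show ?thesis by (auto elim!: eventually_mono simp: X_def)
qed

context chart
begin

lemma Grad_cong:
  assumes "\<And>v. v \<in> U \<Longrightarrow> F v = F' v" "F differentiable (at u)" "u \<in> U"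
  shows "Grad F u = Grad F' u"
  unfolding Grad_def using pd_cong[OF open_U assms(3,1,2), of 1] pd_cong[OF open_U assms(3,1,2), of 2] by simp

lemma smooth_gauss_curv: "smooth_on U (\<lambda>v. gauss_curv M n (\<phi> v))"
  by (rule smooth_on_cong[OF smooth_K]) (simp add: gauss_curv_chart)

end

context killing_chart
begin

lemma w_Grad_gauss_curv: "u \<in> B \<Longrightarrow> w u \<bullet> Grad (\<lambda>v. gauss_curv M n (\<phi> v)) u = 0"
  using w_Grad_K[of u] Grad_cong[of K "\<lambda>v. gauss_curv M n (\<phi> v)" u]
    smooth_on_differentiable[OF smooth_K in_U] gauss_curv_chart in_U[of u] by simp

end

lemma zero_in_tangent_space:
  assumes "smooth_surface M" "orientation M n" "x \<in> M"
  shows "0 \<in> tangent_space M x" and "tan_proj M x 0 = 0"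
proof -
  from chart_box[OF assms(1,2) openin_subtopology_self assms(3)]
  obtain U \<phi> u a b where c: "chart M n U \<phi>" "cbox a b \<subseteq> U" "u \<in> box a b" "\<phi> u = x"
    by (elim exE conjE)
  interpret chart M n U \<phi> by (rule c(1))
  have u: "u \<in> U" using c(2,3) box_subset_cbox by blast
  show "0 \<in> tangent_space M x" using tangent_iff[OF u, of 0] c(4) by simp
  show "tan_proj M x 0 = 0" using tan_proj_chart[OF u, of 0] c(4) by simp
qed

lemma zero_in_H1_kf:
  assumes M: "smooth_surface M" "orientation M n" and \<Omega>: "openin (top_of_set M) \<Omega>"
  shows "(\<lambda>x. 0) \<in> H1_kf M \<Omega>"
proof -
  have sub: "\<Omega> \<subseteq> M" using \<Omega> openin_imp_subset by blast
  note z = zero_in_tangent_space[OF M]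
  have wp: "weak_pd U j (\<lambda>u. 0) (\<lambda>u. 0)" for U j
    by (simp add: weak_pd_def loc_integrable_def set_integrable_def set_lebesgue_integral_def)
  have "weak_cov_deriv M \<Omega> (\<lambda>x. 0) (\<lambda>x v. 0)"
    unfolding weak_cov_deriv_def
  proof (intro conjI allI impI ballI)
    show "linear (\<lambda>v::real^3. 0 :: real^3)" by (rule linear_zero)
    show "0 \<in> tangent_space M x" if "x \<in> \<Omega>" for x using z(1) that sub by blast
    fix U \<phi> j assume c: "local_param M U \<phi> \<and> \<phi> ` U \<subseteq> \<Omega>"
    have "tan_proj M (\<phi> u) 0 = 0" if "u \<in> U" for u by (rule z(2)) (use c sub that in blast)
    then show "\<exists>V. weak_pd U j ((\<lambda>x. 0) \<circ> \<phi>) V \<and> (AE u in lborel. u \<in> U \<longrightarrow> 0 = tan_proj M (\<phi> u) (V u))"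
      using wp[of U j] by (intro exI[of _ "\<lambda>u. 0"]) (simp add: comp_def)
  qed
  then have d: "H1_deriv M \<Omega> (\<lambda>x. 0) (\<lambda>x v. 0)"
    by (simp add: H1_deriv_def hs_norm2_def set_integrable_def)
  have "(\<lambda>x. 0) \<in> L2_fields M \<Omega>"
    using z(1) sub by (auto simp: L2_fields_def set_integrable_def)
  then have "(\<lambda>x. 0) \<in> H1 M \<Omega>" using d by (auto simp: H1_def)
  then show ?thesis using d by (auto simp: H1_kf_def intro!: exI[of _ "\<lambda>x v. 0"])
qed

section \<open>Killing fields and the Gaussian curvature\<close>

lemma exists_gradient_nonzero:
  assumes M: "smooth_surface M" "orientation M n" and \<Omega>: "openin (top_of_set M) \<Omega>" "connected \<Omega>"
    and nc: "\<not> gauss_curv M n constant_on \<Omega>"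
  shows "\<exists>U \<phi> u a b. chart M n U \<phi> \<and> \<phi> ` U \<subseteq> \<Omega> \<and> cbox a b \<subseteq> U \<and> u \<in> box a b \<and>
    chart.Grad n \<phi> (\<lambda>v. gauss_curv M n (\<phi> v)) u \<noteq> 0"
proof (rule ccontr)
  assume no: "\<not> ?thesis"
  have "gauss_curv M n constant_on \<Omega>"
  proof (rule locally_constant_imp_constant[OF \<Omega>(2)])
    fix p assume "p \<in> \<Omega>"
    from chart_box[OF M \<Omega>(1) this]
    obtain U \<phi> u a b where c: "chart M n U \<phi>" "\<phi> ` U \<subseteq> \<Omega>" "cbox a b \<subseteq> U" "u \<in> box a b" "\<phi> u = p"
      by (elim exE conjE)
    interpret chart M n U \<phi> by (rule c(1))
    let ?F = "\<lambda>v. gauss_curv M n (\<phi> v)"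
    have BU: "box a b \<subseteq> U" using c(3) box_subset_cbox by blast
    have "(?F has_derivative (\<lambda>h. 0)) (at v)" if v: "v \<in> box a b" for v
    proof -
      have vU: "v \<in> U" using v BU by blast
      have G: "Grad ?F v = 0" using no c(1-3) v by blast
      have "pd 1 ?F v = 0" "pd 2 ?F v = 0" using Grad_inner(1,2)[OF vU, of ?F] unfolding G by simp_all
      then show ?thesis
        using has_derivative_sum_pd[OF smooth_on_differentiable[OF smooth_gauss_curv vU]] by (simp add: sum_2)
    qed
    then have const: "?F v = ?F u" if "v \<in> box a b" for v
      using has_derivative_zero_unique[OF convex_box(2) has_derivative_at_withinI that c(4)] by blast
    have "openin (top_of_set M) (\<phi> ` box a b)"
      using local_param_subset[OF lp open_box BU] unfolding local_param_def by blast
    then have "openin (top_of_set \<Omega>) (\<phi> ` box a b)"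
    proof (rule openin_subset_trans)
      show "\<phi> ` box a b \<subseteq> \<Omega>" using c(2) BU by blast
      show "\<Omega> \<subseteq> M" using \<Omega>(1) openin_imp_subset by blast
    qed
    moreover have "p \<in> \<phi> ` box a b" using c(4,5) by blast
    moreover have "\<forall>x\<in>\<phi> ` box a b. gauss_curv M n x = gauss_curv M n p" using const c(5) by auto
    ultimately show "\<exists>T. openin (top_of_set \<Omega>) T \<and> p \<in> T \<and> (\<forall>x\<in>T. gauss_curv M n x = gauss_curv M n p)" by blast
  qed
  then show False using nc by blast
qed

lemma H1_kf_dim_le_1:
  assumes M: "smooth_surface M" "orientation M n" and \<Omega>: "openin (top_of_set M) \<Omega>" "connected \<Omega>"
    and nc: "\<not> gauss_curv M n constant_on \<Omega>"
  shows "ae_dim M \<Omega> (H1_kf M \<Omega>) \<le> 1"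
  unfolding ae_dim_def
proof (rule SUP_least)
  fix B assume "B \<in> {B. B \<subseteq> H1_kf M \<Omega> \<and> ae_independent M \<Omega> B}"
  then have B: "B \<subseteq> H1_kf M \<Omega>" "finite B"
    and ind: "\<And>c. ((\<lambda>x. \<Sum>b\<in>B. c b *\<^sub>R b x), (\<lambda>x. 0)) \<in> ae_eq M \<Omega> \<Longrightarrow> (\<forall>b\<in>B. c b = (0::real))"
    unfolding ae_independent_def by blast+
  have "b1 = b2" if b: "b1 \<in> B" "b2 \<in> B" for b1 b2
  proof (rule ccontr)
    assume ne: "b1 \<noteq> b2"
    from exists_gradient_nonzero[OF M \<Omega> nc]
    obtain U \<phi> u a b where c: "chart M n U \<phi>" "\<phi> ` U \<subseteq> \<Omega>" "cbox a b \<subseteq> U" "u \<in> box a b"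
      and G: "chart.Grad n \<phi> (\<lambda>v. gauss_curv M n (\<phi> v)) u \<noteq> 0"
      by (elim exE conjE)
    have kf: "kf_represented M n \<Omega> b1" "kf_represented M n \<Omega> b2"
      using b B(1) kf_represented_H1_kf by blast+
    from kf_representedD[OF kf(1) c(1-3)] obtain w1 \<tau>1 where k1: "killing_chart M n U \<phi> (box a b) w1 \<tau>1" "AE u in lborel. u \<in> box a b \<longrightarrow> b1 (\<phi> u) = w1 u"
      by (elim exE conjE)
    from kf_representedD[OF kf(2) c(1-3)] obtain w2 \<tau>2 where k2: "killing_chart M n U \<phi> (box a b) w2 \<tau>2" "AE u in lborel. u \<in> box a b \<longrightarrow> b2 (\<phi> u) = w2 u"
      by (elim exE conjE)
    interpret k1: killing_chart M n U \<phi> "box a b" w1 \<tau>1 by (rule k1(1))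
    interpret k2: killing_chart M n U \<phi> "box a b" w2 \<tau>2 by (rule k2(1))
    let ?F = "\<lambda>v. gauss_curv M n (\<phi> v)"
    have uU: "u \<in> U" by (rule k1.in_U[OF c(4)])
    have "\<exists>c1 c2. (c1, c2) \<noteq> (0, 0) \<and> c1 *\<^sub>R w1 u + c2 *\<^sub>R w2 u = 0"
    proof (cases "w1 u = 0")
      case True
      then show ?thesis by (intro exI[of _ 1] exI[of _ 0]) simp
    next
      case False
      have "\<exists>c. w2 u = c *\<^sub>R w1 u"
        using frame_parallel[OF k1.frame_at[OF uU] k2.wN[OF c(4)] k2.w_Grad_gauss_curv[OF c(4)]
            k1.wN[OF c(4)] k1.w_Grad_gauss_curv[OF c(4)] False k1.Grad_inner(3)[OF uU] G] .
      then obtain c where "w2 u = c *\<^sub>R w1 u" by blast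
      then show ?thesis by (intro exI[of _ c] exI[of _ "-1"]) simp
    qed
    then obtain c1 c2 where cc: "(c1, c2) \<noteq> (0, 0)" "c1 *\<^sub>R w1 u + c2 *\<^sub>R w2 u = 0" by blast
    define W where "W x = c1 *\<^sub>R b1 x + c2 *\<^sub>R b2 x" for x
    note k = killing_chart_lincomb[OF k1(1) k2(1), of c1 c2]
    have "c1 * \<tau>1 u + c2 * \<tau>2 u = 0"
      using killing_chart.tau_zero[OF k k1.smooth_gauss_curv killing_chart.w_Grad_gauss_curv[OF k] c(4) cc(2) G] .
    moreover have "AE u in lborel. u \<in> box a b \<longrightarrow> W (\<phi> u) = c1 *\<^sub>R w1 u + c2 *\<^sub>R w2 u"
      using k1(2) k2(2) by eventually_elim (simp add: W_def)
    moreover have "kf_represented M n \<Omega> W"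
      unfolding W_def[abs_def] by (rule kf_represented_lincomb[OF kf])
    moreover have "W \<in> borel_measurable (restrict_space borel \<Omega>)"
    proof -
      have "b1 \<in> borel_measurable (restrict_space borel \<Omega>)" "b2 \<in> borel_measurable (restrict_space borel \<Omega>)"
        using b B(1) unfolding H1_kf_def H1_def L2_fields_def by blast+
      then show ?thesis unfolding W_def[abs_def] by measurable
    qed
    ultimately have W0: "AE x in area_measure M. x \<in> \<Omega> \<longrightarrow> W x = 0"
      using kf_unique_continuation[OF M \<Omega> _ _ c(1-3) k _ c(4) cc(2)] by blast
    define d where "d x = (if x = b1 then c1 else if x = b2 then c2 else 0)" for x
    have dW: "(\<Sum>b\<in>B. d b *\<^sub>R b x) = W x" for x
    proof -
      have "(\<Sum>b\<in>B. d b *\<^sub>R b x) = (\<Sum>b\<in>{b1, b2}. d b *\<^sub>R b x)"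
        by (rule sum.mono_neutral_right) (use B(2) b in \<open>auto simp: d_def\<close>)
      then show ?thesis using ne by (simp add: d_def W_def)
    qed
    have "((\<lambda>x. \<Sum>b\<in>B. d b *\<^sub>R b x), (\<lambda>x. 0)) \<in> ae_eq M \<Omega>"
      unfolding ae_eq_def dW using W0 by simp
    then have "d b1 = 0" "d b2 = 0" using ind b by blast+
    then show False using cc(1) ne by (simp add: d_def)
  qed
  then have "card B \<le> Suc 0" using card_le_Suc0_iff_eq[OF B(2)] by blast
  then show "enat (card B) \<le> 1" by (simp add: one_enat_def)
qed

lemma H1_kf_trivial:
  assumes M: "smooth_surface M" "orientation M n" and \<Omega>: "openin (top_of_set M) \<Omega>" "connected \<Omega>"
    and p: "p \<in> \<Omega>" and \<kappa>: "\<kappa> = gauss_curv M n"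
    and pos: "(Q_rot M n p (surf_grad M \<kappa> p) \<bullet> surf_grad M (surf_lap M \<kappa>) p)\<^sup>2
        + (surf_hess M \<kappa> p (surf_grad M \<kappa> p) (Q_rot M n p (surf_grad M \<kappa> p)))\<^sup>2 > 0"
    and W: "W \<in> H1_kf M \<Omega>"
  shows "AE x in area_measure M. x \<in> \<Omega> \<longrightarrow> W x = 0"
proof -
  from chart_box[OF M \<Omega>(1) p]
  obtain U \<phi> u a b where c: "chart M n U \<phi>" "\<phi> ` U \<subseteq> \<Omega>" "cbox a b \<subseteq> U" "u \<in> box a b" "\<phi> u = p"
    by (elim exE conjE)
  have kf: "kf_represented M n \<Omega> W" by (rule kf_represented_H1_kf[OF W])
  from kf_representedD[OF kf c(1-3)] obtain w \<tau> where k: "killing_chart M n U \<phi> (box a b) w \<tau>" "AE u in lborel. u \<in> box a b \<longrightarrow> W (\<phi> u) = w u"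
    by (elim exE conjE)
  interpret killing_chart M n U \<phi> "box a b" w \<tau> by (rule k(1))
  define F where "F v = gauss_curv M n (\<phi> v)" for v
  have F: "smooth_on U F" unfolding F_def[abs_def] by (rule smooth_gauss_curv)
  have inv: "w v \<bullet> Grad F v = 0" if "v \<in> box a b" for v
    unfolding F_def[abs_def] by (rule w_Grad_gauss_curv[OF that])
  have u: "u \<in> U" by (rule in_U[OF c(4)])
  let ?G = "Grad F u" and ?Z = "cross3 (Grad F u) (N u)"
  have F\<kappa>: "(\<lambda>v. \<kappa> (\<phi> v)) = F" by (simp add: F_def \<kappa> fun_eq_iff)
  have g: "surf_grad M \<kappa> p = ?G"
    using surf_grad_chart[OF u, of \<kappa>] smooth_on_differentiable[OF F u] unfolding F\<kappa> c(5) .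
  have lap: "surf_lap M \<kappa> (\<phi> v) = Lap F v" if "v \<in> U" for v
    using surf_lap_chart[OF _ that, of \<kappa>] F unfolding F\<kappa> .
  have sL: "smooth_on U (\<lambda>v. surf_lap M \<kappa> (\<phi> v))"
    by (rule smooth_on_cong[OF smooth_Lap[OF F]]) (simp add: lap)
  have gl: "surf_grad M (surf_lap M \<kappa>) p = Grad (Lap F) u"
    using surf_grad_chart[OF u smooth_on_differentiable[OF sL u]]
      Grad_cong[OF lap smooth_on_differentiable[OF sL u] u] c(5) by simp
  have GN: "?G \<bullet> N u = 0" by (rule Grad_inner(3)[OF u])
  have Z: "Q_rot M n p ?G = ?Z" using Q_rot_chart[OF u GN] c(5) by simp
  have ZN: "?Z \<bullet> N u = 0" and ZG: "?Z \<bullet> ?G = 0" by (simp_all add: dot_cross_self)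
  have hess: "surf_hess M \<kappa> p ?G (s *\<^sub>R pd 1 \<phi> u + t *\<^sub>R pd 2 \<phi> u) =
      (s *\<^sub>R pd 1 (Grad F) u + t *\<^sub>R pd 2 (Grad F) u) \<bullet> ?G" for s t
    using surf_hess_chart[of \<kappa> u ?G s t] F u GN unfolding F\<kappa> c(5) by blast
  have pos': "(?Z \<bullet> Grad (Lap F) u)\<^sup>2 + (surf_hess M \<kappa> p ?G ?Z)\<^sup>2 > 0"
    using pos unfolding g gl Z .
  have G0: "?G \<noteq> 0"
  proof
    assume G: "?G = 0"
    then have "?Z = 0 *\<^sub>R pd 1 \<phi> u + 0 *\<^sub>R pd 2 \<phi> u" by simp
    then have "surf_hess M \<kappa> p ?G ?Z = 0" using hess[of 0 0] by simp
    then show False using pos' G by simp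
  qed
  have w0: "w u = 0"
  proof (rule ccontr)
    assume ne: "w u \<noteq> 0"
    obtain s where s: "?Z = s *\<^sub>R w u"
      using frame_parallel[OF frame_at[OF u] ZN ZG wN[OF c(4)] inv[OF c(4)] ne GN G0] by blast
    obtain d e where w: "w u = d *\<^sub>R pd 1 \<phi> u + e *\<^sub>R pd 2 \<phi> u"
      using frame.tangentE[OF frame_at[OF u] wN[OF c(4)]] .
    have "?Z \<bullet> Grad (Lap F) u = 0" unfolding s using w_Grad_Lap[OF F inv c(4)] by simp
    moreover have "surf_hess M \<kappa> p ?G ?Z = 0"
    proof -
      have "?Z = (s * d) *\<^sub>R pd 1 \<phi> u + (s * e) *\<^sub>R pd 2 \<phi> u" unfolding s w by (simp add: scaleR_add_right)
      then have "surf_hess M \<kappa> p ?G ?Z = s * ((d *\<^sub>R pd 1 (Grad F) u + e *\<^sub>R pd 2 (Grad F) u) \<bullet> ?G)"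
        using hess[of "s * d" "s * e"] by (simp add: inner_add_left algebra_simps)
      then show ?thesis using hess_w_Grad[OF F inv c(4) w] by simp
    qed
    ultimately show False using pos' by simp
  qed
  have "\<tau> u = 0" by (rule tau_zero[OF F inv c(4) w0 G0])
  moreover have "W \<in> borel_measurable (restrict_space borel \<Omega>)"
    using W unfolding H1_kf_def H1_def L2_fields_def by blast
  ultimately show ?thesis
    using kf_unique_continuation[OF M \<Omega> kf _ c(1-3) k c(4) w0] by blast
qed

theorem theorem2p3:
  fixes M \<Omega> :: "(real^3) set" and n :: "real^3 \<Rightarrow> real^3" and \<kappa> :: "real^3 \<Rightarrow> real"
  assumes "smooth_surface M"
    and "orientation M n"
    and "openin (top_of_set M) \<Omega>"
    and "connected \<Omega>"
  defines "\<kappa> \<equiv> gauss_curv M n"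
  shows "(\<not> \<kappa> constant_on \<Omega> \<longrightarrow> ae_dim M \<Omega> (H1_kf M \<Omega>) \<le> 1) \<and>
    ((\<exists>p\<in>\<Omega>.
        (Q_rot M n p (surf_grad M \<kappa> p) \<bullet> surf_grad M (surf_lap M \<kappa>) p)\<^sup>2
        + (surf_hess M \<kappa> p (surf_grad M \<kappa> p) (Q_rot M n p (surf_grad M \<kappa> p)))\<^sup>2 > 0)
     \<longrightarrow> H1_kf M \<Omega> // ae_eq M \<Omega> = {ae_eq M \<Omega> `` {\<lambda>x. 0}})"
proof (intro conjI impI)
  assume "\<not> \<kappa> constant_on \<Omega>"
  then show "ae_dim M \<Omega> (H1_kf M \<Omega>) \<le> 1"
    using H1_kf_dim_le_1[OF assms(1-4)] unfolding \<kappa>_def by blast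
next
  assume "\<exists>p\<in>\<Omega>.
        (Q_rot M n p (surf_grad M \<kappa> p) \<bullet> surf_grad M (surf_lap M \<kappa>) p)\<^sup>2
        + (surf_hess M \<kappa> p (surf_grad M \<kappa> p) (Q_rot M n p (surf_grad M \<kappa> p)))\<^sup>2 > 0"
  then obtain p where p: "p \<in> \<Omega>"
    "(Q_rot M n p (surf_grad M \<kappa> p) \<bullet> surf_grad M (surf_lap M \<kappa>) p)\<^sup>2
        + (surf_hess M \<kappa> p (surf_grad M \<kappa> p) (Q_rot M n p (surf_grad M \<kappa> p)))\<^sup>2 > 0" by blast
  have \<kappa>: "\<kappa> = gauss_curv M n" by (simp add: \<kappa>_def)
  have cls: "ae_eq M \<Omega> `` {W} = ae_eq M \<Omega> `` {\<lambda>x. 0}" if "W \<in> H1_kf M \<Omega>" for W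
  proof -
    have W: "AE x in area_measure M. x \<in> \<Omega> \<longrightarrow> W x = 0"
      by (rule H1_kf_trivial[OF assms(1-4) p(1) \<kappa> p(2) that])
    have "(AE x in area_measure M. x \<in> \<Omega> \<longrightarrow> W x = V x) \<longleftrightarrow> (AE x in area_measure M. x \<in> \<Omega> \<longrightarrow> 0 = V x)" for V
    proof
      assume "AE x in area_measure M. x \<in> \<Omega> \<longrightarrow> W x = V x"
      with W show "AE x in area_measure M. x \<in> \<Omega> \<longrightarrow> 0 = V x" by eventually_elim auto
    next
      assume "AE x in area_measure M. x \<in> \<Omega> \<longrightarrow> 0 = V x"
      with W show "AE x in area_measure M. x \<in> \<Omega> \<longrightarrow> W x = V x" by eventually_elim auto
    qed
    then show ?thesis unfolding ae_eq_def Image_def by simp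
  qed
  show "H1_kf M \<Omega> // ae_eq M \<Omega> = {ae_eq M \<Omega> `` {\<lambda>x. 0}}"
    unfolding quotient_def using cls zero_in_H1_kf[OF assms(1-3)] by blast
qed

end
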